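(* Let $n$ be a power of $2$, let $A\in\mathbb{R}^{n\times n}$, let $W\in\{0,1\}^{n\times n}$, let $k\ge 1$ be an integer and let $\epsilon>0$. Let $f:\{0,1\}^{\log n}\times\{0,1\}^{\log n}\to\{0,1\}$ be the function computed by $W$ and $\neg f = 1-f$ its negation. Set $k' = k\cdot 2^{R^{1\text{-sided}}_{\epsilon}(\neg f)}$. Then there is a matrix $L\in\mathbb{R}^{n\times n}$ of rank at most $k'$ with $$\|W\circ(A-L)\|_F^2 \le OPT + 2\epsilon\|A\circ W\|_F^2,$$ where $OPT=\min_{\text{rank-}k\ \hat L}\|W\circ(A-\hat L)\|_F^2$. Moreover such an $L$ is computable in $O(\mathrm{nnz}(A)) + n\cdot\mathrm{poly}(k'/\epsilon)$ time.
   Context: $\circ$ denotes the entrywise (Hadamard) product and $\mathrm{nnz}(A)$ the number of nonzero entries of $A$. The rows and columns of $W$ are indexed by strings $x,y\in\{0,1\}^{\log n}$ (binary representations of indices), and the function computed by $W$ is $f(x,y)=W_{x,y}$. Communication complexity: Alice holds $x$, Bob holds $y$, and they share a public random string $r$; after seeing $r$ they run a deterministic protocol $\Pi_r$ exchanging bits; the cost $|\Pi|$ of the randomized protocol is the maximum number of bits exchanged over all inputs and all $r$ (the output bit included). A protocol $\Pi$ for a Boolean function $g$ is a $(\delta_1,\delta_2)$-error protocol if for every $(x,y)$ with $g(x,y)=1$, $\Pr_r[\Pi_r(x,y)=g(x,y)]\ge 1-\delta_1$, and for every $(x,y)$ with $g(x,y)=0$, $\Pr_r[\Pi_r(x,y)=g(x,y)]\ge1-\delta_2$.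 $R_{\delta_1,\delta_2}(g)$ is the minimum cost of a $(\delta_1,\delta_2)$-error protocol for $g$, and the one-sided randomized communication complexity is $R^{1\text{-sided}}_{\delta}(g)=R_{0,\delta}(g)$ (the protocol never errs on inputs with $g=1$ and errs with probability at most $\delta$ on each input with $g=0$). *)

theory Defs
  imports
    "HOL-Probability.Probability_Mass_Function"
    "Jordan_Normal_Form.DL_Rank"
begin

section \<open>Matrices\<close>

definition hadamard :: "real mat \<Rightarrow> real mat \<Rightarrow> real mat" (infixl "\<circ>\<^sub>H" 75) where
  "A \<circ>\<^sub>H B = mat (dim_row A) (dim_col A) (\<lambda>(i,j). A $$ (i,j) * B $$ (i,j))"

definition frob_sq :: "real mat \<Rightarrow> real" where
  "frob_sq A = (\<Sum>i<dim_row A. \<Sum>j<dim_col A. (A $$ (i,j))\<^sup>2)"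

definition support :: "real mat \<Rightarrow> (nat \<times> nat) set" where
  "support A = {(i,j). i < dim_row A \<and> j < dim_col A \<and> A $$ (i,j) \<noteq> 0}"

definition nnz :: "real mat \<Rightarrow> nat" where
  "nnz A = card (support A)"

abbreviation mat_rank :: "real mat \<Rightarrow> nat" where
  "mat_rank A \<equiv> vec_space.rank (dim_row A) A"

text \<open>The minimum over rank-\<open>k\<close> matrices is read as the infimum over matrices of rank at most
  \<open>k\<close>; for binary weights it need not be attained.\<close>

definition masked_opt :: "nat \<Rightarrow> real mat \<Rightarrow> real mat \<Rightarrow> nat \<Rightarrow> real" where
  "masked_opt n A W k =
     (INF L \<in> {L \<in> carrier_mat n n. mat_rank L \<le> k}. frob_sq (W \<circ>\<^sub>H (A - L)))"

definition bicriteria_solution ::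
  "nat \<Rightarrow> real mat \<Rightarrow> real mat \<Rightarrow> nat \<Rightarrow> nat \<Rightarrow> real \<Rightarrow> real mat \<Rightarrow> bool" where
  "bicriteria_solution n A W k k' \<epsilon> L \<longleftrightarrow>
     L \<in> carrier_mat n n \<and> mat_rank L \<le> k' \<and>
     frob_sq (W \<circ>\<^sub>H (A - L)) \<le> masked_opt n A W k + 2 * \<epsilon> * frob_sq (A \<circ>\<^sub>H W)"


section \<open>Two-party communication with public randomness\<close>

datatype party = Alice | Bob

fun holds :: "party \<Rightarrow> bool list \<Rightarrow> bool list \<Rightarrow> bool list" where
  "holds Alice x y = x"
| "holds Bob x y = y"

text \<open>In \<open>Send p a P Q\<close> party \<open>p\<close> sends the bit \<open>a\<close> of its input and the protocol continues with
  \<open>P\<close> if that bit is true and with \<open>Q\<close> otherwise. In \<open>Final p a\<close> the bit sent is the last one,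
  and it is the output; thus the output bit is one of the bits exchanged.\<close>

datatype protocol =
    Final party "bool list \<Rightarrow> bool"
  | Send party "bool list \<Rightarrow> bool" protocol protocol

fun out_bit :: "protocol \<Rightarrow> bool list \<Rightarrow> bool list \<Rightarrow> bool" where
  "out_bit (Final p a) x y = a (holds p x y)"
| "out_bit (Send p a P Q) x y = (if a (holds p x y) then out_bit P x y else out_bit Q x y)"

fun bits :: "protocol \<Rightarrow> bool list \<Rightarrow> bool list \<Rightarrow> nat" where
  "bits (Final p a) x y = 1"
| "bits (Send p a P Q) x y = 1 + (if a (holds p x y) then bits P x y else bits Q x y)"

text \<open>A randomized protocol is a distribution \<open>R\<close> of the public random string together with a
  deterministic protocol \<open>\<pi> r\<close> for every string \<open>r\<close>. Inputs are strings of length \<open>m\<close>.\<close>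

definition error_protocol ::
  "nat \<Rightarrow> real \<Rightarrow> real \<Rightarrow> (bool list \<Rightarrow> bool list \<Rightarrow> bool) \<Rightarrow>
   bool list pmf \<Rightarrow> (bool list \<Rightarrow> protocol) \<Rightarrow> bool" where
  "error_protocol m \<delta>1 \<delta>2 g R \<pi> \<longleftrightarrow>
     (\<forall>x y. length x = m \<and> length y = m \<longrightarrow>
        (g x y \<longrightarrow> measure_pmf.prob R {r. out_bit (\<pi> r) x y = g x y} \<ge> 1 - \<delta>1) \<and>
        (\<not> g x y \<longrightarrow> measure_pmf.prob R {r. out_bit (\<pi> r) x y = g x y} \<ge> 1 - \<delta>2))"

definition cost_at_most ::
  "nat \<Rightarrow> bool list pmf \<Rightarrow> (bool list \<Rightarrow> protocol) \<Rightarrow> nat \<Rightarrow> bool" where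
  "cost_at_most m R \<pi> c \<longleftrightarrow>
     (\<forall>r\<in>set_pmf R. \<forall>x y. length x = m \<and> length y = m \<longrightarrow> bits (\<pi> r) x y \<le> c)"

definition rand_cc :: "nat \<Rightarrow> real \<Rightarrow> real \<Rightarrow> (bool list \<Rightarrow> bool list \<Rightarrow> bool) \<Rightarrow> nat" where
  "rand_cc m \<delta>1 \<delta>2 g =
     (LEAST c. \<exists>R \<pi>. error_protocol m \<delta>1 \<delta>2 g R \<pi> \<and> cost_at_most m R \<pi> c)"

definition one_sided_cc :: "nat \<Rightarrow> real \<Rightarrow> (bool list \<Rightarrow> bool list \<Rightarrow> bool) \<Rightarrow> nat" where
  "one_sided_cc m \<delta> g = rand_cc m 0 \<delta> g"

text \<open>The index with a given binary representation, most significant bit first.\<close>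

definition index_of :: "bool list \<Rightarrow> nat" where
  "index_of x = horner_sum of_bool 2 (rev x)"

definition computed_by :: "real mat \<Rightarrow> bool list \<Rightarrow> bool list \<Rightarrow> bool" where
  "computed_by W x y \<longleftrightarrow> W $$ (index_of x, index_of y) = 1"


section \<open>A randomized real RAM\<close>

text \<open>
  Memory consists of two-dimensional arrays of index registers (natural numbers) and of real
  registers; scalars are the cells with indices 0, 0. On indices only addition, truncated
  subtraction and comparison are available (there is no multiplication and no rounding of reals to
  indices, so the usual abuses of unit-cost arithmetic are excluded); on reals there are the
  field operations and comparison. The only source of randomness are fair coin flips.
\<close>

record memory =
  idx :: "string \<Rightarrow> nat \<Rightarrow> nat \<Rightarrow> nat"
  val :: "string \<Rightarrow> nat \<Rightarrow> nat \<Rightarrow> real"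

datatype iexp =
    IConst nat
  | ICell string iexp iexp
  | IAdd iexp iexp
  | ISub iexp iexp

datatype rexp =
    RIndex iexp
  | RCell string iexp iexp
  | RAdd rexp rexp
  | RSub rexp rexp
  | RMul rexp rexp
  | RDiv rexp rexp

datatype bexp =
    ILess iexp iexp
  | RLess rexp rexp
  | BNot bexp
  | BAnd bexp bexp

datatype com =
    Skip
  | IAssign string iexp iexp iexp
  | RAssign string iexp iexp rexp
  | Flip string iexp iexp
  | Seq com com
  | Cond bexp com com
  | While bexp com

fun ieval :: "memory \<Rightarrow> iexp \<Rightarrow> nat" where
  "ieval s (IConst c) = c"
| "ieval s (ICell a i j) = idx s a (ieval s i) (ieval s j)"
| "ieval s (IAdd e f) = ieval s e + ieval s f"
| "ieval s (ISub e f) = ieval s e - ieval s f"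

fun reval :: "memory \<Rightarrow> rexp \<Rightarrow> real" where
  "reval s (RIndex e) = real (ieval s e)"
| "reval s (RCell a i j) = val s a (ieval s i) (ieval s j)"
| "reval s (RAdd e f) = reval s e + reval s f"
| "reval s (RSub e f) = reval s e - reval s f"
| "reval s (RMul e f) = reval s e * reval s f"
| "reval s (RDiv e f) = reval s e / reval s f"

fun beval :: "memory \<Rightarrow> bexp \<Rightarrow> bool" where
  "beval s (ILess e f) \<longleftrightarrow> ieval s e < ieval s f"
| "beval s (RLess e f) \<longleftrightarrow> reval s e < reval s f"
| "beval s (BNot b) \<longleftrightarrow> \<not> beval s b"
| "beval s (BAnd b c) \<longleftrightarrow> beval s b \<and> beval s c"

definition upd :: "(string \<Rightarrow> nat \<Rightarrow> nat \<Rightarrow> 'v) \<Rightarrow> string \<Rightarrow> nat \<Rightarrow> nat \<Rightarrow> 'v \<Rightarrow>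
    string \<Rightarrow> nat \<Rightarrow> nat \<Rightarrow> 'v" where
  "upd m a i j v = m(a := (m a)(i := (m a i)(j := v)))"

text \<open>\<open>exec c s \<omega> t s' \<omega>'\<close>: started in memory \<open>s\<close> with the results \<open>\<omega>\<close> of the coin flips still
  to come, \<open>c\<close> halts after \<open>t\<close> steps in memory \<open>s'\<close> with \<open>\<omega>'\<close> unused. Each executed
  assignment, coin flip, test and \<open>Skip\<close> is one step; as the expressions of a program have
  bounded size, counting every single operation would change \<open>t\<close> by at most a constant factor
  depending on the program.\<close>

inductive exec :: "com \<Rightarrow> memory \<Rightarrow> bool list \<Rightarrow> nat \<Rightarrow> memory \<Rightarrow> bool list \<Rightarrow> bool" where
  Skip: "exec Skip s \<omega> 1 s \<omega>"
| IAssign: "exec (IAssign a i j e) s \<omega> 1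
    (s\<lparr>idx := upd (idx s) a (ieval s i) (ieval s j) (ieval s e)\<rparr>) \<omega>"
| RAssign: "exec (RAssign a i j e) s \<omega> 1
    (s\<lparr>val := upd (val s) a (ieval s i) (ieval s j) (reval s e)\<rparr>) \<omega>"
| Flip: "exec (Flip a i j) s (b # \<omega>) 1
    (s\<lparr>idx := upd (idx s) a (ieval s i) (ieval s j) (of_bool b)\<rparr>) \<omega>"
| Seq: "exec c s \<omega> t s' \<omega>' \<Longrightarrow> exec d s' \<omega>' u s'' \<omega>'' \<Longrightarrow>
    exec (Seq c d) s \<omega> (t + u) s'' \<omega>''"
| CondTrue: "beval s b \<Longrightarrow> exec c s \<omega> t s' \<omega>' \<Longrightarrow> exec (Cond b c d) s \<omega> (1 + t) s' \<omega>'"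
| CondFalse: "\<not> beval s b \<Longrightarrow> exec d s \<omega> t s' \<omega>' \<Longrightarrow> exec (Cond b c d) s \<omega> (1 + t) s' \<omega>'"
| WhileFalse: "\<not> beval s b \<Longrightarrow> exec (While b c) s \<omega> 1 s \<omega>"
| WhileTrue: "beval s b \<Longrightarrow> exec c s \<omega> t s' \<omega>' \<Longrightarrow> exec (While b c) s' \<omega>' u s'' \<omega>'' \<Longrightarrow>
    exec (While b c) s \<omega> (1 + t + u) s'' \<omega>''"

text \<open>The time bound \<open>T\<close> holds for every outcome of the coin flips; only the postcondition may
  fail, with probability at most \<open>\<delta>\<close>. The number \<open>l\<close> only has to be large enough for the
  program never to run out of coins (a \<open>Flip\<close> without remaining coins does not execute).\<close>

definition runs_within :: "com \<Rightarrow> memory \<Rightarrow> real \<Rightarrow> real \<Rightarrow> (memory \<Rightarrow> bool) \<Rightarrow> bool" where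
  "runs_within c s T \<delta> Q \<longleftrightarrow>
     (\<exists>l. (\<forall>\<omega>. length \<omega> = l \<longrightarrow> (\<exists>t s' \<omega>'. exec c s \<omega> t s' \<omega>' \<and> real t \<le> T)) \<and>
          measure_pmf.prob (pmf_of_set {\<omega>. length \<omega> = l})
            {\<omega>. \<exists>t s' \<omega>'. exec c s \<omega> t s' \<omega>' \<and> Q s'} \<ge> 1 - \<delta>)"

lemma exec_deterministic:
  "exec c s \<omega> t s' \<omega>' \<Longrightarrow> exec c s \<omega> u s'' \<omega>'' \<Longrightarrow> u = t \<and> s'' = s' \<and> \<omega>'' = \<omega>'"
proof (induction arbitrary: u s'' \<omega>'' rule: exec.induct)
  case (Seq c s \<omega> t s' \<omega>' d v r \<rho>)
  from Seq.prems show ?case by cases (use Seq.IH in blast)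
next
  case (WhileTrue s b c \<omega> t s' \<omega>' v r \<rho>)
  from WhileTrue.prems WhileTrue.hyps(1) show ?case
    by cases (use WhileTrue.IH in blast)+
qed (erule exec.cases; fastforce)+


section \<open>Input and output of the algorithm\<close>

text \<open>The input is \<open>n\<close>, the rank bound \<open>k'\<close>, the accuracy \<open>\<epsilon>\<close>, the nonzero entries of \<open>A\<close> as a
  list of triples in the order given by \<open>es\<close>, and \<open>W\<close> with random access. All other cells are 0.\<close>

definition input_memory ::
  "nat \<Rightarrow> nat \<Rightarrow> real \<Rightarrow> real mat \<Rightarrow> (nat \<times> nat) list \<Rightarrow> real mat \<Rightarrow> memory" where
  "input_memory n k' \<epsilon> A es W =
    \<lparr>idx = (\<lambda>a i j.
        if a = ''n'' \<and> i = 0 \<and> j = 0 then n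
        else if a = ''rank'' \<and> i = 0 \<and> j = 0 then k'
        else if a = ''nnz'' \<and> i = 0 \<and> j = 0 then length es
        else if a = ''row'' \<and> i < length es \<and> j = 0 then fst (es ! i)
        else if a = ''col'' \<and> i < length es \<and> j = 0 then snd (es ! i)
        else 0),
     val = (\<lambda>a i j.
        if a = ''eps'' \<and> i = 0 \<and> j = 0 then \<epsilon>
        else if a = ''entry'' \<and> i < length es \<and> j = 0 then A $$ (es ! i)
        else if a = ''W'' \<and> i < n \<and> j < n then W $$ (i,j)
        else 0)\<rparr>"

text \<open>The output matrix is given in factored form \<open>X Y\<^sup>T\<close>, where \<open>X\<close> and \<open>Y\<close> have \<open>r\<close> columns.
  Its \<open>n\<^sup>2\<close> entries could not be written one by one within the time bound.\<close>

definition output_matrix :: "nat \<Rightarrow> memory \<Rightarrow> real mat" where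
  "output_matrix n s =
     mat n n (\<lambda>(i,j). \<Sum>l<idx s ''r'' 0 0. val s ''X'' i l * val s ''Y'' j l)"

end

theory Submission
  imports Defs "HOL-Analysis.Convex"
begin

text \<open>
  Write \<open>M = A \<circ> W\<close>. A protocol for \<open>\<not> f\<close> that never errs where \<open>W = 0\<close> cuts a rank-\<open>k\<close> matrix \<open>L\<^sub>0\<close>, on its
  rectangles with answer 0, down to a matrix \<open>L'\<close> of rank at most \<open>k'\<close>. Entries with \<open>W = 1\<close> are lost with probability
  at most \<open>\<epsilon>\<close>, so for some outcome of the public coins \<open>\<parallel>M - L'\<parallel>\<^sup>2 \<le> \<parallel>W \<circ> (A - L\<^sub>0)\<parallel>\<^sup>2 + \<epsilon> \<parallel>M\<parallel>\<^sup>2\<close>. It remains to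
  approximate \<open>M\<close> by rank \<open>k'\<close> up to an additive error \<open>\<epsilon> \<parallel>M\<parallel>\<^sup>2\<close>.

  Two independent count sketches \<open>C = M S\<close> and \<open>D = T M\<close> into \<open>b = poly (k' / \<epsilon>)\<close> buckets cost constant time per
  nonzero entry. The greedy algorithm takes \<open>k'\<close> times an approximately top left singular vector \<open>x\<close> of
  \<open>C\<close>, found by exact power iteration on the Gram matrix started from the best unit vector, and projects it
  out of \<open>C\<close>. An interlacing argument shows that the span of these vectors captures nearly as much
  of \<open>C C\<^sup>T\<close>, hence of \<open>M M\<^sup>T\<close>, as any \<open>k'\<close>-dimensional space. The coefficients \<open>x\<^sup>T M\<close> are estimated by \<open>(T x)\<^sup>T D\<close>.
  Vectors are never normalized, since the machine has no square roots. The existence of \<open>L\<close> follows from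
  the algorithm succeeding with positive probability.
\<close>

section \<open>Orthogonality and Bessel systems in coordinates\<close>

text \<open>Soundness on the zeros of \<open>W\<close> is what removes the mask: there the cut-down
  matrix vanishes, and so does \<open>M\<close>, so the unmasked error of \<open>L'\<close> costs
  nothing outside the support of \<open>W\<close>. The factor 2 in front of \<epsilon> is one
  \<epsilon> for entries lost to the protocol and one for approximating \<open>M\<close>. Since the
  infimum defining the optimum need not be attained, the comparison is made with every competitor
  separately. The second obstacle is the machine model, which has neither square roots nor products
  of indices. The analysis of power iteration uses moments of the Gram matrix and inequalities
  against every vector \<open>z\<close>, not singular values. The number \<open>b\<close> is found
  by doubling, which also makes a bucket exactly \<open>lb\<close> coin flips. The bound
  \<open>b \<ge> K * (k' / \<epsilon>)^2\<close> serves two purposes: accuracy of both sketches, and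
  convergence of the \<open>b\<close> power steps made in each round. For \<epsilon> \<ge> 1/2 the
  zero matrix is already good enough, so the sketching analysis may take
  \<open>k' / \<epsilon>\<close> to be at least 1.\<close>

definition ip :: "nat \<Rightarrow> (nat \<Rightarrow> real) \<Rightarrow> (nat \<Rightarrow> real) \<Rightarrow> real" where
  "ip n x y = (\<Sum>i<n. x i * y i)"

lemma ip_commute: "ip n x y = ip n y x"
  by (simp add: ip_def mult.commute)

lemma ip_nonneg [simp]: "0 \<le> ip n x x"
  by (simp add: ip_def sum_nonneg)

lemma ip_zero [simp]: "ip n (\<lambda>_. 0) x = 0" "ip n x (\<lambda>_. 0) = 0"
  by (simp_all add: ip_def)

lemma ip_add: "ip n (\<lambda>i. x i + y i) z = ip n x z + ip n y z" "ip n z (\<lambda>i. x i + y i) = ip n z x + ip n z y"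
  by (simp_all add: ip_def sum.distrib algebra_simps)

lemma ip_diff: "ip n (\<lambda>i. x i - y i) z = ip n x z - ip n y z" "ip n z (\<lambda>i. x i - y i) = ip n z x - ip n z y"
  by (simp_all add: ip_def sum_subtractf algebra_simps)

lemma ip_scale: "ip n (\<lambda>i. c * x i) z = c * ip n x z" "ip n z (\<lambda>i. c * x i) = c * ip n z x"
  "ip n (\<lambda>i. x i * c) z = c * ip n x z" "ip n z (\<lambda>i. x i * c) = c * ip n z x"
  "ip n (\<lambda>i. x i / c) z = ip n x z / c" "ip n z (\<lambda>i. x i / c) = ip n z x / c"
  by (simp_all add: ip_def sum_distrib_left sum_divide_distrib algebra_simps)

lemma ip_sum: "ip n (\<lambda>i. \<Sum>l\<in>S. f l i) z = (\<Sum>l\<in>S. ip n (f l) z)"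
  "ip n z (\<lambda>i. \<Sum>l\<in>S. f l i) = (\<Sum>l\<in>S. ip n z (f l))"
  unfolding ip_def sum_distrib_left sum_distrib_right by (rule sum.swap)+

lemma ip_eq_0D:
  assumes "ip n x x = 0" "i < n" shows "x i = 0"
proof -
  have "\<forall>j\<in>{..<n}. x j * x j = 0"
    using assms(1) sum_nonneg_eq_0_iff[of "{..<n}" "\<lambda>j. x j * x j"] by (simp add: ip_def)
  then show ?thesis using assms(2) by auto
qed

lemma ip_eq_0_ip:
  assumes "ip n x x = 0" shows "ip n x y = 0"
  unfolding ip_def by (rule sum.neutral) (simp add: ip_eq_0D[OF assms])

lemma ip_cong: "(\<And>i. i < n \<Longrightarrow> x i = x' i) \<Longrightarrow> (\<And>i. i < n \<Longrightarrow> y i = y' i) \<Longrightarrow> ip n x y = ip n x' y'"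
  by (simp add: ip_def)

lemma ip_Cauchy_Schwarz: "(ip n x y)\<^sup>2 \<le> ip n x x * ip n y y"
  using Cauchy_Schwarz_ineq_sum[of x y "{..<n}"] by (simp add: ip_def power2_eq_square)

text \<open>Bessel systems stand in for orthonormal ones: the notion is stable under rotations, under dropping
  vectors and under replacing vectors by 0.\<close>

definition bessel :: "nat \<Rightarrow> nat \<Rightarrow> (nat \<Rightarrow> nat \<Rightarrow> real) \<Rightarrow> bool" where
  "bessel n m q \<longleftrightarrow> (\<forall>x. (\<Sum>l<m. (ip n (q l) x)\<^sup>2) \<le> ip n x x)"

text \<open>The Bessel inequality is tested on \<open>q l\<close> itself, whose own term is the
  square of its squared norm.\<close>

lemma bessel_norm_le_1:
  assumes "bessel n m q" "l < m" shows "ip n (q l) (q l) \<le> 1"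
proof -
  have "(ip n (q l) (q l))\<^sup>2 \<le> (\<Sum>l'<m. (ip n (q l') (q l))\<^sup>2)"
    using assms(2) by (intro member_le_sum) auto
  also have "\<dots> \<le> ip n (q l) (q l)" using assms(1) by (auto simp: bessel_def)
  finally have "ip n (q l) (q l) * ip n (q l) (q l) \<le> ip n (q l) (q l) * 1" by (simp add: power2_eq_square)
  then show ?thesis using ip_nonneg[of n "q l"] by (cases "ip n (q l) (q l) = 0") auto
qed

text \<open>Plane rotations of neighbouring vectors push the whole component along \<open>h\<close>
  into the last vector and leave the quadratic form in \<open>x\<close> unchanged. This replaces a
  change of basis when one deflated direction has to be split off.\<close>

lemma bessel_rotate:
  fixes m :: nat
  assumes "m > 0"
  shows "\<exists>q'. (\<forall>x. (\<Sum>l<m. (ip n (q' l) x)\<^sup>2) = (\<Sum>l<m. (ip n (q l) x)\<^sup>2)) \<and>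
     (\<forall>l<m - 1. ip n (q' l) h = 0)"
  using assms
proof (induction m)
  case (Suc m)
  show ?case
  proof (cases "m = 0")
    case True then show ?thesis by (intro exI[of _ q]) auto
  next
    case False
    then obtain m0 where m: "m = Suc m0" by (cases m) auto
    obtain q' where q': "\<And>x. (\<Sum>l<m. (ip n (q' l) x)\<^sup>2) = (\<Sum>l<m. (ip n (q l) x)\<^sup>2)"
      "\<And>l. l < m - 1 \<Longrightarrow> ip n (q' l) h = 0" using Suc.IH False by auto
    define a b r where "a = ip n (q' m0) h" and "b = ip n (q m) h" and "r = sqrt (a\<^sup>2 + b\<^sup>2)"
    show ?thesis
    proof (cases "r = 0")
      case True
      then have "a = 0" "b = 0" unfolding r_def by (simp_all add: sum_power2_eq_zero_iff)
      then show ?thesis using q'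
        by (intro exI[of _ "q'(m := q m)"]) (auto simp: a_def b_def m less_Suc_eq)
    next
      case False
      then have r2: "r\<^sup>2 = a\<^sup>2 + b\<^sup>2" "r\<^sup>2 > 0" by (auto simp: r_def sum_power2_gt_zero_iff)
      \<comment> \<open>Givens rotation of the pair: position \<open>m0\<close> loses its component
        along \<open>h\<close>, which becomes \<open>(b * a - a * b) / r\<close>, and position
        \<open>m\<close> receives all of it.\<close>
      define Q where "Q = q'(m0 := (\<lambda>i. (b * q' m0 i - a * q m i) / r), m := (\<lambda>i. (a * q' m0 i + b * q m i) / r))"
      have Qs: "ip n (Q l) x = (if l = m0 then (b * ip n (q' m0) x - a * ip n (q m) x) / r
          else if l = m then (a * ip n (q' m0) x + b * ip n (q m) x) / r else ip n (q' l) x)" for l x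
        by (simp add: Q_def ip_scale ip_diff ip_add m)
      have key: "((b * u - a * v) / r)\<^sup>2 + ((a * u + b * v) / r)\<^sup>2 = u\<^sup>2 + v\<^sup>2" for u v
      proof -
        have "((b * u - a * v) / r)\<^sup>2 + ((a * u + b * v) / r)\<^sup>2 = (u\<^sup>2 + v\<^sup>2) * (a\<^sup>2 + b\<^sup>2) / r\<^sup>2"
          by (simp add: power_divide add_divide_distrib[symmetric]) (simp add: power2_eq_square algebra_simps)
        moreover have "a\<^sup>2 + b\<^sup>2 \<noteq> 0" using r2 by linarith
        ultimately show ?thesis unfolding r2(1) by (metis nonzero_mult_div_cancel_right)
      qed
      have "(\<Sum>l<Suc m. (ip n (Q l) x)\<^sup>2) = (\<Sum>l<Suc m. (ip n (q l) x)\<^sup>2)" for x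
      proof -
        have "(\<Sum>l<Suc m. (ip n (Q l) x)\<^sup>2) = (\<Sum>l<m0. (ip n (q' l) x)\<^sup>2) + (ip n (q' m0) x)\<^sup>2 + (ip n (q m) x)\<^sup>2"
          using key[of "ip n (q' m0) x" "ip n (q m) x"] by (simp add: m Qs[unfolded m])
        also have "\<dots> = (\<Sum>l<m. (ip n (q' l) x)\<^sup>2) + (ip n (q m) x)\<^sup>2" by (simp add: m)
        finally show ?thesis by (simp add: q')
      qed
      moreover have "ip n (Q l) h = 0" if "l < m" for l
        using that q'(2)[of l] by (auto simp: Qs m less_Suc_eq a_def[symmetric]) (simp add: a_def b_def m)
      ultimately show ?thesis by (intro exI[of _ Q]) auto
    qed
  qed
qed simp

text \<open>The zero vector normalizes to itself, because division by 0 gives 0.\<close>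

definition normalized :: "nat \<Rightarrow> (nat \<Rightarrow> real) \<Rightarrow> nat \<Rightarrow> real" where
  "normalized n x = (\<lambda>i. x i / sqrt (ip n x x))"

lemma ip_normalized_self: "ip n (normalized n x) (normalized n x) = (if ip n x x = 0 then 0 else 1)"
  by (simp add: normalized_def ip_scale)

lemma ip_normalized: "ip n (normalized n x) y = ip n x y / sqrt (ip n x x)"
  "ip n y (normalized n x) = ip n y x / sqrt (ip n x x)"
  by (simp_all add: normalized_def ip_scale)

text \<open>Gram-Schmidt started from the last vector: \<open>q\<close> is orthonormal, up to zero
  vectors, in the span of the \<open>x l\<close>, so the left side is the squared distance of
  \<open>v\<close> to that span. The system is chosen before \<open>v\<close> and \<open>y\<close>,
  so that one system serves all columns of a matrix.\<close>

lemma bessel_projection: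
  "\<exists>q. bessel n m q \<and> (\<forall>v y. ip n v v - (\<Sum>l<m. (ip n (q l) v)\<^sup>2) \<le>
      ip n (\<lambda>i. v i - (\<Sum>l<m. x l i * y l)) (\<lambda>i. v i - (\<Sum>l<m. x l i * y l)))"
proof (induction m arbitrary: x)
  case 0
  then show ?case by (auto simp: bessel_def)
next
  case (Suc m)
  define u where "u = normalized n (x m)"
  define pr where "pr = (\<lambda>v i. v i - u i * ip n u v)"
  have u: "ip n u u = 1 \<or> (\<forall>i<n. x m i = 0) \<and> (\<forall>i. u i = 0)"
    unfolding u_def ip_normalized_self using ip_eq_0D[of n "x m"] by (auto simp: normalized_def)
  have pp: "ip n (pr v) (pr v) = ip n v v - (ip n u v)\<^sup>2" for v
  proof -
    have "ip n (pr v) (pr v) = ip n v v - 2 * (ip n u v)\<^sup>2 + ip n u u * (ip n u v)\<^sup>2"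
      by (simp add: pr_def ip_diff ip_scale ip_commute[of n v u] algebra_simps power2_eq_square)
    then show ?thesis using u by (auto simp: ip_def)
  qed
  obtain q where q: "bessel n m q" "\<And>v y. ip n v v - (\<Sum>l<m. (ip n (q l) v)\<^sup>2) \<le>
      ip n (\<lambda>i. v i - (\<Sum>l<m. pr (x l) i * y l)) (\<lambda>i. v i - (\<Sum>l<m. pr (x l) i * y l))"
    using Suc[of "\<lambda>l. pr (x l)"] by blast
  define Q where "Q = (\<lambda>l. if l < m then pr (q l) else u)"
  \<comment> \<open>The projection is self-adjoint, so testing \<open>pr (q l)\<close> against
    \<open>v\<close> is testing \<open>q l\<close> against \<open>pr v\<close>, where the induction
    hypothesis applies.\<close>
  have prs: "ip n (pr v) w = ip n v (pr w)" for v w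
    by (simp add: pr_def ip_diff ip_scale ip_commute[of n v u])
  have Qs: "(\<Sum>l<Suc m. (ip n (Q l) v)\<^sup>2) = (\<Sum>l<m. (ip n (q l) (pr v))\<^sup>2) + (ip n u v)\<^sup>2" for v
    by (simp add: Q_def prs)
  have "(\<Sum>l<m. (ip n (q l) (pr v))\<^sup>2) \<le> ip n (pr v) (pr v)" for v
    using q(1) by (auto simp: bessel_def)
  then have "bessel n (Suc m) Q" unfolding bessel_def Qs by (simp add: pp le_diff_eq)
  moreover have "ip n v v - (\<Sum>l<Suc m. (ip n (Q l) v)\<^sup>2) \<le>
      ip n (\<lambda>i. v i - (\<Sum>l<Suc m. x l i * y l)) (\<lambda>i. v i - (\<Sum>l<Suc m. x l i * y l))" for v y
  proof -
    let ?w = "\<lambda>i. v i - (\<Sum>l<Suc m. x l i * y l)"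
    have prx: "pr (x m) i = 0" if "i < n" for i
    proof (cases "ip n (x m) (x m) = 0")
      case True then show ?thesis using u that by (auto simp: pr_def u_def ip_normalized_self)
    next
      case False
      then have "sqrt (ip n (x m) (x m)) * sqrt (ip n (x m) (x m)) = ip n (x m) (x m)" by simp
      then show ?thesis using False by (simp add: pr_def u_def normalized_def ip_scale field_simps)
    qed
    have w: "pr ?w i = pr v i - (\<Sum>l<m. pr (x l) i * y l)" if "i < n" for i
    proof -
      have "pr ?w i = pr v i - (\<Sum>l<Suc m. pr (x l) i * y l)"
        by (simp add: pr_def ip_diff ip_sum ip_scale ip_add sum_distrib_left algebra_simps sum_subtractf)
      then show ?thesis using prx[OF that] by simp
    qed
    have "ip n v v - (\<Sum>l<Suc m. (ip n (Q l) v)\<^sup>2) = ip n (pr v) (pr v) - (\<Sum>l<m. (ip n (q l) (pr v))\<^sup>2)"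
      by (simp only: Qs pp)
    also have "\<dots> \<le> ip n (\<lambda>i. pr v i - (\<Sum>l<m. pr (x l) i * y l)) (\<lambda>i. pr v i - (\<Sum>l<m. pr (x l) i * y l))"
      by (rule q(2))
    also have "\<dots> = ip n (pr ?w) (pr ?w)" by (rule ip_cong[OF w[symmetric] w[symmetric]])
    also have "\<dots> \<le> ip n ?w ?w" unfolding pp by simp
    finally show ?thesis .
  qed
  ultimately show ?case by (intro exI[of _ Q] conjI allI)
qed

text \<open>The left side is the squared Frobenius product of \<Delta> with the sum \<open>Q\<close>
  of the outer products of the \<open>q l\<close> with themselves, and \<open>Q\<close> has squared
  norm at most \<open>m\<close>. Thus a Frobenius bound on the error of a Gram matrix controls the
  energy captured by any \<open>m\<close> directions, even if these were chosen depending on the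
  error.\<close>

lemma bessel_trace:
  assumes "bessel n m q"
  shows "(\<Sum>l<m. \<Sum>i<n. \<Sum>j<n. q l i * \<Delta> i j * q l j)\<^sup>2 \<le> real m * (\<Sum>i<n. \<Sum>j<n. (\<Delta> i j)\<^sup>2)"
proof -
  let ?S = "{..<n} \<times> {..<n}"
  define Q where "Q = (\<lambda>p. \<Sum>l<m. q l (fst p) * q l (snd p))"
  have "(\<Sum>l<m. \<Sum>i<n. \<Sum>j<n. q l i * \<Delta> i j * q l j) = (\<Sum>p\<in>?S. Q p * \<Delta> (fst p) (snd p))"
  proof -
    have "(\<Sum>p\<in>?S. Q p * \<Delta> (fst p) (snd p)) = (\<Sum>p\<in>?S. \<Sum>l<m. q l (fst p) * \<Delta> (fst p) (snd p) * q l (snd p))"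
      by (simp add: Q_def sum_distrib_right sum_distrib_left mult_ac)
    also have "\<dots> = (\<Sum>l<m. \<Sum>p\<in>?S. q l (fst p) * \<Delta> (fst p) (snd p) * q l (snd p))"
      by (rule sum.swap)
    finally show ?thesis by (simp add: sum.cartesian_product split_def)
  qed
  then have "(\<Sum>l<m. \<Sum>i<n. \<Sum>j<n. q l i * \<Delta> i j * q l j)\<^sup>2 \<le> (\<Sum>p\<in>?S. (Q p)\<^sup>2) * (\<Sum>p\<in>?S. (\<Delta> (fst p) (snd p))\<^sup>2)"
    using Cauchy_Schwarz_ineq_sum[of Q "\<lambda>p. \<Delta> (fst p) (snd p)" ?S] by simp
  also have "\<dots> \<le> real m * (\<Sum>p\<in>?S. (\<Delta> (fst p) (snd p))\<^sup>2)"
  proof (rule mult_right_mono)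
    show "(\<Sum>p\<in>?S. (Q p)\<^sup>2) \<le> real m"
  proof -
    \<comment> \<open>Expanding the square yields all scalar products within the system; each row of
      them is bounded by the Bessel inequality at \<open>q l\<close>.\<close>
    have "(\<Sum>p\<in>?S. (Q p)\<^sup>2) = (\<Sum>l<m. \<Sum>l'<m. (ip n (q l') (q l))\<^sup>2)"
    proof -
      have "(\<Sum>p\<in>?S. (Q p)\<^sup>2) = (\<Sum>p\<in>?S. \<Sum>l<m. \<Sum>l'<m. (q l' (fst p) * q l (fst p)) * (q l' (snd p) * q l (snd p)))"
        by (simp add: Q_def power2_eq_square sum_product algebra_simps)
      also have "\<dots> = (\<Sum>l<m. \<Sum>l'<m. \<Sum>p\<in>?S. (q l' (fst p) * q l (fst p)) * (q l' (snd p) * q l (snd p)))"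
        by (subst sum.swap, rule sum.cong[OF refl], rule sum.swap)
      also have "\<dots> = (\<Sum>l<m. \<Sum>l'<m. (ip n (q l') (q l))\<^sup>2)"
        by (simp add: ip_def power2_eq_square sum_product sum.cartesian_product split_def)
      finally show ?thesis .
    qed
    also have "\<dots> \<le> (\<Sum>l<m. 1)"
    proof (rule sum_mono)
      fix l assume "l \<in> {..<m}"
      then show "(\<Sum>l'<m. (ip n (q l') (q l))\<^sup>2) \<le> 1"
        using assms bessel_norm_le_1[OF assms, of l] unfolding bessel_def
        by (meson lessThan_iff order_trans)
    qed
    finally show ?thesis by simp
    qed
  qed (simp add: sum_nonneg)
  finally show ?thesis by (simp add: sum.cartesian_product split_def)
qed

text \<open>For a log-convex sequence starting at 1 the \<open>j\<close>-th roots of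
  \<open>a j\<close> are nondecreasing in \<open>j\<close>; this is that fact raised to the power
  \<open>j * (j + 1)\<close>, which avoids roots.\<close>

lemma log_convex_power:
  fixes a :: "nat \<Rightarrow> real"
  assumes nn: "\<And>j. a j \<ge> 0" and lc: "\<And>j. (a (Suc j))\<^sup>2 \<le> a j * a (Suc (Suc j))" and a0: "a 0 = 1"
  shows "a j ^ Suc j \<le> a (Suc j) ^ j"
proof (induction j)
  case (Suc j)
  show ?case
  proof (cases "a (Suc j) = 0")
    case False
    then have pos: "a (Suc j) > 0" using nn[of "Suc j"] by simp
    \<comment> \<open>Log-convexity is raised to the power \<open>j + 1\<close>; after the induction
      hypothesis both sides share the positive factor \<open>a (Suc j) ^ j\<close>, which
      cancels.\<close>
    have "a (Suc j) ^ j * a (Suc j) ^ Suc (Suc j) = ((a (Suc j))\<^sup>2) ^ Suc j"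
      unfolding power_mult[symmetric] power_add[symmetric] by (rule arg_cong[where f = "(^) _"]) simp
    also have "\<dots> \<le> (a j * a (Suc (Suc j))) ^ Suc j" using lc by (intro power_mono) auto
    also have "\<dots> = a j ^ Suc j * a (Suc (Suc j)) ^ Suc j" by (rule power_mult_distrib)
    also have "\<dots> \<le> a (Suc j) ^ j * a (Suc (Suc j)) ^ Suc j" using Suc nn by (intro mult_right_mono) auto
    finally show ?thesis using pos by (metis mult_le_cancel_left_pos zero_less_power)
  qed (simp add: nn)
qed (simp add: a0)

lemma log_convex_first:
  fixes a :: "nat \<Rightarrow> real"
  assumes nn: "\<And>j. a j \<ge> 0" and lc: "\<And>j. (a (Suc j))\<^sup>2 \<le> a j * a (Suc (Suc j))" and a0: "a 0 = 1"
  shows "a 1 ^ j \<le> a j"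
proof (induction j)
  case (Suc j)
  show ?case
  proof (cases "j = 0")
    case False
    have "(a 1 ^ Suc j) ^ j = (a 1 ^ j) ^ Suc j" by (simp only: power_mult[symmetric] mult.commute)
    also have "\<dots> \<le> a j ^ Suc j" using Suc nn by (intro power_mono) auto
    also have "\<dots> \<le> a (Suc j) ^ j" using log_convex_power[OF assms] .
    finally show ?thesis using nn False by (meson power_mono_iff bot_nat_0.not_eq_extremum zero_le_power)
  qed simp
qed (simp add: a0)

section \<open>Power iteration and greedy deflation\<close>

definition gram :: "nat \<Rightarrow> (nat \<Rightarrow> nat \<Rightarrow> real) \<Rightarrow> nat \<Rightarrow> nat \<Rightarrow> real" where
  "gram n E u v = (\<Sum>i<n. E i u * E i v)"

primrec mpow :: "nat \<Rightarrow> (nat \<Rightarrow> nat \<Rightarrow> real) \<Rightarrow> nat \<Rightarrow> nat \<Rightarrow> nat \<Rightarrow> real" where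
  "mpow b G 0 = (\<lambda>u v. of_bool (u = v))"
| "mpow b G (Suc q) = (\<lambda>u v. \<Sum>l<b. G u l * mpow b G q l v)"

definition mvec :: "nat \<Rightarrow> (nat \<Rightarrow> nat \<Rightarrow> real) \<Rightarrow> (nat \<Rightarrow> real) \<Rightarrow> nat \<Rightarrow> real" where
  "mvec b E y i = (\<Sum>u<b. E i u * y u)"

definition tvec :: "nat \<Rightarrow> (nat \<Rightarrow> nat \<Rightarrow> real) \<Rightarrow> (nat \<Rightarrow> real) \<Rightarrow> nat \<Rightarrow> real" where
  "tvec n E z u = ip n z (\<lambda>i. E i u)"

lemma ip_mvec: "ip n z (mvec b E y) = ip b (tvec n E z) y"
  unfolding ip_def tvec_def mvec_def sum_distrib_left sum_distrib_right
  by (subst sum.swap) (simp add: mult_ac)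

text \<open>The power of the Gram matrix applied to a vector, with each Gram factor written as
  \<open>tvec\<close> after \<open>mvec\<close>; in this form \<open>ip_mvec\<close> moves factors
  across a scalar product.\<close>

primrec iter :: "nat \<Rightarrow> nat \<Rightarrow> (nat \<Rightarrow> nat \<Rightarrow> real) \<Rightarrow> (nat \<Rightarrow> real) \<Rightarrow> nat \<Rightarrow> nat \<Rightarrow> real" where
  "iter n b E y 0 = y"
| "iter n b E y (Suc q) = tvec n E (mvec b E (iter n b E y q))"

lemma gram_mvec: "(\<Sum>l<b. gram n E u l * y l) = tvec n E (mvec b E y) u"
  unfolding gram_def ip_def tvec_def mvec_def sum_distrib_left sum_distrib_right
  by (subst sum.swap) (simp add: mult_ac)

lemma mpow_gram: "mpow b (gram n E) q u v = iter n b E (\<lambda>u. of_bool (u = v)) q u"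
  by (induction q arbitrary: u) (simp_all add: gram_mvec[symmetric])

lemma iter_linear: "u < b \<Longrightarrow> iter n b E y q u = (\<Sum>v<b. mpow b (gram n E) q u v * y v)"
proof (induction q arbitrary: u)
  case 0
  then show ?case by (simp add: of_bool_def if_distrib[of "\<lambda>x. x * _"] cong: if_cong)
next
  case (Suc q)
  have "iter n b E y (Suc q) u = (\<Sum>l<b. gram n E u l * (\<Sum>v<b. mpow b (gram n E) q l v * y v))"
    by (simp add: gram_mvec[symmetric] Suc)
  also have "\<dots> = (\<Sum>v<b. mpow b (gram n E) (Suc q) u v * y v)"
    unfolding mpow.simps sum_distrib_left sum_distrib_right by (subst sum.swap) (simp add: mult_ac)
  finally show ?case .
qed

text \<open>With \<open>G\<close> the Gram matrix, \<open>moment n b E y j\<close> is \<open>y\<^sup>T G\<^sup>j y\<close>; splitting \<open>j\<close> into halves makes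
  positivity and log-convexity instances of the Cauchy-Schwarz inequality.\<close>

definition moment :: "nat \<Rightarrow> nat \<Rightarrow> (nat \<Rightarrow> nat \<Rightarrow> real) \<Rightarrow> (nat \<Rightarrow> real) \<Rightarrow> nat \<Rightarrow> real" where
  "moment n b E y j = ip b (iter n b E y (j div 2)) (iter n b E y (Suc j div 2))"

lemma moment_even: "moment n b E y (2 * t) = ip b (iter n b E y t) (iter n b E y t)"
  by (simp add: moment_def)

lemma moment_odd: "moment n b E y (Suc (2 * t)) = ip n (mvec b E (iter n b E y t)) (mvec b E (iter n b E y t))"
  by (simp add: moment_def ip_mvec ip_commute)

lemma moment_nonneg: "0 \<le> moment n b E y j"
  by (cases "even j") (auto elim!: evenE oddE simp: moment_even moment_odd)

lemma moment_log_convex: "(moment n b E y (Suc j))\<^sup>2 \<le> moment n b E y j * moment n b E y (Suc (Suc j))"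
proof (cases "even j")
  case True
  then obtain t where "j = 2 * t" by (elim evenE)
  then show ?thesis by (simp add: moment_def ip_Cauchy_Schwarz del: iter.simps)
next
  case False
  then obtain t where j: "j = Suc (2 * t)" by (elim oddE) auto
  have e: "Suc (Suc (2 * t)) = 2 * Suc t" by simp
  have "moment n b E y (2 * Suc t) = ip n (mvec b E (iter n b E y (Suc t))) (mvec b E (iter n b E y t))"
    unfolding moment_even by (simp add: ip_mvec ip_commute)
  then show ?thesis unfolding j e moment_odd
    using ip_Cauchy_Schwarz[of n "mvec b E (iter n b E y (Suc t))" "mvec b E (iter n b E y t)"]
    by (simp only: mult.commute)
qed

text \<open>No spectral theory enters, because the comparison is with an arbitrary \<open>z\<close>.
  Let \<open>a\<close> and \<open>a'\<close> be the moment sequences of the best unit vector and of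
  the normalized vector \<open>w = tvec n E z\<close>. Cauchy-Schwarz bounds the energy of
  \<open>z\<close> by \<open>a' 1\<close> times its squared norm. Log-convexity bounds
  \<open>a' 1 ^ (2 * q)\<close> by \<open>a' (2 * q)\<close>, which is at most the squared Frobenius
  norm of the \<open>q\<close>-th power and hence at most \<open>b\<close> times the largest squared
  column norm. In the other direction the energy of the normalized \<open>x\<close> is a ratio of
  consecutive moments of \<open>a\<close>, and such ratios increase. The factor \<open>b\<close>
  lost in between is absorbed by the assumption on \<open>q\<close>.\<close>

lemma power_iteration:
  fixes \<eta> :: real
  assumes i0: "i0 < b" and best: "\<And>v. v < b \<Longrightarrow> (\<Sum>u<b. (mpow b (gram n E) q u v)\<^sup>2) \<le> (\<Sum>u<b. (mpow b (gram n E) q u i0)\<^sup>2)"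
    and \<eta>: "0 \<le> \<eta>" "\<eta> \<le> 1" and q: "(1 - \<eta>) ^ (2 * q) * real b < 1"
    and x: "x = mvec b E (\<lambda>u. mpow b (gram n E) q u i0)"
  shows "(1 - \<eta>) * (\<Sum>u<b. (ip n z (\<lambda>i. E i u))\<^sup>2) \<le> ip n z z * (\<Sum>u<b. (ip n (normalized n x) (\<lambda>i. E i u))\<^sup>2)"
proof -
  define a where "a = moment n b E (\<lambda>u. of_bool (u = i0))"
  define \<alpha> where "\<alpha> = a (2 * q)"
  have a0: "a 0 = 1" using i0
    by (simp add: a_def moment_def ip_def of_bool_def if_distrib[of "\<lambda>x. x * _"] cong: if_cong)
  have xx: "ip n x x = a (Suc (2 * q))"
    by (simp add: a_def moment_odd x mpow_gram)
  have \<alpha>: "\<alpha> = (\<Sum>u<b. (mpow b (gram n E) q u i0)\<^sup>2)"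
    by (simp add: \<alpha>_def a_def moment_even mpow_gram ip_def power2_eq_square)
  have a2: "a (Suc (Suc (2 * q))) = (\<Sum>u<b. (ip n x (\<lambda>i. E i u))\<^sup>2)"
    using moment_even[of n b E "\<lambda>u. of_bool (u = i0)" "Suc q"]
    by (simp add: a_def x mpow_gram) (simp add: ip_def tvec_def power2_eq_square)
  have nn: "0 \<le> a j" for j by (simp add: a_def moment_nonneg)
  have lc: "(a (Suc j))\<^sup>2 \<le> a j * a (Suc (Suc j))" for j by (simp add: a_def moment_log_convex)
  define cap where "cap = (\<Sum>u<b. (ip n (normalized n x) (\<lambda>i. E i u))\<^sup>2)"
  have cap: "cap = a (Suc (Suc (2 * q))) / a (Suc (2 * q))"
    by (simp add: cap_def a2 ip_normalized power_divide sum_divide_distrib xx nn)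
  define w where "w = tvec n E z"
  define W where "W = ip b w w"
  have Weq: "W = (\<Sum>u<b. (ip n z (\<lambda>i. E i u))\<^sup>2)" by (simp add: W_def w_def ip_def[of b] tvec_def power2_eq_square)
  have cap0: "cap \<ge> 0" unfolding cap_def by (simp add: sum_nonneg)
  have "(1 - \<eta>) * W \<le> ip n z z * cap"
  proof (cases "W = 0")
    case True then show ?thesis using cap0 by simp
  next
    case False
    then have Wpos: "W > 0" using ip_nonneg[of b w] unfolding W_def by linarith
    define x0 where "x0 = (\<lambda>u. w u / sqrt W)"
    define a' where "a' = moment n b E x0"
    have a'0: "a' 0 = 1" using Wpos by (simp add: a'_def moment_def x0_def ip_scale W_def[symmetric])
    have a'1: "a' 1 = ip n (mvec b E w) (mvec b E w) / W"
    proof -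
      have "mvec b E x0 = (\<lambda>i. mvec b E w i / sqrt W)"
        by (rule ext) (simp add: mvec_def x0_def sum_divide_distrib)
      then show ?thesis using moment_odd[of n b E x0 0] Wpos by (simp add: a'_def ip_scale)
    qed
    have "W\<^sup>2 \<le> ip n z z * ip n (mvec b E w) (mvec b E w)"
      using ip_Cauchy_Schwarz[of n z "mvec b E w"] by (simp add: ip_mvec W_def w_def)
    then have "W * W \<le> ip n z z * ip n (mvec b E w) (mvec b E w)" by (simp add: power2_eq_square)
    then have Wa: "W \<le> ip n z z * a' 1" using Wpos by (simp only: a'1 times_divide_eq_right pos_le_divide_eq)
    then have a'1pos: "a' 1 > 0" using Wpos mult_nonneg_nonpos[OF ip_nonneg[of n z], of "a' 1"] by linarith
    have "a' 1 ^ (2 * q) \<le> a' (2 * q)"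
      by (rule log_convex_first) (simp_all add: a'0 a'_def[symmetric] moment_nonneg[of n b E x0, folded a'_def]
          moment_log_convex[of n b E x0, folded a'_def])
    also have "a' (2 * q) = (\<Sum>u<b. (\<Sum>v<b. mpow b (gram n E) q u v * x0 v)\<^sup>2)"
      by (simp add: a'_def moment_even ip_def iter_linear power2_eq_square)
    also have "\<dots> \<le> (\<Sum>u<b. \<Sum>v<b. (mpow b (gram n E) q u v)\<^sup>2)"
    proof (rule sum_mono)
      fix u
      have "(\<Sum>v<b. (x0 v)\<^sup>2) = 1" using a'0 by (simp add: a'_def moment_def ip_def power2_eq_square)
      then show "(\<Sum>v<b. mpow b (gram n E) q u v * x0 v)\<^sup>2 \<le> (\<Sum>v<b. (mpow b (gram n E) q u v)\<^sup>2)"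
        using Cauchy_Schwarz_ineq_sum[of "mpow b (gram n E) q u" x0 "{..<b}"] by simp
    qed
    also have "\<dots> \<le> (\<Sum>v<b. \<alpha>)" by (subst sum.swap, rule sum_mono) (use best \<alpha> in auto)
    finally have up: "a' 1 ^ (2 * q) \<le> real b * \<alpha>" by simp
    then have "real b * \<alpha> > 0" using zero_less_power[OF a'1pos, of "2 * q"] by linarith
    then have \<alpha>pos: "\<alpha> > 0" by (simp add: zero_less_mult_iff)
    have qpos: "q > 0" using q i0 by (cases q) auto
    have lo: "\<alpha> ^ Suc (2 * q) \<le> a (Suc (2 * q)) ^ (2 * q)"
      unfolding \<alpha>_def by (rule log_convex_power) (use nn lc a0 in auto)
    then have "a (Suc (2 * q)) ^ (2 * q) > 0" using zero_less_power[OF \<alpha>pos, of "Suc (2 * q)"] by linarith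
    then have "a (Suc (2 * q)) \<noteq> 0" using qpos by (auto simp: power_0_left)
    then have apos: "a (Suc (2 * q)) > 0" using nn[of "Suc (2 * q)"] by linarith
    \<comment> \<open>The ratio of the moments \<open>2 * q + 1\<close> and \<open>2 * q\<close>.
      Later ratios are larger, so \<open>cap\<close> is at least \<rho>; monotone roots make \<rho>
      at least the root of order \<open>2 * q\<close> of \<alpha>.\<close>
    define \<rho> where "\<rho> = a (Suc (2 * q)) / \<alpha>"
    have "\<rho> \<le> cap" using lc[of "2 * q", folded \<alpha>_def] apos \<alpha>pos
      by (simp add: \<rho>_def cap frac_le_eq power2_eq_square divide_le_0_iff mult.commute)
    moreover have "(1 - \<eta>) * a' 1 \<le> \<rho>"
    proof (rule ccontr)
      assume "\<not> (1 - \<eta>) * a' 1 \<le> \<rho>"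
      then have "\<rho> ^ (2 * q) \<le> ((1 - \<eta>) * a' 1) ^ (2 * q)" using apos \<alpha>pos by (intro power_mono) (auto simp: \<rho>_def)
      moreover have "\<alpha> \<le> \<rho> ^ (2 * q)" using lo \<alpha>pos by (simp add: \<rho>_def power_divide pos_le_divide_eq)
      ultimately have "\<alpha> \<le> (1 - \<eta>) ^ (2 * q) * a' 1 ^ (2 * q)" by (simp add: power_mult_distrib)
      also have "\<dots> \<le> (1 - \<eta>) ^ (2 * q) * (real b * \<alpha>)" using up \<eta> by (intro mult_left_mono) auto
      also have "\<dots> = ((1 - \<eta>) ^ (2 * q) * real b) * \<alpha>" by simp
      also have "\<dots> < 1 * \<alpha>" using q \<alpha>pos by (intro mult_strict_right_mono) auto
      finally show False by simp
    qed
    ultimately have "(1 - \<eta>) * a' 1 \<le> cap" by simp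
    then have "ip n z z * ((1 - \<eta>) * a' 1) \<le> ip n z z * cap" by (intro mult_left_mono) auto
    moreover have "(1 - \<eta>) * W \<le> (1 - \<eta>) * (ip n z z * a' 1)" using Wa \<eta> by (intro mult_left_mono) auto
    ultimately show ?thesis by (simp add: mult_ac)
  qed
  then show ?thesis by (simp add: Weq cap_def)
qed

text \<open>If \<open>x a\<close> vanishes, the quotient is 0 and the step does nothing, so no case distinction is needed.\<close>

locale deflation =
  fixes n b :: nat and E :: "nat \<Rightarrow> nat \<Rightarrow> nat \<Rightarrow> real" and x y :: "nat \<Rightarrow> nat \<Rightarrow> real"
  assumes x: "\<And>a i. i < n \<Longrightarrow> x a i = mvec b (E a) (y a) i"
    and E_Suc: "\<And>a i u. i < n \<Longrightarrow> u < b \<Longrightarrow>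
      E (Suc a) i u = E a i u - x a i * (ip n (x a) (\<lambda>i. E a i u) / ip n (x a) (x a))"
begin

abbreviation "hat a \<equiv> normalized n (x a)"

lemma ip_E_Suc:
  assumes "u < b"
  shows "ip n z (\<lambda>i. E (Suc a) i u) = ip n z (\<lambda>i. E a i u) - ip n z (x a) * (ip n (x a) (\<lambda>i. E a i u) / ip n (x a) (x a))"
proof -
  have "ip n z (\<lambda>i. E (Suc a) i u) = ip n z (\<lambda>i. E a i u - x a i * (ip n (x a) (\<lambda>i. E a i u) / ip n (x a) (x a)))"
    by (rule ip_cong) (simp_all add: E_Suc assms)
  then show ?thesis by (simp add: ip_diff ip_scale)
qed

text \<open>\<open>x a\<close> is a combination of the columns of \<open>E a\<close>, so whatever is
  orthogonal to these columns is orthogonal to it.\<close>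

lemma ip_x: "ip n z (x a) = (\<Sum>u<b. ip n z (\<lambda>i. E a i u) * y a u)"
proof -
  have "ip n z (x a) = ip n z (mvec b (E a) (y a))" by (rule ip_cong) (simp_all add: x)
  then show ?thesis by (simp add: ip_mvec) (simp add: ip_def[of b] tvec_def)
qed

text \<open>The step itself removes the component along \<open>x a\<close>. Later directions are
  combinations of columns already orthogonal to \<open>x a\<close>, so subtracting multiples of them
  cannot bring it back.\<close>

lemma orth_E: "a < l \<Longrightarrow> u < b \<Longrightarrow> ip n (x a) (\<lambda>i. E l i u) = 0"
proof (induction l arbitrary: u)
  case (Suc l)
  show ?case
  proof (cases "a = l")
    case True
    then show ?thesis using ip_eq_0_ip[of n "x l"] Suc.prems by (cases "ip n (x l) (x l) = 0") (auto simp: ip_E_Suc)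
  next
    case False
    then have "a < l" using Suc.prems by simp
    then have "ip n (x a) (x l) = 0" by (simp add: ip_x Suc.IH)
    then show ?thesis using Suc \<open>a < l\<close> by (simp add: ip_E_Suc)
  qed
qed simp

lemma orth_x: "a \<noteq> l \<Longrightarrow> ip n (x a) (x l) = 0"
proof (induction a l rule: linorder_less_wlog)
  case (sym a b) then show ?case by (simp add: ip_commute)
qed (simp_all add: ip_x orth_E)

text \<open>Deflation along earlier directions is invisible to \<open>x l\<close>, which is
  orthogonal to them. Energies measured in the current residual are therefore energies in the
  original sketch.\<close>

lemma ip_x_E0: "k \<le> l \<Longrightarrow> u < b \<Longrightarrow> ip n (x l) (\<lambda>i. E k i u) = ip n (x l) (\<lambda>i. E 0 i u)"
  by (induction k) (simp_all add: ip_E_Suc orth_x)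

lemma ip_hat_E0: "u < b \<Longrightarrow> ip n (hat l) (\<lambda>i. E 0 i u) = ip n (hat l) (\<lambda>i. E l i u)"
  using ip_x_E0[of l l u] by (simp add: ip_normalized)

lemma ip_hat: "ip n (hat a) (hat l) = (if a = l \<and> ip n (x a) (x a) \<noteq> 0 then 1 else 0)"
  by (cases "a = l") (auto simp: ip_normalized_self, simp add: ip_normalized orth_x)

text \<open>Pythagoras for a system that is orthonormal except for zero vectors. Where
  \<open>hat l\<close> vanishes, a nonzero coefficient would enter the last sum without changing the
  left side; the assumption excludes this.\<close>

lemma residual:
  assumes "\<And>l. l < r \<Longrightarrow> ip n (x l) (x l) = 0 \<Longrightarrow> \<zeta> l = 0"
  shows "ip n (\<lambda>i. v i - (\<Sum>l<r. hat l i * \<zeta> l)) (\<lambda>i. v i - (\<Sum>l<r. hat l i * \<zeta> l)) =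
    ip n v v - (\<Sum>l<r. (ip n (hat l) v)\<^sup>2) + (\<Sum>l<r. (ip n (hat l) v - \<zeta> l)\<^sup>2)"
proof -
  let ?s = "\<lambda>i. \<Sum>l<r. hat l i * \<zeta> l"
  have "ip n ?s ?s = (\<Sum>l<r. \<zeta> l * (\<Sum>k<r. \<zeta> k * ip n (hat l) (hat k)))"
    by (simp add: ip_sum ip_scale sum_distrib_left mult_ac)
  also have "\<dots> = (\<Sum>l<r. (\<zeta> l)\<^sup>2)"
  proof (rule sum.cong[OF refl])
    fix l assume l: "l \<in> {..<r}"
    have "(\<Sum>k<r. \<zeta> k * ip n (hat l) (hat k)) = (\<Sum>k<r. if k = l then \<zeta> l else 0)"
      using assms[of l] l by (intro sum.cong) (auto simp: ip_hat)
    then show "\<zeta> l * (\<Sum>k<r. \<zeta> k * ip n (hat l) (hat k)) = (\<zeta> l)\<^sup>2" using l by (simp add: power2_eq_square)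
  qed
  finally have ss: "ip n ?s ?s = (\<Sum>l<r. (\<zeta> l)\<^sup>2)" .
  have vs: "ip n v ?s = (\<Sum>l<r. ip n (hat l) v * \<zeta> l)"
    by (simp add: ip_sum ip_scale ip_commute[of n v] mult_ac)
  have "ip n (\<lambda>i. v i - ?s i) (\<lambda>i. v i - ?s i) = ip n v v - 2 * ip n v ?s + ip n ?s ?s"
    by (simp add: ip_diff ip_commute[of n ?s v])
  then show ?thesis unfolding ss vs
    by (simp add: power2_diff sum.distrib sum_subtractf sum_distrib_left mult_ac)
qed

lemma bessel_hat: "bessel n r hat"
  unfolding bessel_def
proof
  fix v
  have "0 \<le> ip n v v - (\<Sum>l<r. (ip n (hat l) v)\<^sup>2) + (\<Sum>l<r. (ip n (hat l) v - ip n (hat l) v)\<^sup>2)"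
    by (subst residual[symmetric]) (auto simp: ip_normalized)
  then show "(\<Sum>l<r. (ip n (hat l) v)\<^sup>2) \<le> ip n v v" by simp
qed

text \<open>Induction on the number of competing directions. After a rotation all but one of them
  are orthogonal to \<open>x a\<close>; these do not notice the deflation and compete with the later
  rounds, while the remaining one is beaten, up to the factor, by \<open>hat a\<close>. This stands
  in for the interlacing of singular values: one deflation costs a competing system at most one
  direction.\<close>

lemma interlacing:
  assumes greedy: "\<And>a z. (1 - \<eta>) * (\<Sum>u<b. (ip n z (\<lambda>i. E a i u))\<^sup>2) \<le>
      ip n z z * (\<Sum>u<b. (ip n (hat a) (\<lambda>i. E a i u))\<^sup>2)"
    and "bessel n m q"
  shows "(1 - \<eta>) * (\<Sum>l<m. \<Sum>u<b. (ip n (q l) (\<lambda>i. E a i u))\<^sup>2) \<le>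
    (\<Sum>l<m. \<Sum>u<b. (ip n (hat (a + l)) (\<lambda>i. E (a + l) i u))\<^sup>2)"
  using assms(2)
proof (induction m arbitrary: a q)
  case (Suc m)
  obtain q' where q': "\<And>v. (\<Sum>l<Suc m. (ip n (q' l) v)\<^sup>2) = (\<Sum>l<Suc m. (ip n (q l) v)\<^sup>2)"
    "\<And>l. l < m \<Longrightarrow> ip n (q' l) (x a) = 0" using bessel_rotate[of "Suc m" n q "x a"] by auto
  have B: "bessel n (Suc m) q'" using Suc.prems unfolding bessel_def q'(1) .
  have "(\<Sum>l<m. (ip n (q' l) v)\<^sup>2) \<le> ip n v v" for v
  proof -
    have "(\<Sum>l<m. (ip n (q' l) v)\<^sup>2) \<le> (\<Sum>l<Suc m. (ip n (q' l) v)\<^sup>2)" by simp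
    also have "\<dots> \<le> ip n v v" using B unfolding bessel_def by blast
    finally show ?thesis .
  qed
  then have B': "bessel n m q'" by (simp add: bessel_def)
  define cap where "cap = (\<lambda>a. \<Sum>u<b. (ip n (hat a) (\<lambda>i. E a i u))\<^sup>2)"
  have "(\<Sum>l<Suc m. \<Sum>u<b. (ip n (q l) (\<lambda>i. E a i u))\<^sup>2) = (\<Sum>l<Suc m. \<Sum>u<b. (ip n (q' l) (\<lambda>i. E a i u))\<^sup>2)"
    by (subst (1 2) sum.swap) (simp only: q')
  also have "\<dots> = (\<Sum>l<m. \<Sum>u<b. (ip n (q' l) (\<lambda>i. E (Suc a) i u))\<^sup>2) + (\<Sum>u<b. (ip n (q' m) (\<lambda>i. E a i u))\<^sup>2)"
    by (simp add: ip_E_Suc q')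
  finally have "(1 - \<eta>) * (\<Sum>l<Suc m. \<Sum>u<b. (ip n (q l) (\<lambda>i. E a i u))\<^sup>2) =
     (1 - \<eta>) * (\<Sum>l<m. \<Sum>u<b. (ip n (q' l) (\<lambda>i. E (Suc a) i u))\<^sup>2) + (1 - \<eta>) * (\<Sum>u<b. (ip n (q' m) (\<lambda>i. E a i u))\<^sup>2)"
    by (simp add: distrib_left)
  moreover have "(1 - \<eta>) * (\<Sum>l<m. \<Sum>u<b. (ip n (q' l) (\<lambda>i. E (Suc a) i u))\<^sup>2) \<le> (\<Sum>l<m. cap (Suc a + l))"
    using Suc.IH[OF B', of "Suc a"] by (simp only: cap_def)
  moreover have "(1 - \<eta>) * (\<Sum>u<b. (ip n (q' m) (\<lambda>i. E a i u))\<^sup>2) \<le> cap a"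
  proof -
    have "cap a \<ge> 0" by (simp add: cap_def sum_nonneg)
    then have "ip n (q' m) (q' m) * cap a \<le> 1 * cap a"
      using bessel_norm_le_1[OF B, of m] by (intro mult_right_mono) auto
    then show ?thesis using greedy[of "q' m" a] unfolding cap_def by linarith
  qed
  moreover have "(\<Sum>l<Suc m. cap (a + l)) = cap a + (\<Sum>l<m. cap (Suc a + l))"
    by (subst sum.lessThan_Suc_shift) simp
  ultimately show ?case unfolding cap_def by linarith
qed simp

text \<open>The error of the competitor is at least \<open>F\<close> minus the energy captured by a
  system \<open>q\<close> for the span of the \<open>X l\<close>. That energy is compared with the
  energy of \<open>hat\<close> through the sketch: from \<open>M\<close> to \<open>E 0\<close> for
  \<open>q\<close>, by interlacing from \<open>q\<close> to \<open>hat\<close> within the sketch,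
  and back to \<open>M\<close>. The estimated coefficients \<zeta> add their own squared error by
  Pythagoras.\<close>

theorem low_rank_error:
  fixes M :: "nat \<Rightarrow> nat \<Rightarrow> real" and \<zeta> :: "nat \<Rightarrow> nat \<Rightarrow> real"
  defines "F \<equiv> \<Sum>i<n. \<Sum>j<n. (M i j)\<^sup>2"
  assumes greedy: "\<And>a z. (1 - \<epsilon> / 4) * (\<Sum>u<b. (ip n z (\<lambda>i. E a i u))\<^sup>2) \<le>
      ip n z z * (\<Sum>u<b. (ip n (hat a) (\<lambda>i. E a i u))\<^sup>2)"
    and \<epsilon>: "0 < \<epsilon>" "\<epsilon> \<le> 1"
    and \<Delta>: "real r * (\<Sum>i<n. \<Sum>j<n. (ip b (E 0 i) (E 0 j) - ip n (M i) (M j))\<^sup>2) \<le> (\<epsilon> / 8 * F)\<^sup>2"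
    and \<zeta>0: "\<And>l j. l < r \<Longrightarrow> ip n (x l) (x l) = 0 \<Longrightarrow> \<zeta> l j = 0"
    and \<zeta>: "(\<Sum>l<r. \<Sum>j<n. (ip n (hat l) (\<lambda>i. M i j) - \<zeta> l j)\<^sup>2) \<le> \<epsilon> / 2 * F"
  shows "(\<Sum>i<n. \<Sum>j<n. (M i j - (\<Sum>l<r. hat l i * \<zeta> l j))\<^sup>2) \<le>
    (\<Sum>i<n. \<Sum>j<n. (M i j - (\<Sum>l<r. X l i * Y l j))\<^sup>2) + \<epsilon> * F"
proof -
  have F0: "F \<ge> 0" by (simp add: F_def sum_nonneg)
  have F: "F = (\<Sum>j<n. ip n (\<lambda>i. M i j) (\<lambda>i. M i j))"
    unfolding F_def by (subst sum.swap) (simp add: ip_def power2_eq_square)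
  obtain q where q: "bessel n r q" "\<And>v y. ip n v v - (\<Sum>l<r. (ip n (q l) v)\<^sup>2) \<le>
      ip n (\<lambda>i. v i - (\<Sum>l<r. X l i * y l)) (\<lambda>i. v i - (\<Sum>l<r. X l i * y l))"
    using bessel_projection[of n r X] by blast
  define pM where "pM = (\<lambda>q. \<Sum>l<r. \<Sum>j<n. (ip n (q l) (\<lambda>i. M i j))\<^sup>2)"
  define pC where "pC = (\<lambda>q. \<Sum>l<r. \<Sum>u<b. (ip n (q l) (\<lambda>i. E 0 i u))\<^sup>2)"
  \<comment> \<open>Captured energy is a quadratic form in the Gram matrix of the rows, so a
    difference of energies has the shape treated by \<open>bessel_trace\<close>.\<close>
  have quad: "(\<Sum>j<c. (ip n z (\<lambda>i. N i j))\<^sup>2) = (\<Sum>i<n. \<Sum>j<n. z i * ip c (N i) (N j) * z j)" for z c N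
  proof -
    have "(\<Sum>j<c. (ip n z (\<lambda>i. N i j))\<^sup>2) = (\<Sum>u<c. \<Sum>i<n. \<Sum>j<n. z i * (N i u * N j u) * z j)"
      by (simp add: ip_def power2_eq_square sum_product mult_ac)
    also have "\<dots> = (\<Sum>i<n. \<Sum>j<n. \<Sum>u<c. z i * (N i u * N j u) * z j)"
      by (subst sum.swap, rule sum.cong[OF refl], rule sum.swap)
    finally show ?thesis by (simp add: ip_def sum_distrib_left sum_distrib_right)
  qed
  have close: "\<bar>pC h - pM h\<bar> \<le> \<epsilon> / 8 * F" if "bessel n r h" for h
  proof -
    have "pC h - pM h = (\<Sum>l<r. \<Sum>i<n. \<Sum>j<n. h l i * (ip b (E 0 i) (E 0 j) - ip n (M i) (M j)) * h l j)"
      unfolding pC_def pM_def quad by (simp add: sum_subtractf right_diff_distrib left_diff_distrib)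
    then have "(pC h - pM h)\<^sup>2 \<le> (\<epsilon> / 8 * F)\<^sup>2"
      using bessel_trace[OF that, of "\<lambda>i j. ip b (E 0 i) (E 0 j) - ip n (M i) (M j)"] \<Delta> by simp
    moreover have "0 \<le> \<epsilon> / 8 * F" using \<epsilon> F0 by simp
    ultimately show ?thesis by (simp only: power2_le_iff_abs_le)
  qed
  have g: "(1 - \<epsilon> / 4) * pC q \<le> pC hat"
    using interlacing[OF greedy q(1), of 0] by (simp add: pC_def ip_hat_E0)
  have qF: "pM q \<le> F"
  proof -
    have "pM q = (\<Sum>j<n. \<Sum>l<r. (ip n (q l) (\<lambda>i. M i j))\<^sup>2)" unfolding pM_def by (rule sum.swap)
    also have "\<dots> \<le> F" unfolding F by (rule sum_mono) (use q(1) in \<open>simp add: bessel_def\<close>)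
    finally show ?thesis .
  qed
  have c1: "pC q \<ge> pM q - \<epsilon> / 8 * F" and c2: "pM hat \<ge> pC hat - \<epsilon> / 8 * F"
    using close[OF q(1)] close[OF bessel_hat] by linarith+
  have "(1 - \<epsilon> / 4) * (pM q - \<epsilon> / 8 * F) \<le> (1 - \<epsilon> / 4) * pC q"
    by (rule mult_left_mono[OF c1]) (use \<epsilon> in simp)
  moreover have "(1 - \<epsilon> / 4) * (pM q - \<epsilon> / 8 * F) = pM q - \<epsilon> / 4 * pM q - \<epsilon> / 8 * F + \<epsilon> / 4 * (\<epsilon> / 8 * F)"
    by (simp add: field_simps)
  moreover have "\<epsilon> / 4 * pM q \<le> \<epsilon> / 4 * F" by (rule mult_left_mono[OF qF]) (use \<epsilon> in simp)
  moreover have "\<epsilon> / 4 * (\<epsilon> / 8 * F) \<ge> 0" using \<epsilon> F0 by simp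
  \<comment> \<open>The budget: \<epsilon>/8 for each of the two passages between \<open>M\<close>
    and the sketch and \<epsilon>/4 for the greedy factor make \<epsilon>/2; the coefficients use
    the other half.\<close>
  ultimately have key: "pM hat \<ge> pM q - \<epsilon> / 2 * F" using g c2 by linarith
  have pMj: "pM h = (\<Sum>j<n. \<Sum>l<r. (ip n (h l) (\<lambda>i. M i j))\<^sup>2)" for h
    unfolding pM_def by (rule sum.swap)
  have \<zeta>j: "(\<Sum>l<r. \<Sum>j<n. (ip n (hat l) (\<lambda>i. M i j) - \<zeta> l j)\<^sup>2) =
      (\<Sum>j<n. \<Sum>l<r. (ip n (hat l) (\<lambda>i. M i j) - \<zeta> l j)\<^sup>2)"
    by (rule sum.swap)
  have "(\<Sum>i<n. \<Sum>j<n. (M i j - (\<Sum>l<r. hat l i * \<zeta> l j))\<^sup>2) =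
     (\<Sum>j<n. ip n (\<lambda>i. M i j - (\<Sum>l<r. hat l i * \<zeta> l j)) (\<lambda>i. M i j - (\<Sum>l<r. hat l i * \<zeta> l j)))"
    by (subst sum.swap) (simp add: ip_def power2_eq_square)
  also have "\<dots> = F - pM hat + (\<Sum>l<r. \<Sum>j<n. (ip n (hat l) (\<lambda>i. M i j) - \<zeta> l j)\<^sup>2)"
    unfolding pMj \<zeta>j F by (simp add: residual \<zeta>0 sum.distrib sum_subtractf)
  also have "\<dots> \<le> F - pM q + \<epsilon> * F" using key \<zeta> by (simp add: algebra_simps)
  also have "F - pM q \<le> (\<Sum>j<n. ip n (\<lambda>i. M i j - (\<Sum>l<r. X l i * Y l j)) (\<lambda>i. M i j - (\<Sum>l<r. X l i * Y l j)))"
    unfolding F pMj sum_subtractf[symmetric] by (rule sum_mono, rule q(2))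
  also have "\<dots> = (\<Sum>i<n. \<Sum>j<n. (M i j - (\<Sum>l<r. X l i * Y l j))\<^sup>2)"
    unfolding ip_def by (subst sum.swap) (simp add: power2_eq_square)
  finally show ?thesis by simp
qed

end

section \<open>Averages over coin flips and count sketches\<close>

text \<open>Averages over strings of fair coins, by recursion on the length. Independence, of the
  two sketches and of the blocks within one sketch, becomes the splitting of a string in
  \<open>cavg_append\<close>.\<close>

primrec cavg :: "nat \<Rightarrow> (bool list \<Rightarrow> real) \<Rightarrow> real" where
  "cavg 0 F = F []"
| "cavg (Suc l) F = (cavg l (\<lambda>cs. F (True # cs)) + cavg l (\<lambda>cs. F (False # cs))) / 2"

lemma cavg_mono: "(\<And>cs. length cs = l \<Longrightarrow> F cs \<le> G cs) \<Longrightarrow> cavg l F \<le> cavg l G"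
  by (induction l arbitrary: F G) (auto intro!: divide_right_mono add_mono)

lemma cavg_cong: "(\<And>cs. length cs = l \<Longrightarrow> F cs = G cs) \<Longrightarrow> cavg l F = cavg l G"
  by (intro antisym cavg_mono) auto

lemma cavg_const [simp]: "cavg l (\<lambda>_. c) = c"
  by (induction l) auto

lemma cavg_add: "cavg l (\<lambda>cs. F cs + G cs) = cavg l F + cavg l G"
  by (induction l arbitrary: F G) (simp_all add: field_simps)

lemma cavg_scale: "cavg l (\<lambda>cs. c * F cs) = c * cavg l F"
  by (induction l arbitrary: F) (simp_all add: field_simps)

lemma cavg_sum: "cavg l (\<lambda>cs. \<Sum>i\<in>S. F i cs) = (\<Sum>i\<in>S. cavg l (F i))"
  by (induction S rule: infinite_finite_induct) (simp_all add: cavg_add)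

lemma cavg_append: "cavg (a + b) F = cavg a (\<lambda>u. cavg b (\<lambda>v. F (u @ v)))"
  by (induction a arbitrary: F) simp_all

lemma cavg_eq_0D: "cavg l F \<le> 0 \<Longrightarrow> (\<And>cs. F cs \<ge> 0) \<Longrightarrow> length cs = l \<Longrightarrow> F cs = 0"
proof (induction l arbitrary: F cs)
  case (Suc l)
  have nn: "cavg l (\<lambda>cs. F (c # cs)) \<ge> 0" for c
    using cavg_mono[of l "\<lambda>_. 0" "\<lambda>cs. F (c # cs)"] Suc.prems(2) by simp
  obtain c cs' where cs: "cs = c # cs'" using Suc.prems(3) by (cases cs) auto
  have "cavg l (\<lambda>cs. F (c # cs)) \<le> 0" using Suc.prems(1) nn[of True] nn[of False] by (cases c) auto
  then show ?case using Suc.IH[of "\<lambda>cs. F (c # cs)" cs'] Suc.prems by (simp add: cs)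
qed (use order_antisym in fastforce)

text \<open>The event is a strict inequality and \<open>K = 0\<close> is allowed, because the
  thresholds in the application are multiples of the squared norm of \<open>M\<close> or of its
  square, which may vanish. In that case a mean of 0 forces the nonnegative \<open>F\<close> to
  vanish on every string.\<close>

lemma cavg_Markov:
  assumes "cavg l F \<le> p * K" "\<And>cs. F cs \<ge> 0" "K \<ge> 0" "p \<ge> 0"
  shows "cavg l (\<lambda>cs. of_bool (F cs > K)) \<le> p"
proof (cases "K = 0")
  case True
  then have "cavg l (\<lambda>cs. of_bool (F cs > K)) = cavg l (\<lambda>cs. 0)"
    using cavg_eq_0D[of l F] assms by (intro cavg_cong) auto
  then show ?thesis using assms by simp
next
  case False
  then have K: "K > 0" using assms by simp
  have "cavg l (\<lambda>cs. of_bool (F cs > K)) \<le> cavg l (\<lambda>cs. (1 / K) * F cs)"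
    using K assms(2) by (intro cavg_mono) auto
  also have "\<dots> \<le> p" unfolding cavg_scale using K assms(1) by (simp add: field_simps)
  finally show ?thesis .
qed

text \<open>Counting strings translates the recursive averages into the probabilities used by
  \<open>runs_within\<close>.\<close>

lemma prob_coins: "measure_pmf.prob (pmf_of_set {cs :: bool list. length cs = l}) S = cavg l (\<lambda>cs. of_bool (cs \<in> S))"
proof -
  have fin: "finite {cs :: bool list. length cs = l}" and card: "card {cs :: bool list. length cs = l} = 2 ^ l" for l
    using finite_lists_length_eq[of "UNIV :: bool set" l] card_lists_length_eq[of "UNIV :: bool set" l] by simp_all
  have ne: "{cs :: bool list. length cs = l} \<noteq> {}" using Ex_list_of_length by auto
  have "real (card ({cs. length cs = l} \<inter> S)) = 2 ^ l * cavg l (\<lambda>cs. of_bool (cs \<in> S))"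
  proof (induction l arbitrary: S)
    case (Suc l)
    have "{cs. length cs = Suc l} \<inter> S = (#) True ` ({cs. length cs = l} \<inter> {cs. True # cs \<in> S}) \<union>
        (#) False ` ({cs. length cs = l} \<inter> {cs. False # cs \<in> S})"
      by (auto simp: length_Suc_conv image_iff) (metis (full_types))+
    moreover have "card \<dots> = card ((#) True ` ({cs. length cs = l} \<inter> {cs. True # cs \<in> S})) +
        card ((#) False ` ({cs. length cs = l} \<inter> {cs. False # cs \<in> S}))"
      by (rule card_Un_disjoint) (auto simp: fin)
    ultimately show ?case by (simp add: card_image Suc field_simps)
  next
    case 0
    have "{cs. length cs = 0} \<inter> S = (if [] \<in> S then {[]} else {})" by auto
    then show ?case by simp
  qed
  then show ?thesis by (simp add: measure_pmf_of_set[OF ne fin] card)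
qed

section \<open>Count sketches and their second moments\<close>

definition bucket :: "nat \<Rightarrow> bool list \<Rightarrow> nat" where
  "bucket = foldl (\<lambda>a c. a + a + of_bool c)"

lemma sum_split_add: "(\<Sum>u<m + n. f u) = (\<Sum>u<m. f u) + (\<Sum>u<n. f (m + u))" for m n :: nat and f :: "nat \<Rightarrow> real"
  by (induction n) simp_all

text \<open>Reading \<open>lb\<close> bits after the accumulator \<open>a\<close> reaches each of
  the \<open>2 ^ lb\<close> numbers with leading part \<open>a\<close> exactly once, so coin flips
  give an exactly uniform bucket.\<close>

lemma cavg_bucket: "cavg lb (\<lambda>v. F (bucket a v)) = (\<Sum>u<2 ^ lb. F (a * 2 ^ lb + u)) / 2 ^ lb"
proof (induction lb arbitrary: a)
  case (Suc lb)
  have "(\<Sum>u<2 ^ Suc lb. F (a * 2 ^ Suc lb + u)) =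
     (\<Sum>u<2 ^ lb. F ((a + a) * 2 ^ lb + u)) + (\<Sum>u<2 ^ lb. F ((a + a + 1) * 2 ^ lb + u))"
    using sum_split_add[of "\<lambda>u. F (a * 2 ^ Suc lb + u)" "2 ^ lb" "2 ^ lb"] by (simp add: algebra_simps mult_2)
  moreover have "bucket a (c # v) = bucket (a + a + of_bool c) v" for c v by (simp add: bucket_def)
  ultimately show ?case using Suc[of "a + a"] Suc[of "a + a + 1"] by (simp add: field_simps)
qed (simp add: bucket_def)

text \<open>Every index owns a block of \<open>lb + 1\<close> coins: the bits of its bucket, then its sign.\<close>

definition hash :: "nat \<Rightarrow> bool list \<Rightarrow> nat \<Rightarrow> nat" where
  "hash lb cs j = bucket 0 (take lb (drop (j * Suc lb) cs))"

definition sign :: "nat \<Rightarrow> bool list \<Rightarrow> nat \<Rightarrow> real" where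
  "sign lb cs j = 1 - 2 * of_bool (cs ! (j * Suc lb + lb))"

lemma block_in_prefix: "(j::nat) < n \<Longrightarrow> j * Suc lb + Suc lb \<le> n * Suc lb"
proof -
  assume "j < n"
  then have "Suc j * Suc lb \<le> n * Suc lb" by (intro mult_right_mono) auto
  then show ?thesis by simp
qed

lemma hash_append:
  assumes "length w = n * Suc lb"
  shows "j < n \<Longrightarrow> hash lb (w @ v) j = hash lb w j" and "hash lb (w @ v) n = bucket 0 (take lb v)"
  using assms block_in_prefix[of j n lb] by (simp_all add: hash_def)

lemma sign_append:
  assumes "length w = n * Suc lb"
  shows "j < n \<Longrightarrow> sign lb (w @ v) j = sign lb w j" and "sign lb (w @ v) n = 1 - 2 * of_bool (v ! lb)"
  using assms block_in_prefix[of j n lb] by (simp_all add: sign_def nth_append)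

definition sketch :: "nat \<Rightarrow> nat \<Rightarrow> bool list \<Rightarrow> (nat \<Rightarrow> real) \<Rightarrow> nat \<Rightarrow> real" where
  "sketch lb n cs x u = (\<Sum>j<n. of_bool (hash lb cs j = u) * sign lb cs j * x j)"

lemma sketch_append:
  assumes "length w = n * Suc lb"
  shows "sketch lb (Suc n) (w @ v) x u = sketch lb n w x u +
     (if bucket 0 (take lb v) = u then (1 - 2 * of_bool (v ! lb)) * x n else 0)"
proof -
  have "(\<Sum>j<n. of_bool (hash lb (w @ v) j = u) * sign lb (w @ v) j * x j) = sketch lb n w x u"
    unfolding sketch_def
    by (rule sum.cong[OF refl]) (simp add: hash_append(1)[OF assms] sign_append(1)[OF assms])
  then show ?thesis
    unfolding sketch_def[of lb "Suc n"] sum.lessThan_Suc hash_append(2)[OF assms] sign_append(2)[OF assms]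
    by (simp only: of_bool_def mult_1 mult_zero_left if_distribR) (cases "bucket 0 (take lb v) = u"; simp only: simp_thms if_True if_False mult_1 mult_zero_left add_0_right)
qed

lemma sketch_linear: "sketch lb n cs (\<lambda>j. c * x j + d * y j) u = c * sketch lb n cs x u + d * sketch lb n cs y u"
  unfolding sketch_def sum_distrib_left sum.distrib[symmetric]
  by (rule sum.cong[OF refl]) (simp only: distrib_left mult.left_commute mult.assoc)

lemma cavg_item:
  fixes F :: "nat \<Rightarrow> real \<Rightarrow> real"
  shows "cavg (Suc lb) (\<lambda>v. F (bucket 0 (take lb v)) (1 - 2 * of_bool (v ! lb))) =
    (\<Sum>h<2 ^ lb. (F h (- 1) + F h 1) / 2) / 2 ^ lb"
proof -
  have "cavg (Suc lb) (\<lambda>v. F (bucket 0 (take lb v)) (1 - 2 * of_bool (v ! lb))) =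
      cavg lb (\<lambda>u. (F (bucket 0 u) (- 1) + F (bucket 0 u) 1) / 2)"
  proof -
    have "cavg (Suc lb) (\<lambda>v. F (bucket 0 (take lb v)) (1 - 2 * of_bool (v ! lb))) =
      cavg lb (\<lambda>u. cavg 1 (\<lambda>c. F (bucket 0 (take lb (u @ c))) (1 - 2 * of_bool ((u @ c) ! lb))))"
      using cavg_append[of lb 1 "\<lambda>v. F (bucket 0 (take lb v)) (1 - 2 * of_bool (v ! lb))"]
      by (simp only: Suc_eq_plus1)
    also have "\<dots> = cavg lb (\<lambda>u. (F (bucket 0 u) (- 1) + F (bucket 0 u) 1) / 2)"
      by (rule cavg_cong) (simp add: nth_append)
    finally show ?thesis .
  qed
  then show ?thesis using cavg_bucket[of lb "\<lambda>h. (F h (- 1) + F h 1) / 2" 0] by simp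
qed

text \<open>A new index enters a single bucket \<open>h\<close>, so only the terms of that bucket
  change.\<close>

lemma sum_point_update:
  assumes "h < (b::nat)"
  shows "(\<Sum>u<b. (R u + (if h = u then c else 0)) * (S u + (if h = u then d else 0))) =
     (\<Sum>u<b. R u * S u) + c * S h + d * R h + c * (d::real)"
proof -
  have "(\<Sum>u<b. (R u + (if h = u then c else 0)) * (S u + (if h = u then d else 0))) =
     (\<Sum>u<b. R u * S u + (if h = u then c * S h + d * R h + c * d else 0))"
    by (rule sum.cong) (auto simp: algebra_simps)
  then show ?thesis using assms by (simp add: sum.distrib)
qed

text \<open>The cross term between the new index and the old content of its bucket carries a fresh
  sign and averages to 0.\<close>

lemma cavg_sketch_norm: "cavg (n * Suc lb) (\<lambda>cs. \<Sum>u<2 ^ lb. (sketch lb n cs d u)\<^sup>2) = ip n d d"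
proof (induction n)
  case (Suc n)
  have "cavg (Suc n * Suc lb) (\<lambda>cs. \<Sum>u<2 ^ lb. (sketch lb (Suc n) cs d u)\<^sup>2) =
     cavg (n * Suc lb) (\<lambda>w. cavg (Suc lb) (\<lambda>v. \<Sum>u<2 ^ lb. (sketch lb (Suc n) (w @ v) d u)\<^sup>2))"
    using cavg_append[of "n * Suc lb" "Suc lb"] by (simp only: mult_Suc add.commute)
  also have "\<dots> = cavg (n * Suc lb) (\<lambda>w. (\<Sum>u<2 ^ lb. (sketch lb n w d u)\<^sup>2) + (d n)\<^sup>2)"
  proof (rule cavg_cong)
    fix w :: "bool list" assume w: "length w = n * Suc lb"
    let ?R = "sketch lb n w d"
    have "cavg (Suc lb) (\<lambda>v. \<Sum>u<2 ^ lb. (sketch lb (Suc n) (w @ v) d u)\<^sup>2) =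
      (\<Sum>h<2 ^ lb. ((\<Sum>u<2 ^ lb. (?R u + (if h = u then - 1 * d n else 0))\<^sup>2) +
        (\<Sum>u<2 ^ lb. (?R u + (if h = u then 1 * d n else 0))\<^sup>2)) / 2) / 2 ^ lb"
      using cavg_item[of lb "\<lambda>h s. \<Sum>u<2 ^ lb. (?R u + (if h = u then s * d n else 0))\<^sup>2"]
      by (simp only: sketch_append[OF w])
    also have "\<dots> = (\<Sum>h<2 ^ lb::nat. (\<Sum>u<2 ^ lb. (?R u)\<^sup>2) + (d n)\<^sup>2) / 2 ^ lb"
      by (intro arg_cong[where f = "\<lambda>x. x / _"] sum.cong refl)
        (simp add: power2_eq_square sum_point_update)
    finally show "cavg (Suc lb) (\<lambda>v. \<Sum>u<2 ^ lb. (sketch lb (Suc n) (w @ v) d u)\<^sup>2) =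
      (\<Sum>u<2 ^ lb. (?R u)\<^sup>2) + (d n)\<^sup>2" by simp
  qed
  also have "\<dots> = ip (Suc n) d d" using Suc by (simp add: cavg_add ip_def power2_eq_square)
  finally show ?case .
qed (simp add: sketch_def ip_def)

text \<open>Peeling off the last index, the new terms of the error carry an independent sign and average, over the
  bucket, the squared norm of a sketch. This gives the second moment without counting collisions.\<close>

theorem cavg_sketch_ip:
  "cavg (n * Suc lb) (\<lambda>cs. (ip (2 ^ lb) (sketch lb n cs x) (sketch lb n cs y) - ip n x y)\<^sup>2) \<le>
    2 / 2 ^ lb * ip n x x * ip n y y"
proof (induction n)
  case (Suc n)
  define f where "f = (\<lambda>w. ip (2 ^ lb) (sketch lb n w x) (sketch lb n w y) - ip n x y)"
  define g where "g = (\<lambda>w h. x n * sketch lb n w y h + y n * sketch lb n w x h)"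
  have "cavg (Suc n * Suc lb) (\<lambda>cs. (ip (2 ^ lb) (sketch lb (Suc n) cs x) (sketch lb (Suc n) cs y) - ip (Suc n) x y)\<^sup>2) =
     cavg (n * Suc lb) (\<lambda>w. cavg (Suc lb) (\<lambda>v. (ip (2 ^ lb) (sketch lb (Suc n) (w @ v) x) (sketch lb (Suc n) (w @ v) y) - ip (Suc n) x y)\<^sup>2))"
    using cavg_append[of "n * Suc lb" "Suc lb"] by (simp only: mult_Suc add.commute)
  also have "\<dots> = cavg (n * Suc lb) (\<lambda>w. (f w)\<^sup>2 + 1 / 2 ^ lb * (\<Sum>h<2 ^ lb. (g w h)\<^sup>2))"
  proof (rule cavg_cong)
    fix w :: "bool list" assume w: "length w = n * Suc lb"
    let ?X = "sketch lb n w x" and ?Y = "sketch lb n w y"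
    define G where "G = (\<lambda>h s. ((\<Sum>u<2 ^ lb. (?X u + (if h = u then s * x n else 0)) * (?Y u + (if h = u then s * y n else 0))) - ip (Suc n) x y)\<^sup>2)"
    \<comment> \<open>The product of the two new terms is \<open>x n * y n\<close>, exactly the
      growth of the true scalar product. What remains of the change is \<open>s * g w h\<close>, and
      averaging the square over both signs leaves the sum of two squares.\<close>
    have G: "G h s = (f w + s * g w h)\<^sup>2" if "h < 2 ^ lb" "s * s = 1" for h s
    proof -
      have e: "s * x n * (s * y n) = x n * y n" using that(2) by (metis mult.assoc mult.left_commute mult_1)
      show ?thesis unfolding G_def sum_point_update[OF that(1)] e
        by (simp add: f_def g_def ip_def algebra_simps)
    qed
    have "cavg (Suc lb) (\<lambda>v. (ip (2 ^ lb) (sketch lb (Suc n) (w @ v) x) (sketch lb (Suc n) (w @ v) y) - ip (Suc n) x y)\<^sup>2) =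
       cavg (Suc lb) (\<lambda>v. G (bucket 0 (take lb v)) (1 - 2 * of_bool (v ! lb)))"
      unfolding G_def ip_def[of "2 ^ lb"] sketch_append[OF w] ..
    also have "\<dots> = (\<Sum>h<2 ^ lb. (G h (- 1) + G h 1) / 2) / 2 ^ lb" by (rule cavg_item)
    also have "\<dots> = (\<Sum>h<2 ^ lb::nat. (f w)\<^sup>2 + (g w h)\<^sup>2) / 2 ^ lb"
      by (intro arg_cong[where f = "\<lambda>x. x / _"] sum.cong refl) (simp add: G power2_eq_square algebra_simps)
    finally show "cavg (Suc lb) (\<lambda>v. (ip (2 ^ lb) (sketch lb (Suc n) (w @ v) x) (sketch lb (Suc n) (w @ v) y) - ip (Suc n) x y)\<^sup>2) =
       (f w)\<^sup>2 + 1 / 2 ^ lb * (\<Sum>h<2 ^ lb. (g w h)\<^sup>2)"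
      by (simp add: sum.distrib add_divide_distrib)
  qed
  also have "\<dots> = cavg (n * Suc lb) (\<lambda>w. (f w)\<^sup>2) + 1 / 2 ^ lb * cavg (n * Suc lb) (\<lambda>w. \<Sum>h<2 ^ lb. (g w h)\<^sup>2)"
    by (simp only: cavg_add cavg_scale)
  \<comment> \<open>By linearity \<open>g\<close> is the sketch of one fixed vector, and its squares
    summed over the buckets average to the squared norm of that vector.\<close>
  also have "cavg (n * Suc lb) (\<lambda>w. \<Sum>h<2 ^ lb. (g w h)\<^sup>2) = (\<Sum>j<n. (x n * y j + y n * x j)\<^sup>2)"
    using cavg_sketch_norm[of n lb "\<lambda>j. x n * y j + y n * x j"]
    unfolding g_def by (simp only: sketch_linear) (simp add: ip_def power2_eq_square)
  also have "\<dots> \<le> (\<Sum>j<n. 2 * (x n)\<^sup>2 * (y j * y j) + 2 * (y n)\<^sup>2 * (x j * x j))"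
  proof (rule sum_mono)
    fix j
    show "(x n * y j + y n * x j)\<^sup>2 \<le> 2 * (x n)\<^sup>2 * (y j * y j) + 2 * (y n)\<^sup>2 * (x j * x j)"
      using sum_squares_bound[of "x n * y j" "y n * x j"] by (simp add: power2_eq_square algebra_simps)
  qed
  also have "\<dots> = 2 * (x n)\<^sup>2 * ip n y y + 2 * (y n)\<^sup>2 * ip n x x"
    by (simp add: ip_def sum.distrib sum_distrib_left)
  finally have "cavg (Suc n * Suc lb) (\<lambda>cs. (ip (2 ^ lb) (sketch lb (Suc n) cs x) (sketch lb (Suc n) cs y) - ip (Suc n) x y)\<^sup>2)
    \<le> cavg (n * Suc lb) (\<lambda>w. (f w)\<^sup>2) + 1 / 2 ^ lb * (2 * (x n)\<^sup>2 * ip n y y + 2 * (y n)\<^sup>2 * ip n x x)"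
    by (simp add: divide_right_mono)
  also have "\<dots> \<le> 2 / 2 ^ lb * ip n x x * ip n y y + 1 / 2 ^ lb * (2 * (x n)\<^sup>2 * ip n y y + 2 * (y n)\<^sup>2 * ip n x x)"
    using Suc by (simp add: f_def)
  also have "\<dots> = 2 / 2 ^ lb * (ip n x x * ip n y y + (x n)\<^sup>2 * ip n y y + (y n)\<^sup>2 * ip n x x)"
    by (simp add: field_simps)
  also have "\<dots> \<le> 2 / 2 ^ lb * (ip (Suc n) x x * ip (Suc n) y y)"
  proof -
    have "ip (Suc n) x x * ip (Suc n) y y = ip n x x * ip n y y + (x n)\<^sup>2 * ip n y y + (y n)\<^sup>2 * ip n x x + (x n)\<^sup>2 * (y n)\<^sup>2"
      by (simp add: ip_def power2_eq_square algebra_simps)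
    then show ?thesis by (intro mult_left_mono) auto
  qed
  finally show ?case by (simp only: mult.assoc)
qed (simp add: sketch_def ip_def)

text \<open>\<open>H\<close> may depend on the coins of the first sketch: the second sketch has
  fresh coins, so its bound holds for each value of the first half. The union bound then adds
  \<delta>/2 and \<delta>/2.\<close>

theorem cavg_sketch_good:
  fixes n lb r :: nat and \<epsilon> \<delta> K :: real and M :: "nat \<Rightarrow> nat \<Rightarrow> real" and H :: "bool list \<Rightarrow> nat \<Rightarrow> nat \<Rightarrow> real"
  defines "F \<equiv> \<Sum>i<n. \<Sum>j<n. (M i j)\<^sup>2"
  defines "bad1 \<equiv> \<lambda>cs. (\<epsilon> / 8 * F)\<^sup>2 < real r * (\<Sum>i<n. \<Sum>j<n.
      (ip (2 ^ lb) (sketch lb n cs (M i)) (sketch lb n cs (M j)) - ip n (M i) (M j))\<^sup>2)"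
  defines "bad2 \<equiv> \<lambda>cs cs'. \<epsilon> / 2 * F < (\<Sum>l<r. \<Sum>j<n.
      (ip (2 ^ lb) (sketch lb n cs' (H cs l)) (sketch lb n cs' (\<lambda>i. M i j)) - ip n (H cs l) (\<lambda>i. M i j))\<^sup>2)"
  assumes \<epsilon>: "0 < \<epsilon>" "\<epsilon> \<le> 1" and r: "r \<ge> 1" and \<delta>: "\<delta> > 0" "\<delta> * K \<ge> 256"
    and lb: "2 ^ lb \<ge> K * (real r / \<epsilon>)\<^sup>2" and H: "\<And>cs l. ip n (H cs l) (H cs l) \<le> 1"
  shows "cavg (n * Suc lb + n * Suc lb) (\<lambda>cs. of_bool (bad1 (take (n * Suc lb) cs) \<or>
     bad2 (take (n * Suc lb) cs) (drop (n * Suc lb) cs))) \<le> \<delta>"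
proof -
  have F0: "F \<ge> 0" by (simp add: F_def sum_nonneg)
  have rows: "(\<Sum>i<n. ip n (M i) (M i)) = F" by (simp add: F_def ip_def power2_eq_square)
  have cols: "(\<Sum>j<n. ip n (\<lambda>i. M i j) (\<lambda>i. M i j)) = F"
    unfolding F_def ip_def by (subst sum.swap) (simp add: power2_eq_square)
  have "\<delta> * 2 ^ lb \<ge> \<delta> * (K * (real r / \<epsilon>)\<^sup>2)" using \<delta> lb by (intro mult_left_mono) auto
  moreover have "\<delta> * K * (real r / \<epsilon>)\<^sup>2 \<ge> 256 * (real r / \<epsilon>)\<^sup>2" using \<delta> by (intro mult_right_mono) auto
  ultimately have big: "\<delta> * 2 ^ lb * \<epsilon>\<^sup>2 \<ge> 256 * (real r)\<^sup>2"
    using \<epsilon> by (simp add: power_divide field_simps)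
  have rr: "real r \<le> (real r)\<^sup>2" using r by (simp add: power2_eq_square)
  have big1: "256 * real r \<le> \<delta> * 2 ^ lb * \<epsilon>\<^sup>2" using big rr by linarith
  have ee: "\<epsilon>\<^sup>2 \<le> \<epsilon>" using \<epsilon> by (simp add: power2_eq_square)
  have p1: "cavg (n * Suc lb) (\<lambda>cs. of_bool (bad1 cs)) \<le> \<delta> / 2"
    unfolding bad1_def
  proof (rule cavg_Markov)
    have "cavg (n * Suc lb) (\<lambda>cs. real r * (\<Sum>i<n. \<Sum>j<n.
      (ip (2 ^ lb) (sketch lb n cs (M i)) (sketch lb n cs (M j)) - ip n (M i) (M j))\<^sup>2)) \<le>
      real r * (\<Sum>i<n. \<Sum>j<n. 2 / 2 ^ lb * ip n (M i) (M i) * ip n (M j) (M j))"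
      unfolding cavg_scale cavg_sum by (intro mult_left_mono sum_mono cavg_sketch_ip) simp
    also have "\<dots> = real r * (2 / 2 ^ lb) * (F * F)"
      by (simp add: rows[symmetric] sum_product sum_distrib_left mult_ac)
    \<comment> \<open>The origin of 256: a factor 2 from the second moment of the sketch, 2 from
      halving \<delta>, and 64 from the square of \<epsilon>/8.\<close>
    also have "\<dots> \<le> \<delta> / 2 * (\<epsilon> / 8)\<^sup>2 * (F * F)"
    proof (rule mult_right_mono)
      show "real r * (2 / 2 ^ lb) \<le> \<delta> / 2 * (\<epsilon> / 8)\<^sup>2"
        using big1 by (simp add: power_divide field_simps)
    qed (use F0 in simp)
    finally show "cavg (n * Suc lb) (\<lambda>cs. real r * (\<Sum>i<n. \<Sum>j<n.
      (ip (2 ^ lb) (sketch lb n cs (M i)) (sketch lb n cs (M j)) - ip n (M i) (M j))\<^sup>2)) \<le> \<delta> / 2 * (\<epsilon> / 8 * F)\<^sup>2"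
      by (simp only: power_mult_distrib power2_eq_square mult_ac)
  qed (use \<delta> in \<open>auto intro!: mult_nonneg_nonneg sum_nonneg\<close>)
  have p2: "cavg (n * Suc lb) (\<lambda>cs'. of_bool (bad2 cs cs')) \<le> \<delta> / 2" for cs
    unfolding bad2_def
  proof (rule cavg_Markov)
    have "cavg (n * Suc lb) (\<lambda>cs'. \<Sum>l<r. \<Sum>j<n.
      (ip (2 ^ lb) (sketch lb n cs' (H cs l)) (sketch lb n cs' (\<lambda>i. M i j)) - ip n (H cs l) (\<lambda>i. M i j))\<^sup>2) \<le>
      (\<Sum>l<r. \<Sum>j<n. 2 / 2 ^ lb * ip n (H cs l) (H cs l) * ip n (\<lambda>i. M i j) (\<lambda>i. M i j))"
      unfolding cavg_sum by (intro sum_mono cavg_sketch_ip)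
    also have "\<dots> \<le> (\<Sum>l<r. \<Sum>j<n. 2 / 2 ^ lb * 1 * ip n (\<lambda>i. M i j) (\<lambda>i. M i j))"
      by (intro sum_mono mult_right_mono mult_left_mono H) auto
    also have "\<dots> = real r * (2 / 2 ^ lb) * F"
      by (simp add: cols[symmetric] sum_distrib_left mult_ac)
    also have "\<dots> \<le> \<delta> / 2 * (\<epsilon> / 2) * F"
    proof (rule mult_right_mono)
      have "8 * real r \<le> \<delta> * 2 ^ lb * \<epsilon>\<^sup>2" using big1 by linarith
      also have "\<dots> \<le> \<delta> * 2 ^ lb * \<epsilon>" using ee \<delta> by (intro mult_left_mono) auto
      finally show "real r * (2 / 2 ^ lb) \<le> \<delta> / 2 * (\<epsilon> / 2)" by (simp add: field_simps)
    qed (rule F0)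
    finally show "cavg (n * Suc lb) (\<lambda>cs'. \<Sum>l<r. \<Sum>j<n.
      (ip (2 ^ lb) (sketch lb n cs' (H cs l)) (sketch lb n cs' (\<lambda>i. M i j)) - ip n (H cs l) (\<lambda>i. M i j))\<^sup>2) \<le> \<delta> / 2 * (\<epsilon> / 2 * F)"
      by simp
  qed (use \<delta> \<epsilon> F0 in \<open>auto intro!: mult_nonneg_nonneg sum_nonneg\<close>)
  have "cavg (n * Suc lb + n * Suc lb) (\<lambda>cs. of_bool (bad1 (take (n * Suc lb) cs) \<or>
     bad2 (take (n * Suc lb) cs) (drop (n * Suc lb) cs))) =
     cavg (n * Suc lb) (\<lambda>u. cavg (n * Suc lb) (\<lambda>v. of_bool (bad1 u \<or> bad2 u v)))"
    unfolding cavg_append by (intro cavg_cong) simp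
  also have "\<dots> \<le> cavg (n * Suc lb) (\<lambda>u. cavg (n * Suc lb) (\<lambda>v. of_bool (bad1 u) + of_bool (bad2 u v)))"
    by (intro cavg_mono) auto
  also have "\<dots> \<le> cavg (n * Suc lb) (\<lambda>u. of_bool (bad1 u) + \<delta> / 2)"
    unfolding cavg_add by (intro add_mono cavg_mono p2) simp
  also have "\<dots> \<le> \<delta>" using p1 by (simp add: cavg_add)
  finally show ?thesis .
qed

section \<open>Communication protocols and rank\<close>

text \<open>Rank at most \<open>K\<close>, expressed by \<open>K\<close> outer products. Sums and
  restrictions to rectangles are immediate in this form, and \<open>rank_rep_of_rank\<close>
  connects it with the rank of matrices.\<close>

definition rank_rep :: "nat \<Rightarrow> nat \<Rightarrow> (nat \<Rightarrow> nat \<Rightarrow> real) \<Rightarrow> bool" where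
  "rank_rep n K f \<longleftrightarrow> (\<exists>X Y. \<forall>i<n. \<forall>j<n. f i j = (\<Sum>l<K. X l i * Y l j))"

lemma rank_rep_cong: "rank_rep n K f \<Longrightarrow> (\<And>i j. i < n \<Longrightarrow> j < n \<Longrightarrow> g i j = f i j) \<Longrightarrow> rank_rep n K g"
  by (auto simp: rank_rep_def)

lemma rank_rep_mono:
  assumes "rank_rep n K f" "K \<le> K'" shows "rank_rep n K' f"
proof -
  obtain X Y where XY: "\<And>i j. i < n \<Longrightarrow> j < n \<Longrightarrow> f i j = (\<Sum>l<K. X l i * Y l j)"
    using assms(1) unfolding rank_rep_def by blast
  have "f i j = (\<Sum>l<K'. (if l < K then X l i else 0) * Y l j)" if "i < n" "j < n" for i j
  proof -
    have "(\<Sum>l<K. X l i * Y l j) = (\<Sum>l<K'. (if l < K then X l i else 0) * Y l j)"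
      using assms(2) by (intro sum.mono_neutral_cong_left) auto
    then show ?thesis using XY[OF that] by simp
  qed
  then show ?thesis unfolding rank_rep_def by (intro exI[of _ "\<lambda>l i. if l < K then X l i else 0"] exI[of _ Y]) auto
qed

lemma rank_rep_zero: "rank_rep n K (\<lambda>_ _. 0)"
  unfolding rank_rep_def by (intro exI[of _ "\<lambda>_ _. 0"]) auto

lemma rank_rep_add:
  assumes "rank_rep n K f" "rank_rep n K' g" shows "rank_rep n (K + K') (\<lambda>i j. f i j + g i j)"
proof -
  obtain X Y where XY: "\<And>i j. i < n \<Longrightarrow> j < n \<Longrightarrow> f i j = (\<Sum>l<K. X l i * Y l j)"
    using assms(1) unfolding rank_rep_def by blast
  obtain X' Y' where XY': "\<And>i j. i < n \<Longrightarrow> j < n \<Longrightarrow> g i j = (\<Sum>l<K'. X' l i * Y' l j)"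
    using assms(2) unfolding rank_rep_def by blast
  show ?thesis unfolding rank_rep_def
    by (intro exI[of _ "\<lambda>l. if l < K then X l else X' (l - K)"] exI[of _ "\<lambda>l. if l < K then Y l else Y' (l - K)"])
      (auto simp: XY XY' sum_split_add)
qed

lemma rank_rep_restrict:
  assumes "rank_rep n K f" shows "rank_rep n K (\<lambda>i j. of_bool (\<alpha> i \<and> \<beta> j) * f i j)"
proof -
  obtain X Y where XY: "\<And>i j. i < n \<Longrightarrow> j < n \<Longrightarrow> f i j = (\<Sum>l<K. X l i * Y l j)"
    using assms(1) unfolding rank_rep_def by blast
  show ?thesis unfolding rank_rep_def
    by (intro exI[of _ "\<lambda>l i. of_bool (\<alpha> i) * X l i"] exI[of _ "\<lambda>l j. of_bool (\<beta> j) * Y l j"])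
      (auto simp: XY)
qed

text \<open>A maximal independent set of columns has as many members as the rank and spans all
  columns. Its members serve as the \<open>X l\<close>, the coefficients expressing column
  \<open>j\<close> as the \<open>Y l j\<close>.\<close>

lemma (in vec_space) rank_factorization:
  assumes L: "L \<in> carrier_mat n nc"
  shows "\<exists>X Y. \<forall>i<n. \<forall>j<nc. L $$ (i,j) = (\<Sum>l<rank L. X l i * Y l j)"
proof -
  obtain S where S: "finite S" "maximal S (\<lambda>T. T \<subseteq> set (cols L) \<and> lin_indpt T)"
  proof -
    have "lin_indpt {}" by (auto simp: lin_dep_def)
    then have "\<exists>S. finite S \<and> maximal S (\<lambda>T. T \<subseteq> set (cols L) \<and> lin_indpt T) \<and> {} \<subseteq> S"
      by (intro maximal_exists_superset[of "set (cols L)"]) auto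
    then show ?thesis using that by blast
  qed
  have card: "rank L = card S" by (rule rank_card_indpt[OF L S(2)])
  have Ssub: "S \<subseteq> set (cols L)" and Sli: "lin_indpt S" using S(2) by (auto simp: maximal_def)
  have carr: "set (cols L) \<subseteq> carrier_vec n" using L cols_dim by blast
  have Sc: "S \<subseteq> carrier_vec n" using Ssub carr by blast
  have ex: "\<exists>a. c = lincomb a S" if c: "c \<in> set (cols L)" for c
  proof -
    have cc: "c \<in> carrier_vec n" using c carr by blast
    have "c \<in> span S"
    proof (rule ccontr)
      assume n: "c \<notin> span S"
      then have "c \<notin> S" using Sc span_mem by blast
      moreover have "lin_indpt (S \<union> {c})"
        using lin_dep_iff_in_span[of S c] n Sc Sli cc \<open>c \<notin> S\<close> by auto
      ultimately show False using S(2) Ssub c unfolding maximal_def by blast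
    qed
    then show ?thesis using finite_in_span[OF S(1) Sc] by metis
  qed
  define a where "a = (\<lambda>c. SOME a. c = lincomb a S)"
  have a: "c = lincomb (a c) S" if "c \<in> set (cols L)" for c
    unfolding a_def by (rule someI_ex[OF ex[OF that]])
  obtain h where h: "bij_betw h {..<card S} S" using ex_bij_betw_nat_finite[OF S(1)] by (auto simp: lessThan_atLeast0)
  have entry: "L $$ (i,j) = (\<Sum>l<rank L. h l $ i * a (col L j) (h l))" if ij: "i < n" "j < nc" for i j
  proof -
    have cL: "col L j \<in> set (cols L)" using ij L by (metis carrier_matD(2) cols_length cols_nth nth_mem)
    have "L $$ (i,j) = col L j $ i" using ij L by auto
    also have "\<dots> = lincomb (a (col L j)) S $ i" using a[OF cL] by simp
    also have "\<dots> = (\<Sum>v\<in>S. a (col L j) v * v $ i)" using lincomb_index[OF ij(1) Sc] .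
    also have "\<dots> = (\<Sum>l<card S. a (col L j) (h l) * h l $ i)"
      by (rule sum.reindex_bij_betw[OF h, symmetric])
    finally show ?thesis by (simp add: card mult.commute)
  qed
  show ?thesis
    by (intro exI[of _ "\<lambda>l i. h l $ i"] exI[of _ "\<lambda>l j. a (col L j) (h l)"] allI impI entry)
qed

lemma rank_rep_of_rank:
  assumes "L \<in> carrier_mat n n" "vec_space.rank n L \<le> k"
  shows "rank_rep n k (\<lambda>i j. L $$ (i,j))"
  by (rule rank_rep_mono[OF _ assms(2)]) (unfold rank_rep_def, rule vec_space.rank_factorization[OF assms(1)])

lemma rank_of_factorization:
  "vec_space.rank n (mat n n (\<lambda>(i,j). \<Sum>l<r. X i l * Y j l :: real)) \<le> r"
proof (induction r)
  case 0
  have "mat n n (\<lambda>(i,j). \<Sum>l<0. X i l * Y j l :: real) = 0\<^sub>m n n" by auto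
  then show ?case by (simp only: vec_space.rank_0I)
next
  case (Suc r)
  let ?A = "mat n n (\<lambda>(i,j). \<Sum>l<r. X i l * Y j l :: real)" and ?B = "mat n n (\<lambda>(i,j). X i r * Y j r :: real)"
  have "mat n n (\<lambda>(i,j). \<Sum>l<Suc r. X i l * Y j l :: real) = ?A + ?B" by auto
  moreover have "vec_space.rank n (?A + ?B) \<le> vec_space.rank n ?A + vec_space.rank n ?B"
    by (rule vec_space.rank_subadditive) auto
  moreover have "vec_space.rank n ?B \<le> 1"
    by (rule vec_space.rank_le_1_product_entries[where f = "\<lambda>i. X i r" and g = "\<lambda>j. Y j r"]) auto
  ultimately show ?case using Suc by simp
qed

text \<open>The inputs reaching a node of the protocol tree form a combinatorial rectangle, which
  the induction carries along as \<alpha> and \<beta>. A sent bit splits one side of it and doubles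
  the rank bound; a leaf restricts \<open>F\<close> to a subrectangle, namely the part with answer
  0, which keeps the rank.\<close>

lemma rank_rep_protocol:
  assumes F: "rank_rep n k F"
  shows "(\<And>i j. i < n \<Longrightarrow> j < n \<Longrightarrow> \<alpha> i \<Longrightarrow> \<beta> j \<Longrightarrow> bits P (s i) (s j) \<le> c) \<Longrightarrow>
    rank_rep n (k * 2 ^ c) (\<lambda>i j. of_bool (\<alpha> i \<and> \<beta> j \<and> \<not> out_bit P (s i) (s j)) * F i j)"
proof (induction P arbitrary: \<alpha> \<beta> c)
  case (Final p a)
  have "k \<le> k * 2 ^ c" by simp
  show ?case
  proof (cases p)
    case Alice
    show ?thesis
      by (rule rank_rep_cong[OF rank_rep_mono[OF rank_rep_restrict[OF F, of "\<lambda>i. \<alpha> i \<and> \<not> a (s i)" \<beta>] \<open>k \<le> k * 2 ^ c\<close>]])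
        (auto simp: Alice)
  next
    case Bob
    show ?thesis
      by (rule rank_rep_cong[OF rank_rep_mono[OF rank_rep_restrict[OF F, of \<alpha> "\<lambda>j. \<beta> j \<and> \<not> a (s j)"] \<open>k \<le> k * 2 ^ c\<close>]])
        (auto simp: Bob)
  qed
next
  case (Send p a P Q)
  show ?case
  \<comment> \<open>On an empty rectangle the cost assumption says nothing and \<open>c\<close> may
    be 0; the matrix is 0 there.\<close>
  proof (cases "\<exists>i<n. \<exists>j<n. \<alpha> i \<and> \<beta> j")
    case False
    show ?thesis by (rule rank_rep_cong[OF rank_rep_zero]) (use False in auto)
  next
    case True
    then obtain i j where ij: "i < n" "j < n" "\<alpha> i" "\<beta> j" by blast
    have "c \<noteq> 0" using Send.prems[OF ij] by auto
    then obtain c' where c: "c = Suc c'" by (cases c) auto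
    define \<alpha>' where "\<alpha>' = (\<lambda>v i. \<alpha> i \<and> (p = Alice \<longrightarrow> a (s i) = v))"
    define \<beta>' where "\<beta>' = (\<lambda>v j. \<beta> j \<and> (p = Bob \<longrightarrow> a (s j) = v))"
    have "rank_rep n (k * 2 ^ c') (\<lambda>i j. of_bool (\<alpha>' True i \<and> \<beta>' True j \<and> \<not> out_bit P (s i) (s j)) * F i j)"
    proof (rule Send.IH(1))
      fix i j assume "i < n" "j < n" "\<alpha>' True i" "\<beta>' True j"
      then show "bits P (s i) (s j) \<le> c'" using Send.prems[of i j] c by (cases p) (auto simp: \<alpha>'_def \<beta>'_def)
    qed
    moreover have "rank_rep n (k * 2 ^ c') (\<lambda>i j. of_bool (\<alpha>' False i \<and> \<beta>' False j \<and> \<not> out_bit Q (s i) (s j)) * F i j)"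
    proof (rule Send.IH(2))
      fix i j assume "i < n" "j < n" "\<alpha>' False i" "\<beta>' False j"
      then show "bits Q (s i) (s j) \<le> c'" using Send.prems[of i j] c by (cases p) (auto simp: \<alpha>'_def \<beta>'_def)
    qed
    ultimately have "rank_rep n (k * 2 ^ c' + k * 2 ^ c') (\<lambda>i j.
       of_bool (\<alpha>' True i \<and> \<beta>' True j \<and> \<not> out_bit P (s i) (s j)) * F i j +
       of_bool (\<alpha>' False i \<and> \<beta>' False j \<and> \<not> out_bit Q (s i) (s j)) * F i j)"
      by (rule rank_rep_add)
    moreover have "k * 2 ^ c' + k * 2 ^ c' = k * 2 ^ c" by (simp add: c)
    ultimately have "rank_rep n (k * 2 ^ c) (\<lambda>i j.
       of_bool (\<alpha>' True i \<and> \<beta>' True j \<and> \<not> out_bit P (s i) (s j)) * F i j +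
       of_bool (\<alpha>' False i \<and> \<beta>' False j \<and> \<not> out_bit Q (s i) (s j)) * F i j)"
      by (simp only:)
    then show ?thesis by (rule rank_rep_cong) (cases p; auto simp: \<alpha>'_def \<beta>'_def)
  qed
qed

section \<open>Attained communication cost and low-rank competitors from protocols\<close>

fun send_input :: "(bool list \<Rightarrow> bool list \<Rightarrow> bool) \<Rightarrow> nat \<Rightarrow> bool list \<Rightarrow> protocol" where
  "send_input g 0 u = Final Bob (g u)"
| "send_input g (Suc k) u = Send Alice (\<lambda>x. x ! length u) (send_input g k (u @ [True])) (send_input g k (u @ [False]))"

lemma send_input: "length x = length u + k \<Longrightarrow> take (length u) x = u \<Longrightarrow>
   out_bit (send_input g k u) x y = g x y \<and> bits (send_input g k u) x y = Suc k"
proof (induction k arbitrary: u)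
  case (Suc k)
  have "take (length (u @ [x ! length u])) x = u @ [x ! length u]"
    using Suc.prems by (simp add: take_Suc_conv_app_nth)
  then show ?case using Suc.IH[of "u @ [x ! length u]"] Suc.prems by (cases "x ! length u") auto
qed simp

text \<open>If Alice sends her whole input and Bob answers, no error occurs; hence the set of
  possible costs is nonempty and its least element is the cost of some protocol.\<close>

lemma rand_cc_attained:
  assumes "0 \<le> \<delta>1" "0 \<le> \<delta>2"
  shows "\<exists>R \<pi>. error_protocol m \<delta>1 \<delta>2 g R \<pi> \<and> cost_at_most m R \<pi> (rand_cc m \<delta>1 \<delta>2 g)"
  unfolding rand_cc_def
proof (rule LeastI)
  have "error_protocol m \<delta>1 \<delta>2 g (return_pmf []) (\<lambda>_. send_input g m [])"
    using assms by (auto simp: error_protocol_def send_input)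
  moreover have "cost_at_most m (return_pmf []) (\<lambda>_. send_input g m []) (Suc m)"
    by (auto simp: cost_at_most_def send_input)
  ultimately show "\<exists>R \<pi>. error_protocol m \<delta>1 \<delta>2 g R \<pi> \<and> cost_at_most m R \<pi> (Suc m)" by blast
qed

lemma index_of_surj: "i < 2 ^ m \<Longrightarrow> \<exists>x. length x = m \<and> index_of x = i"
proof -
  have "i < 2 ^ m \<Longrightarrow> \<exists>x. length x = m \<and> horner_sum of_bool 2 x = i"
  proof (induction m arbitrary: i)
    case (Suc m)
    have "i div 2 < 2 ^ m" using Suc.prems by auto
    then obtain x where x: "length x = m" "horner_sum of_bool 2 x = i div 2" using Suc.IH by blast
    have "horner_sum of_bool 2 (odd i # x) = i" using x by simp
    then show ?case using x(1) by (intro exI[of _ "odd i # x"]) simp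
  qed simp
  moreover assume "i < 2 ^ m"
  ultimately obtain x where "length x = m" "horner_sum of_bool 2 x = i" by blast
  then show ?thesis by (intro exI[of _ "rev x"]) (simp add: index_of_def)
qed

text \<open>For fixed coins, \<open>L\<close> is kept where the protocol answers 0 and replaced by 0
  elsewhere. Zeros of \<open>W\<close> are always answered 1, so there \<open>L'\<close> and
  \<open>M\<close> both vanish. Where \<open>W\<close> is 1, an entry is either kept, with its
  masked error, or lost, at the price of the square of \<open>M\<close>. The expected loss is at
  most \<epsilon> times the squared norm of \<open>M\<close>, and some coins do no worse than the
  mean.\<close>

lemma communication_rank:
  fixes A W :: "real mat"
  defines "M \<equiv> \<lambda>i j. A $$ (i,j) * W $$ (i,j)"
  assumes n: "n = 2 ^ m" and W: "\<And>i j. i < n \<Longrightarrow> j < n \<Longrightarrow> W $$ (i,j) \<in> {0, 1}"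
    and err: "error_protocol m 0 \<epsilon> (\<lambda>x y. \<not> computed_by W x y) R \<pi>" and cost: "cost_at_most m R \<pi> c"
    and L: "rank_rep n k L"
  shows "\<exists>L'. rank_rep n (k * 2 ^ c) L' \<and> (\<Sum>i<n. \<Sum>j<n. (M i j - L' i j)\<^sup>2) \<le>
    (\<Sum>i<n. \<Sum>j<n. (W $$ (i,j) * (A $$ (i,j) - L i j))\<^sup>2) + \<epsilon> * (\<Sum>i<n. \<Sum>j<n. (M i j)\<^sup>2)"
proof -
  define s where "s = (\<lambda>i. SOME x. length x = m \<and> index_of x = i)"
  have s: "length (s i) = m \<and> index_of (s i) = i" if "i < n" for i
    using someI_ex[OF index_of_surj[of i m]] that n by (simp add: s_def)
  have comp: "computed_by W (s i) (s j) \<longleftrightarrow> W $$ (i,j) = 1" if "i < n" "j < n" for i j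
    using s that by (simp add: computed_by_def)
  define out where "out = (\<lambda>i j r. out_bit (\<pi> r) (s i) (s j))"
  have sound: "out i j r" if "i < n" "j < n" "W $$ (i,j) = 0" "r \<in> set_pmf R" for i j r
  proof -
    have "measure_pmf.prob R {r. out i j r} \<ge> 1"
      using err s[OF that(1)] s[OF that(2)] comp[OF that(1,2)] that(3) unfolding error_protocol_def out_def by auto
    then have "measure_pmf.prob R {r. out i j r} = 1" using measure_pmf.prob_le_1 order_antisym by blast
    \<comment> \<open>For a discrete distribution, probability 1 means every string in the support,
      so one-sidedness holds for each single outcome of the coins.\<close>
    then have "AE r in measure_pmf R. r \<in> {r. out i j r}" by (subst measure_pmf.AE_in_set_eq_1) auto
    then show ?thesis using that(4) by (simp add: AE_measure_pmf_iff)
  qed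
  have miss: "measure_pmf.prob R {r. out i j r} \<le> \<epsilon>" if "i < n" "j < n" "W $$ (i,j) = 1" for i j
  proof -
    have "measure_pmf.prob R {r. \<not> out i j r} \<ge> 1 - \<epsilon>"
      using err s[OF that(1)] s[OF that(2)] comp[OF that(1,2)] that(3) unfolding error_protocol_def out_def by auto
    moreover have "measure_pmf.prob R {r. \<not> out i j r} = 1 - measure_pmf.prob R {r. out i j r}"
      using measure_pmf.prob_compl[of "{r. out i j r}" R] by (simp add: Compl_eq_Diff_UNIV[symmetric] Collect_neg_eq)
    ultimately show ?thesis by linarith
  qed
  define G where "G = (\<lambda>r. \<Sum>i<n. \<Sum>j<n. (M i j)\<^sup>2 * indicator {r. out i j r} r)"
  have int: "integrable (measure_pmf R) (\<lambda>r. (M i j)\<^sup>2 * indicator {r. out i j r} r :: real)" for i j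
    by (rule measure_pmf.integrable_const_bound[where B = "(M i j)\<^sup>2"]) (auto simp: indicator_def)
  have EG: "measure_pmf.expectation R G \<le> \<epsilon> * (\<Sum>i<n. \<Sum>j<n. (M i j)\<^sup>2)"
  proof -
    have "measure_pmf.expectation R G = (\<Sum>i<n. \<Sum>j<n. (M i j)\<^sup>2 * measure_pmf.prob R {r. out i j r})"
    proof -
      have "measure_pmf.expectation R G = (\<Sum>i<n. \<Sum>j<n. measure_pmf.expectation R (\<lambda>r. (M i j)\<^sup>2 * indicator {r. out i j r} r))"
        unfolding G_def by (simp only: Bochner_Integration.integral_sum Bochner_Integration.integrable_sum int)
      moreover have "measure_pmf.expectation R (\<lambda>r. (M i j)\<^sup>2 * indicator {r. out i j r} r) =
          (M i j)\<^sup>2 * measure_pmf.prob R {r. out i j r}" for i j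
        by (subst integral_mult_right_zero) simp
      ultimately show ?thesis by (simp only:)
    qed
    also have "\<dots> \<le> (\<Sum>i<n. \<Sum>j<n. (M i j)\<^sup>2 * \<epsilon>)"
    proof (intro sum_mono)
      fix i j assume "i \<in> {..<n}" "j \<in> {..<n}"
      then show "(M i j)\<^sup>2 * measure_pmf.prob R {r. out i j r} \<le> (M i j)\<^sup>2 * \<epsilon>"
        using W[of i j] miss[of i j] by (cases "W $$ (i,j) = 0") (auto simp: M_def mult_left_mono)
    qed
    finally show ?thesis by (simp add: sum_distrib_left mult.commute)
  qed
  obtain r where r: "r \<in> set_pmf R" "G r \<le> \<epsilon> * (\<Sum>i<n. \<Sum>j<n. (M i j)\<^sup>2)"
  proof (rule ccontr)
    assume "\<not> thesis"
    then have gt: "\<forall>r\<in>set_pmf R. \<epsilon> * (\<Sum>i<n. \<Sum>j<n. (M i j)\<^sup>2) < G r" using that not_le by blast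
    have "integrable (measure_pmf R) G" unfolding G_def by (intro Bochner_Integration.integrable_sum int)
    then have "\<epsilon> * (\<Sum>i<n. \<Sum>j<n. (M i j)\<^sup>2) < measure_pmf.expectation R G"
      by (rule measure_pmf.expectation_greater) (simp add: AE_measure_pmf_iff gt)
    then show False using EG by linarith
  qed
  define L' where "L' = (\<lambda>i j. of_bool (\<not> out i j r) * L i j)"
  have "rank_rep n (k * 2 ^ c) (\<lambda>i j. of_bool (True \<and> True \<and> \<not> out_bit (\<pi> r) (s i) (s j)) * L i j)"
    by (rule rank_rep_protocol[OF L]) (use cost r(1) s in \<open>auto simp: cost_at_most_def\<close>)
  then have "rank_rep n (k * 2 ^ c) L'" by (simp add: L'_def out_def)
  moreover have "(\<Sum>i<n. \<Sum>j<n. (M i j - L' i j)\<^sup>2) \<le>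
     (\<Sum>i<n. \<Sum>j<n. (W $$ (i,j) * (A $$ (i,j) - L i j))\<^sup>2) + G r"
    unfolding G_def sum.distrib[symmetric]
  proof (intro sum_mono)
    fix i j assume ij: "i \<in> {..<n}" "j \<in> {..<n}"
    then show "(M i j - L' i j)\<^sup>2 \<le> (W $$ (i,j) * (A $$ (i,j) - L i j))\<^sup>2 + (M i j)\<^sup>2 * indicator {r. out i j r} r"
      using W[of i j] sound[of i j r] r(1) by (auto simp: M_def L'_def indicator_def)
  qed
  ultimately show ?thesis using r(2) by (intro exI[of _ L']) linarith
qed

section \<open>From unmasked approximation to the bicriteria guarantee\<close>

lemma masked_opt_greatest:
  assumes "\<And>L. L \<in> carrier_mat n n \<Longrightarrow> mat_rank L \<le> k \<Longrightarrow> z \<le> frob_sq (W \<circ>\<^sub>H (A - L))"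
  shows "z \<le> masked_opt n A W k"
  unfolding masked_opt_def
proof (rule cINF_greatest)
  have "0\<^sub>m n n \<in> {L \<in> carrier_mat n n. mat_rank L \<le> k}"
    using vec_space.rank_0I[where 'a = real, of n n] by simp
  then show "{L \<in> carrier_mat n n. mat_rank L \<le> k} \<noteq> {}" by blast
qed (use assms in auto)

lemma frob_sq_masked:
  assumes "A \<in> carrier_mat n n" "W \<in> carrier_mat n n" "L \<in> carrier_mat n n"
  shows "frob_sq (W \<circ>\<^sub>H (A - L)) = (\<Sum>i<n. \<Sum>j<n. (W $$ (i,j) * (A $$ (i,j) - L $$ (i,j)))\<^sup>2)"
    and "frob_sq (A \<circ>\<^sub>H W) = (\<Sum>i<n. \<Sum>j<n. (A $$ (i,j) * W $$ (i,j))\<^sup>2)"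
  using assms by (auto simp: frob_sq_def hadamard_def intro!: sum.cong)

text \<open>Reduction of the masked problem to plain approximation of \<open>M\<close> by rank
  \<open>k'\<close>: \<open>opt\<close> and the rank bound are what an algorithm has to provide. One
  \<epsilon> comes from \<open>opt\<close>, the other from the protocol that turns a competitor of
  rank \<open>k\<close> into one of rank \<open>k'\<close>.\<close>

theorem bicriteria_solutionI:
  fixes A W :: "real mat"
  defines "M \<equiv> \<lambda>i j. A $$ (i,j) * W $$ (i,j)"
  assumes n: "n = 2 ^ m" and A: "A \<in> carrier_mat n n" and Wc: "W \<in> carrier_mat n n"
    and W: "\<forall>i<n. \<forall>j<n. W $$ (i,j) \<in> {0, 1}" and \<epsilon>: "\<epsilon> > 0"
    and k': "k' = k * 2 ^ one_sided_cc m \<epsilon> (\<lambda>x y. \<not> computed_by W x y)"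
    and L: "L \<in> carrier_mat n n" "mat_rank L \<le> k'"
    and opt: "\<And>X Y. (\<Sum>i<n. \<Sum>j<n. (M i j - L $$ (i,j))\<^sup>2) \<le>
      (\<Sum>i<n. \<Sum>j<n. (M i j - (\<Sum>l<k'. X l i * Y l j))\<^sup>2) + \<epsilon> * (\<Sum>i<n. \<Sum>j<n. (M i j)\<^sup>2)"
  shows "bicriteria_solution n A W k k' \<epsilon> L"
proof -
  obtain R \<pi> where R: "error_protocol m 0 \<epsilon> (\<lambda>x y. \<not> computed_by W x y) R \<pi>"
     "cost_at_most m R \<pi> (one_sided_cc m \<epsilon> (\<lambda>x y. \<not> computed_by W x y))"
    using rand_cc_attained[of 0 \<epsilon> m "\<lambda>x y. \<not> computed_by W x y"] \<epsilon> by (auto simp: one_sided_cc_def)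
  have "frob_sq (W \<circ>\<^sub>H (A - L)) - 2 * \<epsilon> * frob_sq (A \<circ>\<^sub>H W) \<le> masked_opt n A W k"
  proof (rule masked_opt_greatest)
    fix L0 assume L0: "L0 \<in> carrier_mat n n" "mat_rank L0 \<le> k"
    have "rank_rep n k (\<lambda>i j. L0 $$ (i,j))" using L0 by (intro rank_rep_of_rank) auto
    from communication_rank[OF n _ R this] W obtain L' where L': "rank_rep n k' L'"
      "(\<Sum>i<n. \<Sum>j<n. (M i j - L' i j)\<^sup>2) \<le> frob_sq (W \<circ>\<^sub>H (A - L0)) + \<epsilon> * (\<Sum>i<n. \<Sum>j<n. (M i j)\<^sup>2)"
      unfolding frob_sq_masked[OF A Wc L0(1)] M_def k' by blast
    then obtain X Y where XY: "\<And>i j. i < n \<Longrightarrow> j < n \<Longrightarrow> L' i j = (\<Sum>l<k'. X l i * Y l j)"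
      unfolding rank_rep_def by blast
    \<comment> \<open>Passing to the unmasked error only adds the squares of \<open>L\<close> on the
      zeros of \<open>W\<close>.\<close>
    have "frob_sq (W \<circ>\<^sub>H (A - L)) \<le> (\<Sum>i<n. \<Sum>j<n. (M i j - L $$ (i,j))\<^sup>2)"
      unfolding frob_sq_masked[OF A Wc L(1)]
    proof (intro sum_mono)
      fix i j assume "i \<in> {..<n}" "j \<in> {..<n}"
      then show "(W $$ (i,j) * (A $$ (i,j) - L $$ (i,j)))\<^sup>2 \<le> (M i j - L $$ (i,j))\<^sup>2"
        using W[rule_format, of i j] by (auto simp: M_def)
    qed
    also have "\<dots> \<le> (\<Sum>i<n. \<Sum>j<n. (M i j - L' i j)\<^sup>2) + \<epsilon> * (\<Sum>i<n. \<Sum>j<n. (M i j)\<^sup>2)"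
      using opt[of X Y] by (simp add: XY)
    finally show "frob_sq (W \<circ>\<^sub>H (A - L)) - 2 * \<epsilon> * frob_sq (A \<circ>\<^sub>H W) \<le> frob_sq (W \<circ>\<^sub>H (A - L0))"
      using L'(2) unfolding frob_sq_masked(2)[OF A Wc L(1)] M_def by linarith
  qed
  then show ?thesis using L unfolding bicriteria_solution_def by simp
qed

text \<open>The error of the zero matrix is the whole squared norm of
  \<open>A \<circ>\<^sub>H W\<close>, and for large \<epsilon> the slack in the guarantee pays for
  it.\<close>

lemma bicriteria_solution_zero:
  assumes A: "A \<in> carrier_mat n n" and W: "W \<in> carrier_mat n n" and \<epsilon>: "\<epsilon> \<ge> 1 / 2"
  shows "bicriteria_solution n A W k k' \<epsilon> (0\<^sub>m n n)"
proof -
  have F0: "frob_sq B \<ge> 0" for B by (simp add: frob_sq_def sum_nonneg)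
  have "frob_sq (W \<circ>\<^sub>H (A - 0\<^sub>m n n)) = frob_sq (A \<circ>\<^sub>H W)"
    using A by (simp add: frob_sq_masked[OF A W zero_carrier_mat] mult.commute)
  also have "\<dots> \<le> 2 * \<epsilon> * frob_sq (A \<circ>\<^sub>H W)"
    using mult_right_mono[of 1 "2 * \<epsilon>", OF _ F0[of "A \<circ>\<^sub>H W"]] \<epsilon> by linarith
  finally have "frob_sq (W \<circ>\<^sub>H (A - 0\<^sub>m n n)) \<le> 2 * \<epsilon> * frob_sq (A \<circ>\<^sub>H W)" .
  moreover have "0 \<le> masked_opt n A W k" by (rule masked_opt_greatest) (rule F0)
  ultimately show ?thesis
    using vec_space.rank_0I[where 'a = real, of n n] by (simp add: bicriteria_solution_def)
qed

section \<open>Reasoning about programs\<close>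

definition run :: "com \<Rightarrow> memory \<Rightarrow> bool list \<Rightarrow> nat \<Rightarrow> (memory \<Rightarrow> bool list \<Rightarrow> bool) \<Rightarrow> bool" where
  "run c s cs T Q \<longleftrightarrow> (\<exists>t s' cs'. exec c s cs t s' cs' \<and> t \<le> T \<and> Q s' cs')"

lemma runI: "exec c s cs t s' cs' \<Longrightarrow> t \<le> T \<Longrightarrow> Q s' cs' \<Longrightarrow> run c s cs T Q"
  by (auto simp: run_def)

lemma run_mono: "run c s cs T Q \<Longrightarrow> T \<le> T' \<Longrightarrow> (\<And>s' cs'. Q s' cs' \<Longrightarrow> Q' s' cs') \<Longrightarrow> run c s cs T' Q'"
  unfolding run_def by (meson order_trans)

lemma run_Seq: "run c s cs T Q \<Longrightarrow> (\<And>s' cs'. Q s' cs' \<Longrightarrow> run d s' cs' T' Q') \<Longrightarrow> run (Seq c d) s cs (T + T') Q'"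
  unfolding run_def by (meson add_mono exec.Seq)

lemma run_IAssign: "Q (s\<lparr>idx := upd (idx s) a (ieval s i) (ieval s j) (ieval s e)\<rparr>) cs \<Longrightarrow> run (IAssign a i j e) s cs 1 Q"
  by (rule runI[OF exec.IAssign]) auto

lemma run_RAssign: "Q (s\<lparr>val := upd (val s) a (ieval s i) (ieval s j) (reval s e)\<rparr>) cs \<Longrightarrow> run (RAssign a i j e) s cs 1 Q"
  by (rule runI[OF exec.RAssign]) auto

lemma run_Flip: "Q (s\<lparr>idx := upd (idx s) a (ieval s i) (ieval s j) (of_bool b)\<rparr>) cs \<Longrightarrow> run (Flip a i j) s (b # cs) 1 Q"
  by (rule runI[OF exec.Flip]) auto

lemma run_Skip: "Q s cs \<Longrightarrow> run Skip s cs 1 Q"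
  by (rule runI[OF exec.Skip]) auto

lemma run_Cond: "(beval s b \<Longrightarrow> run c s cs T Q) \<Longrightarrow> (\<not> beval s b \<Longrightarrow> run d s cs T Q) \<Longrightarrow> run (Cond b c d) s cs (1 + T) Q"
  unfolding run_def by (cases "beval s b") (meson add_left_mono exec.CondTrue, meson add_left_mono exec.CondFalse)

lemma run_While_done: "\<not> beval s b \<Longrightarrow> Q s cs \<Longrightarrow> run (While b c) s cs 1 Q"
  by (rule runI[OF exec.WhileFalse]) auto

lemma run_While_step:
  assumes "beval s b" "run c s cs T Q" "\<And>s' cs'. Q s' cs' \<Longrightarrow> run (While b c) s' cs' T' Q'"
  shows "run (While b c) s cs (1 + T + T') Q'"
proof -
  obtain t s' cs' where 1: "exec c s cs t s' cs'" "t \<le> T" "Q s' cs'" using assms(2) by (auto simp: run_def)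
  obtain u s'' cs'' where 2: "exec (While b c) s' cs' u s'' cs''" "u \<le> T'" "Q' s'' cs''"
    using assms(3)[OF 1(3)] by (auto simp: run_def)
  show ?thesis by (rule runI[OF exec.WhileTrue[OF assms(1) 1(1) 2(1)]]) (use 1 2 in auto)
qed

lemma upd_apply: "upd m a i j v a' = (if a' = a then (\<lambda>x y. if x = i \<and> y = j then v else m a x y) else m a')"
  by (auto simp: upd_def fun_eq_iff)

abbreviation scal :: "string \<Rightarrow> iexp" where "scal v \<equiv> ICell v (IConst 0) (IConst 0)"

definition seti :: "string \<Rightarrow> iexp \<Rightarrow> com" where
  "seti v e = IAssign v (IConst 0) (IConst 0) e"

definition For :: "string \<Rightarrow> iexp \<Rightarrow> com \<Rightarrow> com" where
  "For v B c = Seq (seti v (IConst 0))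
     (While (ILess (scal v) B) (Seq c (seti v (IAdd (scal v) (IConst 1)))))"

lemma run_seti: "Q (s\<lparr>idx := upd (idx s) v 0 0 (ieval s e)\<rparr>) cs \<Longrightarrow> run (seti v e) s cs 1 Q"
  unfolding seti_def by (rule run_IAssign) simp

text \<open>The time consists of one initial assignment, one final test, and per pass the body with
  a test and an increment. The limit \<open>B\<close> is evaluated anew in each test, so the
  invariant has to determine its value.\<close>

lemma run_For:
  assumes init: "I 0 (s\<lparr>idx := upd (idx s) v 0 0 0\<rparr>) cs"
    and step: "\<And>k s' cs'. k < m \<Longrightarrow> I k s' cs' \<Longrightarrow> idx s' v 0 0 = k \<Longrightarrow>
      run c s' cs' T (\<lambda>s'' cs''. idx s'' v 0 0 = k \<and> I (Suc k) (s''\<lparr>idx := upd (idx s'') v 0 0 (Suc k)\<rparr>) cs'')"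
    and bound: "\<And>k s' cs'. I k s' cs' \<Longrightarrow> ieval s' B = m"
    and post: "\<And>s' cs'. I m s' cs' \<Longrightarrow> idx s' v 0 0 = m \<Longrightarrow> Q s' cs'"
  shows "run (For v B c) s cs (2 + m * (T + 2)) Q"
proof -
  let ?w = "While (ILess (scal v) B) (Seq c (seti v (IAdd (scal v) (IConst 1))))"
  have loop: "run ?w s' cs' (1 + d * (T + 2)) Q" if "I k s' cs'" "idx s' v 0 0 = k" "k + d = m" for k d s' cs'
    using that
  proof (induction d arbitrary: k s' cs')
    case 0
    then have k: "k = m" by simp
    have "Q s' cs'" using 0 by (intro post) (auto simp: k)
    then have "run ?w s' cs' 1 Q" using 0 bound[OF 0(1)] by (intro run_While_done) (auto simp: k)
    then show ?case by simp
  next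
    case (Suc d)
    have "run ?w s' cs' (1 + (T + 1) + (1 + d * (T + 2))) Q"
    proof (rule run_While_step)
      show "beval s' (ILess (scal v) B)" using Suc.prems bound[OF Suc.prems(1)] by simp
      show "run (Seq c (seti v (IAdd (scal v) (IConst 1)))) s' cs' (T + 1)
          (\<lambda>s'' cs''. I (Suc k) s'' cs'' \<and> idx s'' v 0 0 = Suc k)"
      proof (rule run_Seq[OF step])
        show "k < m" "I k s' cs'" "idx s' v 0 0 = k" using Suc.prems by auto
      next
        fix s'' cs'' assume "idx s'' v 0 0 = k \<and> I (Suc k) (s''\<lparr>idx := upd (idx s'') v 0 0 (Suc k)\<rparr>) cs''"
        then show "run (seti v (IAdd (scal v) (IConst 1))) s'' cs'' 1 (\<lambda>s'' cs''. I (Suc k) s'' cs'' \<and> idx s'' v 0 0 = Suc k)"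
          by (intro run_seti) (auto simp: upd_apply)
      qed
    qed (use Suc in auto)
    then show ?case by (rule run_mono) auto
  qed
  have "run (For v B c) s cs (1 + (1 + m * (T + 2))) Q"
    unfolding For_def
  proof (rule run_Seq[OF run_seti])
    show "I 0 (s\<lparr>idx := upd (idx s) v 0 0 (ieval s (IConst 0))\<rparr>) cs \<and>
       idx (s\<lparr>idx := upd (idx s) v 0 0 (ieval s (IConst 0))\<rparr>) v 0 0 = 0" using init by (simp add: upd_apply)
  qed (use loop[of 0 _ _ m] in auto)
  then show ?thesis by (rule run_mono) auto
qed

section \<open>Frame conditions and table-filling loops\<close>

definition same :: "string set \<Rightarrow> string set \<Rightarrow> memory \<Rightarrow> memory \<Rightarrow> bool" where
  "same IS VS s s' \<longleftrightarrow> (\<forall>a. a \<notin> IS \<longrightarrow> idx s' a = idx s a) \<and> (\<forall>a. a \<notin> VS \<longrightarrow> val s' a = val s a)"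

lemma same_refl [simp]: "same IS VS s s"
  by (simp add: same_def)

lemma same_trans: "same I1 V1 s s' \<Longrightarrow> same I2 V2 s' s'' \<Longrightarrow> I1 \<subseteq> IS \<Longrightarrow> V1 \<subseteq> VS \<Longrightarrow> I2 \<subseteq> IS \<Longrightarrow> V2 \<subseteq> VS \<Longrightarrow>
    same IS VS s s''"
  unfolding same_def by (metis subsetD)

abbreviation AddAcc :: "rexp \<Rightarrow> com" where
  "AddAcc e \<equiv> RAssign ''a'' (IConst 0) (IConst 0) (RAdd (RCell ''a'' (IConst 0) (IConst 0)) e)"

abbreviation TabEntry :: "string \<Rightarrow> iexp \<Rightarrow> iexp \<Rightarrow> rexp \<Rightarrow> com" where
  "TabEntry dst base n3 e \<equiv> Seq (RAssign ''a'' (IConst 0) (IConst 0) (RIndex (IConst 0)))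
     (Seq (For ''l'' n3 (AddAcc e)) (RAssign dst (scal ''i'') (IAdd base (scal ''j'')) (RCell ''a'' (IConst 0) (IConst 0))))"

text \<open>Sums of \<open>e\<close> over \<open>l\<close> are written into a block of
  \<open>dst\<close> whose columns start at \<open>base\<close>. Matrix products, squared norms and
  projections are all instances; with \<open>n3\<close> equal to 1 it is a plain assignment of
  \<open>e\<close> to each cell.\<close>

definition Tab :: "string \<Rightarrow> iexp \<Rightarrow> iexp \<Rightarrow> iexp \<Rightarrow> iexp \<Rightarrow> rexp \<Rightarrow> com" where
  "Tab dst base n1 n2 n3 e = For ''i'' n1 (For ''j'' n2
     (TabEntry dst base n3 e))"

abbreviation tab_same :: "string \<Rightarrow> memory \<Rightarrow> memory \<Rightarrow> bool" where
  "tab_same dst \<equiv> same {''i'', ''j'', ''l''} {''a'', dst}"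

definition tab_time :: "nat \<Rightarrow> nat \<Rightarrow> nat \<Rightarrow> nat" where
  "tab_time N1 N2 N3 = 2 + N1 * (4 + N2 * (6 + 3 * N3))"

text \<open>The expression may read the destination cell about to be overwritten, which still has
  its old value; this is what permits deflating \<open>C\<close> in place.\<close>

lemma run_Tab:
  fixes N1 N2 N3 :: nat
  assumes bounds: "\<And>s'. tab_same dst s s' \<Longrightarrow>
      ieval s' n1 = N1 \<and> ieval s' n2 = N2 \<and> ieval s' n3 = N3 \<and> ieval s' base = \<rho>"
    and e: "\<And>s' x y z. tab_same dst s s' \<Longrightarrow> x < N1 \<Longrightarrow> y < N2 \<Longrightarrow> z < N3 \<Longrightarrow>
      idx s' ''i'' 0 0 = x \<Longrightarrow> idx s' ''j'' 0 0 = y \<Longrightarrow> idx s' ''l'' 0 0 = z \<Longrightarrow>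
      val s' dst x (\<rho> + y) = val s dst x (\<rho> + y) \<Longrightarrow> reval s' e = F x y z"
    and dst: "dst \<noteq> ''a''"
  shows "run (Tab dst base n1 n2 n3 e) s cs (tab_time N1 N2 N3) (\<lambda>s' cs'. cs' = cs \<and>
    tab_same dst s s' \<and>
    val s' dst = (\<lambda>x y. if x < N1 \<and> \<rho> \<le> y \<and> y < \<rho> + N2 then \<Sum>z<N3. F x (y - \<rho>) z else val s dst x y))"
proof -
  let ?S = "tab_same dst s"
  \<comment> \<open>Cells of the block that precede \<open>(x, y)\<close> in row order hold their
    sums, all other cells their old values.\<close>
  define Dn where "Dn = (\<lambda>x y u v. if (u < x \<or> u = x \<and> v < \<rho> + y) \<and> \<rho> \<le> v \<and> v < \<rho> + N2
      then \<Sum>z<N3. F u (v - \<rho>) z else val s dst u v)"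
  have Dn_next: "Dn x N2 = Dn (Suc x) 0" for x by (auto simp: Dn_def fun_eq_iff less_Suc_eq)
  define J1 where "J1 = (\<lambda>x s' cs'. cs' = cs \<and> ?S s' \<and> val s' dst = Dn x 0)"
  define J2 where "J2 = (\<lambda>x y s' cs'. cs' = cs \<and> ?S s' \<and> idx s' ''i'' 0 0 = x \<and> val s' dst = Dn x y)"
  define J3 where "J3 = (\<lambda>x y z s' cs'. cs' = cs \<and> ?S s' \<and> idx s' ''i'' 0 0 = x \<and> idx s' ''j'' 0 0 = y \<and>
      val s' dst = Dn x y \<and> val s' ''a'' 0 0 = (\<Sum>z<z. F x y z))"
  have "run (Tab dst base n1 n2 n3 e) s cs (2 + N1 * ((2 + N2 * (1 + ((2 + N3 * (1 + 2)) + 1) + 2)) + 2)) (J1 N1)"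
    unfolding Tab_def
  proof (rule run_For[where I = J1])
    show "J1 0 (s\<lparr>idx := upd (idx s) ''i'' 0 0 0\<rparr>) cs"
      by (auto simp: J1_def same_def upd_apply Dn_def fun_eq_iff)
  next
    fix x s1 cs1 assume x: "x < N1" "J1 x s1 cs1" "idx s1 ''i'' 0 0 = x"
    show "run (For ''j'' n2 (TabEntry dst base n3 e)) s1 cs1
       (2 + N2 * (1 + ((2 + N3 * (1 + 2)) + 1) + 2))
       (\<lambda>s'' cs''. idx s'' ''i'' 0 0 = x \<and> J1 (Suc x) (s''\<lparr>idx := upd (idx s'') ''i'' 0 0 (Suc x)\<rparr>) cs'')"
    proof (rule run_For[where I = "J2 x"])
      show "J2 x 0 (s1\<lparr>idx := upd (idx s1) ''j'' 0 0 0\<rparr>) cs1"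
        using x by (auto simp: J1_def J2_def same_def upd_apply)
    next
      fix y s2 cs2 assume y: "y < N2" "J2 x y s2 cs2" "idx s2 ''j'' 0 0 = y"
      show "run (TabEntry dst base n3 e) s2 cs2
       (1 + ((2 + N3 * (1 + 2)) + 1))
       (\<lambda>s'' cs''. idx s'' ''j'' 0 0 = y \<and> J2 x (Suc y) (s''\<lparr>idx := upd (idx s'') ''j'' 0 0 (Suc y)\<rparr>) cs'')"
      proof (rule run_Seq[OF run_RAssign run_Seq[OF run_For[where I = "J3 x y"]]])
        show "J3 x y 0 (s2\<lparr>val := upd (val s2) ''a'' (ieval s2 (IConst 0)) (ieval s2 (IConst 0)) (reval s2 (RIndex (IConst 0)))\<rparr>) cs2"
          using y dst by (auto simp: J2_def J3_def same_def upd_apply)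
      next
        fix s3 cs3 assume "J3 x y 0 s3 cs3"
        then show "J3 x y 0 (s3\<lparr>idx := upd (idx s3) ''l'' 0 0 0\<rparr>) cs3"
          by (auto simp: J3_def same_def upd_apply)
      next
        fix z s4 cs4 assume z: "z < N3" "J3 x y z s4 cs4" "idx s4 ''l'' 0 0 = z"
        have "reval s4 e = F x y z"
          by (rule e) (use x y z in \<open>auto simp: J3_def Dn_def\<close>)
        then show "run (AddAcc e) s4 cs4 1
         (\<lambda>s'' cs''. idx s'' ''l'' 0 0 = z \<and> J3 x y (Suc z) (s''\<lparr>idx := upd (idx s'') ''l'' 0 0 (Suc z)\<rparr>) cs'')"
          using z dst by (intro run_RAssign) (auto simp: J3_def same_def upd_apply)
      next
        fix k s' cs' assume "J3 x y k s' cs'"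
        then show "ieval s' n3 = N3" using bounds by (auto simp: J3_def)
      next
        fix s5 cs5 assume j: "J3 x y N3 s5 cs5"
        then show "J3 x y N3 s5 cs5" .
      next
        fix s5 cs5 assume j: "J3 x y N3 s5 cs5"
        then have s5: "cs5 = cs" "?S s5" "idx s5 ''i'' 0 0 = x" "idx s5 ''j'' 0 0 = y" "val s5 dst = Dn x y"
          "val s5 ''a'' 0 0 = (\<Sum>z<N3. F x y z)" by (simp_all add: J3_def)
        have base: "ieval s5 base = \<rho>" using bounds[OF s5(2)] by blast
        define s6 where "s6 = s5\<lparr>val := upd (val s5) dst (ieval s5 (scal ''i'')) (ieval s5 (IAdd base (scal ''j''))) (reval s5 (RCell ''a'' (IConst 0) (IConst 0)))\<rparr>"
        have "val s6 dst u v = Dn x (Suc y) u v" for u v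
          using y(1) by (cases "u = x \<and> v = \<rho> + y") (auto simp: s6_def upd_apply base s5 Dn_def)
        then have "val s6 dst = Dn x (Suc y)" by (intro ext)
        moreover have "?S s6" using s5(2) unfolding same_def by (simp add: s6_def upd_apply)
        moreover have "idx s6 = idx s5" by (simp add: s6_def)
        ultimately have "idx s6 ''j'' 0 0 = y \<and> J2 x (Suc y) (s6\<lparr>idx := upd (idx s6) ''j'' 0 0 (Suc y)\<rparr>) cs5"
          using s5 by (simp add: J2_def upd_apply) (simp add: same_def upd_apply)
        then show "run (RAssign dst (scal ''i'') (IAdd base (scal ''j'')) (RCell ''a'' (IConst 0) (IConst 0))) s5 cs5 1
          (\<lambda>s'' cs''. idx s'' ''j'' 0 0 = y \<and> J2 x (Suc y) (s''\<lparr>idx := upd (idx s'') ''j'' 0 0 (Suc y)\<rparr>) cs'')"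
          unfolding s6_def by (rule run_RAssign)
      qed
    next
      fix k s' cs' assume "J2 x k s' cs'"
      then show "ieval s' n2 = N2" using bounds by (auto simp: J2_def)
    next
      fix s' cs' assume "J2 x N2 s' cs'"
      then show "idx s' ''i'' 0 0 = x \<and> J1 (Suc x) (s'\<lparr>idx := upd (idx s') ''i'' 0 0 (Suc x)\<rparr>) cs'"
        by (auto simp: J1_def J2_def same_def upd_apply Dn_next)
    qed
  next
    fix k s' cs' assume "J1 k s' cs'"
    then show "ieval s' n1 = N1" using bounds by (auto simp: J1_def)
  qed
  then show ?thesis
    by (rule run_mono) (auto simp: tab_time_def J1_def Dn_def fun_eq_iff algebra_simps)
qed

text \<open>15 is the sum of the coefficients 2, 4, 6 and 3 in the expanded time, and each monomial
  is at most the full product.\<close>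

lemma tab_time_le:
  assumes "N1 \<ge> 1" "N2 \<ge> 1" "N3 \<ge> 1" shows "tab_time N1 N2 N3 \<le> 15 * (N1 * N2 * N3)"
proof -
  have a: "1 \<le> N1 * N2 * N3" "N1 \<le> N1 * N2 * N3" "N1 * N2 \<le> N1 * N2 * N3" using assms by auto
  have "tab_time N1 N2 N3 = 2 + 4 * N1 + 6 * (N1 * N2) + 3 * (N1 * N2 * N3)"
    by (simp add: tab_time_def algebra_simps)
  then show ?thesis using a by linarith
qed

section \<open>Hashing and sketching\<close>

text \<open>The failure probability \<open>\<delta>\<close> enters the program only through the constant \<open>K \<ge> 256 / \<delta>\<close>.\<close>

definition size_bound :: "nat \<Rightarrow> rexp" where
  "size_bound K = RMul (RIndex (IConst K)) (RMul (RDiv (RIndex (scal ''rank'')) (RCell ''eps'' (IConst 0) (IConst 0)))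
     (RDiv (RIndex (scal ''rank'')) (RCell ''eps'' (IConst 0) (IConst 0))))"

abbreviation Doubling :: "nat \<Rightarrow> com" where
  "Doubling K \<equiv> While (RLess (RIndex (scal ''b'')) (size_bound K)) (seti ''b'' (IAdd (scal ''b'') (scal ''b'')))"

definition Buckets :: "nat \<Rightarrow> com" where
  "Buckets K = Seq (seti ''b'' (IConst 1))
     (Doubling K)"

text \<open>The exponent is determined by the memory before any coin is seen, since the number of
  coins to be supplied depends on it. By minimality either \<open>lb\<close> is 0 or half of
  \<open>2 ^ lb\<close> lies below \<open>B\<close>, whence the upper bound.\<close>

lemma run_Buckets:
  fixes K :: nat
  assumes B: "B = real K * (real (idx s ''rank'' 0 0) / val s ''eps'' 0 0)\<^sup>2"
  shows "\<exists>lb. B \<le> 2 ^ lb \<and> 2 ^ lb \<le> 1 + 2 * B \<and>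
    (\<forall>cs. run (Buckets K) s cs (2 + 2 * lb) (\<lambda>s' cs'. cs' = cs \<and> same {''b''} {} s s' \<and> idx s' ''b'' 0 0 = 2 ^ lb))"
proof -
  have B0: "B \<ge> 0" unfolding B by simp
  obtain k where k: "B \<le> 2 ^ k" using real_arch_pow[of 2 B] by (auto intro: less_imp_le)
  define lb where "lb = (LEAST k. B \<le> 2 ^ k)"
  have lb: "B \<le> 2 ^ lb" unfolding lb_def by (rule LeastI[of _ k]) (rule k)
  have less: "2 ^ j < B" if "j < lb" for j using not_less_Least[OF that[unfolded lb_def]] by simp
  have le: "2 ^ lb \<le> 1 + 2 * B"
  proof (cases lb)
    case (Suc j)
    then show ?thesis using less[of j] by simp
  qed (use B0 in simp)
  let ?Q = "\<lambda>cs s' cs'. cs' = cs \<and> same {''b''} {} s s' \<and> idx s' ''b'' 0 0 = 2 ^ lb"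
  have bnd: "reval s' (size_bound K) = B" if "same {''b''} {} s s'" for s'
    using that by (simp add: size_bound_def B same_def power2_eq_square)
  have loop: "run (Doubling K) s' cs (1 + 2 * d) (?Q cs)"
    if "same {''b''} {} s s'" "idx s' ''b'' 0 0 = 2 ^ j" "j + d = lb" for s' j d cs
    using that
  proof (induction d arbitrary: s' j)
    case 0
    then have "run (Doubling K) s' cs 1 (?Q cs)"
      by (intro run_While_done) (use lb in \<open>auto simp: bnd\<close>)
    then show ?case by simp
  next
    case (Suc d)
    have "run (Doubling K) s' cs (1 + 1 + (1 + 2 * d)) (?Q cs)"
    proof (rule run_While_step)
      show "beval s' (RLess (RIndex (scal ''b'')) (size_bound K))" using less[of j] Suc.prems by (simp add: bnd)
      show "run (seti ''b'' (IAdd (scal ''b'') (scal ''b''))) s' cs 1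
        (\<lambda>s'' cs'. cs' = cs \<and> same {''b''} {} s s'' \<and> idx s'' ''b'' 0 0 = 2 ^ Suc j)"
        using Suc.prems by (intro run_seti) (auto simp: upd_apply same_def)
    next
      fix s'' cs' assume "cs' = cs \<and> same {''b''} {} s s'' \<and> idx s'' ''b'' 0 0 = 2 ^ Suc j"
      then show "run (Doubling K) s'' cs' (1 + 2 * d) (?Q cs)"
        using Suc.IH[of s'' "Suc j"] Suc.prems by auto
    qed
    then show ?case by simp
  qed
  have "run (Buckets K) s cs (1 + (1 + 2 * lb)) (?Q cs)" for cs
    unfolding Buckets_def
  proof (rule run_Seq)
    show "run (seti ''b'' (IConst 1)) s cs 1 (\<lambda>s' cs'. cs' = cs \<and> same {''b''} {} s s' \<and> idx s' ''b'' 0 0 = 1)"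
      by (rule run_seti) (simp add: upd_apply same_def)
  qed (use loop[of _ 0 lb] in auto)
  then show ?thesis using lb le by auto
qed

abbreviation ShiftIn :: "string \<Rightarrow> com" where
  "ShiftIn g \<equiv> IAssign g (scal ''i'') (IConst 0)
     (IAdd (IAdd (ICell g (scal ''i'') (IConst 0)) (ICell g (scal ''i'') (IConst 0))) (scal ''f''))"

abbreviation NextBit :: "string \<Rightarrow> com" where
  "NextBit g \<equiv> Seq (Flip ''f'' (IConst 0) (IConst 0)) (Seq (ShiftIn g) (seti ''w'' (IAdd (scal ''w'') (scal ''w''))))"

text \<open>The counter \<open>w\<close> doubles until it reaches \<open>b\<close>. Started at 1, it
  causes exactly \<open>lb\<close> flips although the program never computes
  \<open>lb\<close>.\<close>

definition HashBucket :: "string \<Rightarrow> com" where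
  "HashBucket g = While (ILess (scal ''w'') (scal ''b'')) (NextBit g)"

lemma run_HashBucket:
  assumes g: "g \<notin> {''f'', ''w'', ''b'', ''i''}"
  shows "idx s ''w'' 0 0 * 2 ^ length v = idx s ''b'' 0 0 \<Longrightarrow> idx s ''w'' 0 0 > 0 \<Longrightarrow>
   run (HashBucket g) s (v @ cs) (1 + 4 * length v) (\<lambda>s' cs'. cs' = cs \<and> same {''f'', ''w'', g} {} s s' \<and>
     idx s' g = (\<lambda>x y. if x = idx s ''i'' 0 0 \<and> y = 0 then bucket (idx s g x 0) v else idx s g x y))"
proof (induction v arbitrary: s)
  case Nil
  have "run (HashBucket g) s ([] @ cs) 1 (\<lambda>s' cs'. cs' = cs \<and> same {''f'', ''w'', g} {} s s' \<and>
     idx s' g = (\<lambda>x y. if x = idx s ''i'' 0 0 \<and> y = 0 then bucket (idx s g x 0) [] else idx s g x y))"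
    unfolding HashBucket_def by (rule run_While_done) (use Nil in \<open>auto simp: bucket_def fun_eq_iff\<close>)
  then show ?case by simp
next
  case (Cons c v)
  have g': "g \<noteq> ''f''" "''f'' \<noteq> g" "g \<noteq> ''w''" "''w'' \<noteq> g" "g \<noteq> ''i''" "''i'' \<noteq> g" "''b'' \<noteq> g"
    using g by auto
  let ?i = "idx s ''i'' 0 0"
  let ?Q = "\<lambda>s' cs'. cs' = cs \<and> same {''f'', ''w'', g} {} s s' \<and>
     idx s' g = (\<lambda>x y. if x = ?i \<and> y = 0 then bucket (idx s g x 0) (c # v) else idx s g x y)"
  have "run (HashBucket g) s (c # (v @ cs)) (1 + (1 + (1 + 1)) + (1 + 4 * length v)) ?Q"
    unfolding HashBucket_def
  proof (rule run_While_step)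
    show "beval s (ILess (scal ''w'') (scal ''b''))"
    proof -
      have "idx s ''w'' 0 0 * 1 < idx s ''b'' 0 0" unfolding Cons.prems(1)[symmetric] using Cons.prems(2)
        by (intro mult_strict_left_mono one_less_power) auto
      then show ?thesis by simp
    qed
  next
    show "run (NextBit g) s (c # (v @ cs)) (1 + (1 + 1))
      (\<lambda>s' cs'. cs' = v @ cs \<and> same {''f'', ''w'', g} {} s s' \<and> idx s' ''w'' 0 0 = idx s ''w'' 0 0 + idx s ''w'' 0 0 \<and>
        idx s' g = (\<lambda>x y. if x = ?i \<and> y = 0 then idx s g x 0 + idx s g x 0 + of_bool c else idx s g x y))"
    proof (rule run_Seq)
      show "run (Flip ''f'' (IConst 0) (IConst 0)) s (c # (v @ cs)) 1
        (\<lambda>s' cs'. cs' = v @ cs \<and> s' = s\<lparr>idx := upd (idx s) ''f'' 0 0 (of_bool c)\<rparr>)"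
        by (rule run_Flip) simp
    next
      fix s1 cs1 assume s1: "cs1 = v @ cs \<and> s1 = s\<lparr>idx := upd (idx s) ''f'' 0 0 (of_bool c)\<rparr>"
      define s2 where "s2 = s1\<lparr>idx := upd (idx s1) g ?i 0 (idx s g ?i 0 + idx s g ?i 0 + of_bool c)\<rparr>"
      define s3 where "s3 = s2\<lparr>idx := upd (idx s2) ''w'' 0 0 (idx s ''w'' 0 0 + idx s ''w'' 0 0)\<rparr>"
      have r1: "run (ShiftIn g) s1 cs1 1
        (\<lambda>s' cs'. cs' = cs1 \<and> s' = s2)"
        using s1 by (intro run_IAssign) (simp add: g' s2_def upd_apply)
      have r2: "run (seti ''w'' (IAdd (scal ''w'') (scal ''w''))) s2 cs1 1 (\<lambda>s' cs'. cs' = cs1 \<and> s' = s3)"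
        using s1 by (intro run_seti) (simp add: g' s3_def s2_def upd_apply)
      have "run (Seq (ShiftIn g)
         (seti ''w'' (IAdd (scal ''w'') (scal ''w'')))) s1 cs1 (1 + 1) (\<lambda>s' cs'. cs' = cs1 \<and> s' = s3)"
        by (rule run_Seq[OF r1]) (use r2 in simp)
      then show "run (Seq (ShiftIn g)
         (seti ''w'' (IAdd (scal ''w'') (scal ''w'')))) s1 cs1 (1 + 1)
      (\<lambda>s' cs'. cs' = v @ cs \<and> same {''f'', ''w'', g} {} s s' \<and> idx s' ''w'' 0 0 = idx s ''w'' 0 0 + idx s ''w'' 0 0 \<and>
        idx s' g = (\<lambda>x y. if x = ?i \<and> y = 0 then idx s g x 0 + idx s g x 0 + of_bool c else idx s g x y))"
      proof (rule run_mono)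
        fix s' cs' assume a: "cs' = cs1 \<and> s' = s3"
        have "idx s3 g = (\<lambda>x y. if x = ?i \<and> y = 0 then idx s g x 0 + idx s g x 0 + of_bool c else idx s g x y)"
          using s1 by (simp add: g' s3_def s2_def upd_apply cong: if_cong)
        note h1 = this
        have h2: "same {''f'', ''w'', g} {} s s3" using s1 by (simp add: s3_def s2_def same_def upd_apply)
        have h3: "idx s3 ''w'' 0 0 = idx s ''w'' 0 0 + idx s ''w'' 0 0" by (simp add: s3_def upd_apply)
        show "cs' = v @ cs \<and> same {''f'', ''w'', g} {} s s' \<and> idx s' ''w'' 0 0 = idx s ''w'' 0 0 + idx s ''w'' 0 0 \<and>
          idx s' g = (\<lambda>x y. if x = ?i \<and> y = 0 then idx s g x 0 + idx s g x 0 + of_bool c else idx s g x y)"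
        proof -
          have "s' = s3" "cs' = v @ cs" using a s1 by blast+
          then show ?thesis using h1 h2 h3 by (intro conjI) simp_all
        qed
      qed simp
    qed
  next
    fix s' cs' assume s': "cs' = v @ cs \<and> same {''f'', ''w'', g} {} s s' \<and> idx s' ''w'' 0 0 = idx s ''w'' 0 0 + idx s ''w'' 0 0 \<and>
        idx s' g = (\<lambda>x y. if x = ?i \<and> y = 0 then idx s g x 0 + idx s g x 0 + of_bool c else idx s g x y)"
    note a = s'[THEN conjunct1] s'[THEN conjunct2, THEN conjunct1] s'[THEN conjunct2, THEN conjunct2, THEN conjunct1]
      s'[THEN conjunct2, THEN conjunct2, THEN conjunct2]
    have fr: "idx s' ''i'' = idx s ''i''" "idx s' ''b'' = idx s ''b''"
      using a(2) by (simp_all add: same_def g')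
    have IH: "run (HashBucket g) s' (v @ cs) (1 + 4 * length v) (\<lambda>s'' cs'. cs' = cs \<and> same {''f'', ''w'', g} {} s' s'' \<and>
     idx s'' g = (\<lambda>x y. if x = idx s' ''i'' 0 0 \<and> y = 0 then bucket (idx s' g x 0) v else idx s' g x y))"
    proof (rule Cons.IH)
      show "idx s' ''w'' 0 0 * 2 ^ length v = idx s' ''b'' 0 0"
        unfolding a(3) fr Cons.prems(1)[symmetric] by (simp add: algebra_simps)
      show "idx s' ''w'' 0 0 > 0" unfolding a(3) using Cons.prems(2) by simp
    qed
    have "run (HashBucket g) s' (v @ cs) (1 + 4 * length v) ?Q"
    proof (rule run_mono[OF IH])
      fix s'' cs'' assume *: "cs'' = cs \<and> same {''f'', ''w'', g} {} s' s'' \<and>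
         idx s'' g = (\<lambda>x y. if x = idx s' ''i'' 0 0 \<and> y = 0 then bucket (idx s' g x 0) v else idx s' g x y)"
      have "same {''f'', ''w'', g} {} s s''"
        by (rule same_trans[OF a(2) *[THEN conjunct2, THEN conjunct1]]) auto
      moreover have "idx s'' g x y = (if x = ?i \<and> y = 0 then bucket (idx s g x 0) (c # v) else idx s g x y)" for x y
        unfolding *[THEN conjunct2, THEN conjunct2] a(4) fr by (simp add: bucket_def)
      ultimately show "?Q s'' cs''" using *[THEN conjunct1] by (intro conjI ext)
    qed simp
then show "run (While (ILess (scal ''w'') (scal ''b'')) (NextBit g)) s' cs' (1 + 4 * length v) ?Q"
      unfolding HashBucket_def a(1) .
  qed
  moreover have "1 + (1 + (1 + 1)) + (1 + 4 * length v) = 1 + 4 * length (c # v)" "c # (v @ cs) = (c # v) @ cs"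
    by simp_all
  ultimately show ?case by (simp only:)
qed

abbreviation SetSign :: "string \<Rightarrow> com" where
  "SetSign S \<equiv> RAssign S (scal ''i'') (IConst 0) (RSub (RIndex (IConst 1)) (RIndex (IAdd (scal ''f'') (scal ''f''))))"

abbreviation FlipSign :: "string \<Rightarrow> com" where
  "FlipSign S \<equiv> Seq (Flip ''f'' (IConst 0) (IConst 0)) (SetSign S)"

abbreviation HashOne :: "string \<Rightarrow> string \<Rightarrow> com" where
  "HashOne g S \<equiv> Seq (IAssign g (scal ''i'') (IConst 0) (IConst 0))
     (Seq (seti ''w'' (IConst 1)) (Seq (HashBucket g) (FlipSign S)))"

definition HashGen :: "string \<Rightarrow> string \<Rightarrow> com" where
  "HashGen g S = For ''i'' (scal ''n'')
     (HashOne g S)"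

text \<open>Exactly \<open>lb + 1\<close> coins are used per index, so index \<open>j\<close> reads
  block \<open>j\<close> of the string, the tables agree with \<open>hash\<close> and
  \<open>sign\<close>, and the coins of a second sketch remain untouched.\<close>

lemma run_HashGen:
  assumes g: "g \<notin> {''f'', ''w'', ''b'', ''i'', ''n''}" and b: "idx s ''b'' 0 0 = 2 ^ lb" and n: "idx s ''n'' 0 0 = n"
    and w: "length w = n * Suc lb"
  shows "run (HashGen g S) s (w @ cs) (2 + n * (7 + 4 * lb)) (\<lambda>s' cs'. cs' = cs \<and>
     same {''f'', ''w'', ''i'', g} {S} s s' \<and> (\<forall>j<n. idx s' g j 0 = hash lb w j \<and> val s' S j 0 = sign lb w j))"
proof -
  have g': "g \<noteq> ''f''" "''f'' \<noteq> g" "g \<noteq> ''w''" "''w'' \<noteq> g" "g \<noteq> ''i''" "''i'' \<noteq> g" "''b'' \<noteq> g" "''n'' \<noteq> g"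
    using g by auto
  define I where "I = (\<lambda>k s' cs'. cs' = drop (k * Suc lb) w @ cs \<and> same {''f'', ''w'', ''i'', g} {S} s s' \<and>
     (\<forall>j<k. idx s' g j 0 = hash lb w j \<and> val s' S j 0 = sign lb w j))"
  have "run (HashGen g S) s (w @ cs) (2 + n * ((1 + (1 + ((1 + 4 * lb) + (1 + 1)))) + 2)) (I n)"
    unfolding HashGen_def
  proof (rule run_For[where I = I])
    show "I 0 (s\<lparr>idx := upd (idx s) ''i'' 0 0 0\<rparr>) (w @ cs)" by (simp add: I_def same_def upd_apply)
  next
    fix k s1 cs1 assume k: "k < n" "I k s1 cs1" "idx s1 ''i'' 0 0 = k"
    have kb: "k * Suc lb + Suc lb \<le> length w" using block_in_prefix[OF k(1), of lb] w by simp
    define v where "v = take lb (drop (k * Suc lb) w)"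
    define c where "c = w ! (k * Suc lb + lb)"
    define rest where "rest = drop (Suc k * Suc lb) w @ cs"
    have lv: "length v = lb" using kb by (simp add: v_def)
    have spl: "cs1 = v @ (c # rest)"
    proof -
      have "drop (k * Suc lb) w = v @ drop lb (drop (k * Suc lb) w)" by (simp only: v_def append_take_drop_id)
      also have "drop lb (drop (k * Suc lb) w) = drop (k * Suc lb + lb) w" by (simp add: add.commute)
      also have "\<dots> = c # drop (Suc k * Suc lb) w"
        using kb Cons_nth_drop_Suc[of "k * Suc lb + lb" w] by (simp add: c_def add_ac)
      finally show ?thesis using k(2) by (simp add: I_def rest_def)
    qed
    have s1: "same {''f'', ''w'', ''i'', g} {S} s s1" "\<forall>j<k. idx s1 g j 0 = hash lb w j \<and> val s1 S j 0 = sign lb w j"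
      using k(2) unfolding I_def by blast+
    have b1: "idx s1 ''b'' = idx s ''b''" using s1(1) g' by (simp add: same_def)
    show "run (HashOne g S)
      s1 cs1 (1 + (1 + ((1 + 4 * lb) + (1 + 1))))
      (\<lambda>s'' cs''. idx s'' ''i'' 0 0 = k \<and> I (Suc k) (s''\<lparr>idx := upd (idx s'') ''i'' 0 0 (Suc k)\<rparr>) cs'')"
    proof (rule run_Seq[OF run_IAssign[where Q = "\<lambda>s2 cs2. cs2 = cs1 \<and> s2 = s1\<lparr>idx := upd (idx s1) g k 0 0\<rparr>"]])
      show "cs1 = cs1 \<and> s1\<lparr>idx := upd (idx s1) g (ieval s1 (scal ''i'')) (ieval s1 (IConst 0)) (ieval s1 (IConst 0))\<rparr> =
        s1\<lparr>idx := upd (idx s1) g k 0 0\<rparr>" using k by simp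
    next
      fix s2 cs2 assume s2: "cs2 = cs1 \<and> s2 = s1\<lparr>idx := upd (idx s1) g k 0 0\<rparr>"
      define s3 where "s3 = s2\<lparr>idx := upd (idx s2) ''w'' 0 0 1\<rparr>"
      have s3: "same {''w'', g} {} s1 s3" "idx s3 ''w'' 0 0 = 1" "idx s3 g = (\<lambda>x y. if x = k \<and> y = 0 then 0 else idx s1 g x y)"
          "idx s3 ''b'' 0 0 = 2 ^ lb" "idx s3 ''i'' 0 0 = k"
        using s2 g' b b1 k(3) by (simp_all add: s3_def same_def upd_apply)
      have HB: "run (HashBucket g) s3 cs1 (1 + 4 * lb) (\<lambda>s4 cs4. cs4 = c # rest \<and> same {''f'', ''w'', g} {} s3 s4 \<and>
         idx s4 g = (\<lambda>x y. if x = idx s3 ''i'' 0 0 \<and> y = 0 then bucket (idx s3 g x 0) v else idx s3 g x y))"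
        using run_HashBucket[of g s3 v "c # rest"] g s3 lv by (simp add: spl)
      have fin: "run (FlipSign S) s4 cs4 (1 + 1)
        (\<lambda>s'' cs''. idx s'' ''i'' 0 0 = k \<and> I (Suc k) (s''\<lparr>idx := upd (idx s'') ''i'' 0 0 (Suc k)\<rparr>) cs'')"
        if s4: "cs4 = c # rest \<and> same {''f'', ''w'', g} {} s3 s4 \<and>
         idx s4 g = (\<lambda>x y. if x = idx s3 ''i'' 0 0 \<and> y = 0 then bucket (idx s3 g x 0) v else idx s3 g x y)" for s4 cs4
      proof -
        have g4: "idx s4 g = (\<lambda>x y. if x = k \<and> y = 0 then bucket 0 v else idx s1 g x y)"
          unfolding s4[THEN conjunct2, THEN conjunct2] s3(3,5) by (intro ext) simp
        have s14: "same {''f'', ''w'', g} {} s1 s4"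
          by (rule same_trans[OF s3(1) s4[THEN conjunct2, THEN conjunct1]]) auto
        have i4: "idx s4 ''i'' 0 0 = k" using s14 k(3) by (simp add: same_def g')
        have ss4: "same {''f'', ''w'', ''i'', g} {S} s s4" by (rule same_trans[OF s1(1) s14]) auto
        have S4: "val s4 = val s1" using s14 by (simp add: same_def fun_eq_iff)
        define s5 where "s5 = s4\<lparr>idx := upd (idx s4) ''f'' 0 0 (of_bool c)\<rparr>"
        define s6 where "s6 = s5\<lparr>val := upd (val s5) S k 0 (1 - 2 * of_bool c)\<rparr>"
        have f1: "idx s6 ''i'' 0 0 = k" using i4 by (simp add: s6_def s5_def upd_apply)
        have g6: "idx s6 g = idx s4 g" using g by (simp add: s6_def s5_def upd_apply)
        have v6: "val s6 S = (\<lambda>x y. if x = k \<and> y = 0 then 1 - 2 * of_bool c else val s1 S x y)"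
          by (simp add: s6_def s5_def upd_apply S4)
        have n1: "same {''f'', ''w'', ''i'', g} {S} s (s6\<lparr>idx := upd (idx s6) ''i'' 0 0 (Suc k)\<rparr>)"
          using ss4 by (simp add: s6_def s5_def same_def upd_apply)
        have n2: "\<forall>j<Suc k. idx (s6\<lparr>idx := upd (idx s6) ''i'' 0 0 (Suc k)\<rparr>) g j 0 = hash lb w j \<and>
            val (s6\<lparr>idx := upd (idx s6) ''i'' 0 0 (Suc k)\<rparr>) S j 0 = sign lb w j"
        proof -
          have hk: "bucket 0 v = hash lb w k" "1 - 2 * of_bool c = sign lb w k"
            by (simp_all add: hash_def sign_def v_def c_def)
          show ?thesis using s1(2) by (simp add: upd_apply g' g6 g4 v6 less_Suc_eq hk)
        qed
        have *: "idx s6 ''i'' 0 0 = k \<and> I (Suc k) (s6\<lparr>idx := upd (idx s6) ''i'' 0 0 (Suc k)\<rparr>) rest"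
          unfolding I_def rest_def by (intro conjI refl f1 n1 n2)
        have "run (Flip ''f'' (IConst 0) (IConst 0)) s4 cs4 1 (\<lambda>s' cs'. cs' = rest \<and> s' = s5)"
          unfolding s4[THEN conjunct1] by (rule run_Flip) (simp add: s5_def)
        then show ?thesis
        proof (rule run_Seq)
          fix s' cs' assume a: "cs' = rest \<and> s' = s5"
          have "s5\<lparr>val := upd (val s5) S (ieval s5 (scal ''i'')) (ieval s5 (IConst 0))
             (reval s5 (RSub (RIndex (IConst 1)) (RIndex (IAdd (scal ''f'') (scal ''f'')))))\<rparr> = s6"
          proof -
            have f5: "idx s5 ''i'' 0 0 = k" "idx s5 ''f'' 0 0 = of_bool c" by (simp_all add: s5_def upd_apply i4)
            show ?thesis by (cases c) (simp_all add: s6_def f5)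
          qed
          then show "run (SetSign S) s' cs' 1
            (\<lambda>s'' cs''. idx s'' ''i'' 0 0 = k \<and> I (Suc k) (s''\<lparr>idx := upd (idx s'') ''i'' 0 0 (Suc k)\<rparr>) cs'')"
            using a * by (intro run_RAssign) simp
        qed
      qed
      show "run (Seq (seti ''w'' (IConst 1))
         (Seq (HashBucket g)
         (FlipSign S)))
        s2 cs2 (1 + ((1 + 4 * lb) + (1 + 1)))
        (\<lambda>s'' cs''. idx s'' ''i'' 0 0 = k \<and> I (Suc k) (s''\<lparr>idx := upd (idx s'') ''i'' 0 0 (Suc k)\<rparr>) cs'')"
      proof (rule run_Seq[OF run_seti[where Q = "\<lambda>s' cs'. cs' = cs1 \<and> s' = s3"]])
        show "cs2 = cs1 \<and> s2\<lparr>idx := upd (idx s2) ''w'' 0 0 (ieval s2 (IConst 1))\<rparr> = s3" using s2 by (simp add: s3_def)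
      next
        fix s' cs' assume "cs' = cs1 \<and> s' = s3"
        then show "run (Seq (HashBucket g)
           (FlipSign S))
          s' cs' ((1 + 4 * lb) + (1 + 1))
          (\<lambda>s'' cs''. idx s'' ''i'' 0 0 = k \<and> I (Suc k) (s''\<lparr>idx := upd (idx s'') ''i'' 0 0 (Suc k)\<rparr>) cs'')"
          using run_Seq[OF HB fin] by simp
      qed
    qed
  next
    fix k s' cs' assume "I k s' cs'"
    then show "ieval s' (scal ''n'') = n" unfolding I_def same_def using g' n by simp
  qed
  then show ?thesis
  proof (rule run_mono)
    fix s' cs' assume "I n s' cs'"
    then show "cs' = cs \<and> same {''f'', ''w'', ''i'', g} {S} s s' \<and> (\<forall>j<n. idx s' g j 0 = hash lb w j \<and> val s' S j 0 = sign lb w j)"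
      unfolding I_def using w by simp
  qed (simp add: algebra_simps)
qed

text \<open>The mask is applied on the fly by random access to \<open>W\<close>, so \<open>M\<close>
  is never stored.\<close>

definition entry_expr :: rexp where
  "entry_expr = RMul (RCell ''entry'' (scal ''e'') (IConst 0))
     (RCell ''W'' (ICell ''row'' (scal ''e'') (IConst 0)) (ICell ''col'' (scal ''e'') (IConst 0)))"

definition Accumulate :: "string \<Rightarrow> iexp \<Rightarrow> iexp \<Rightarrow> rexp \<Rightarrow> com" where
  "Accumulate a i j e = RAssign a i j (RAdd (RCell a i j) e)"

lemma run_Accumulate:
  "Q (s\<lparr>val := upd (val s) a (ieval s i) (ieval s j) (val s a (ieval s i) (ieval s j) + reval s e)\<rparr>) cs \<Longrightarrow>
   run (Accumulate a i j e) s cs 1 Q"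
  unfolding Accumulate_def by (rule run_RAssign) simp

abbreviation row_of_entry :: iexp where "row_of_entry \<equiv> ICell ''row'' (scal ''e'') (IConst 0)"

abbreviation col_of_entry :: iexp where "col_of_entry \<equiv> ICell ''col'' (scal ''e'') (IConst 0)"

abbreviation AddToC :: com where
  "AddToC \<equiv> Accumulate ''C'' row_of_entry (ICell ''g'' col_of_entry (IConst 0)) (RMul (RCell ''S'' col_of_entry (IConst 0)) entry_expr)"

abbreviation AddToD :: com where
  "AddToD \<equiv> Accumulate ''D'' (ICell ''h'' row_of_entry (IConst 0)) col_of_entry (RMul (RCell ''T'' row_of_entry (IConst 0)) entry_expr)"

definition Entries :: com where
  "Entries = For ''e'' (scal ''nnz'')
     (Seq AddToC
      AddToD)"

text \<open>An entry changes one cell of \<open>C\<close>, in its row and the bucket of its column,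
  and one cell of \<open>D\<close>, in the bucket of its row and its column. With the test and the
  increment this makes 4 steps per nonzero entry.\<close>

lemma run_Entries:
  fixes s :: memory
  defines "R \<equiv> \<lambda>x. idx s ''row'' x 0" and "L \<equiv> \<lambda>x. idx s ''col'' x 0"
  defines "v \<equiv> \<lambda>x. val s ''entry'' x 0 * val s ''W'' (R x) (L x)"
  assumes N: "idx s ''nnz'' 0 0 = N"
  shows "run Entries s cs (2 + N * 4) (\<lambda>s' cs'. cs' = cs \<and> same {''e''} {''C'', ''D''} s s' \<and>
     val s' ''C'' = (\<lambda>i u. val s ''C'' i u + (\<Sum>x<N. of_bool (i = R x \<and> u = idx s ''g'' (L x) 0) * (val s ''S'' (L x) 0 * v x))) \<and>
     val s' ''D'' = (\<lambda>u j. val s ''D'' u j + (\<Sum>x<N. of_bool (u = idx s ''h'' (R x) 0 \<and> j = L x) * (val s ''T'' (R x) 0 * v x))))"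
proof -
  define I where "I = (\<lambda>N s' cs'. cs' = cs \<and> same {''e''} {''C'', ''D''} s s' \<and>
     val s' ''C'' = (\<lambda>i u. val s ''C'' i u + (\<Sum>x<N. of_bool (i = R x \<and> u = idx s ''g'' (L x) 0) * (val s ''S'' (L x) 0 * v x))) \<and>
     val s' ''D'' = (\<lambda>u j. val s ''D'' u j + (\<Sum>x<N. of_bool (u = idx s ''h'' (R x) 0 \<and> j = L x) * (val s ''T'' (R x) 0 * v x))))"
  have "run Entries s cs (2 + N * ((1 + 1) + 2)) (I N)"
    unfolding Entries_def
  proof (rule run_For[where I = I])
    show "I 0 (s\<lparr>idx := upd (idx s) ''e'' 0 0 0\<rparr>) cs" by (simp add: I_def same_def upd_apply)
  next
    fix k s' cs' assume k: "k < N" "I k s' cs'" "idx s' ''e'' 0 0 = k"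
    have fr: "idx s' ''row'' = idx s ''row''" "idx s' ''col'' = idx s ''col''" "idx s' ''g'' = idx s ''g''" "idx s' ''h'' = idx s ''h''"
      "val s' ''S'' = val s ''S''" "val s' ''T'' = val s ''T''" "val s' ''entry'' = val s ''entry''" "val s' ''W'' = val s ''W''"
      using k(2) by (auto simp: I_def same_def)
    show "run (Seq AddToC
      AddToD) s' cs' (1 + 1)
      (\<lambda>s'' cs''. idx s'' ''e'' 0 0 = k \<and> I (Suc k) (s''\<lparr>idx := upd (idx s'') ''e'' 0 0 (Suc k)\<rparr>) cs'')"
    proof (rule run_Seq[OF run_Accumulate[where Q = "\<lambda>s2 cs2. cs2 = cs' \<and> s2 = s'\<lparr>val := upd (val s') ''C'' (R k) (idx s ''g'' (L k) 0)
         (val s' ''C'' (R k) (idx s ''g'' (L k) 0) + val s ''S'' (L k) 0 * v k)\<rparr>"]])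
      show "cs' = cs' \<and> s'\<lparr>val := upd (val s') ''C'' (ieval s' row_of_entry)
         (ieval s' (ICell ''g'' col_of_entry (IConst 0)))
         (val s' ''C'' (ieval s' row_of_entry) (ieval s' (ICell ''g'' col_of_entry (IConst 0))) +
          reval s' (RMul (RCell ''S'' col_of_entry (IConst 0)) entry_expr))\<rparr> =
        s'\<lparr>val := upd (val s') ''C'' (R k) (idx s ''g'' (L k) 0)
         (val s' ''C'' (R k) (idx s ''g'' (L k) 0) + val s ''S'' (L k) 0 * v k)\<rparr>"
        using k(3) by (simp add: fr R_def L_def v_def entry_expr_def)
    next
      fix s2 cs2 assume s2: "cs2 = cs' \<and> s2 = s'\<lparr>val := upd (val s') ''C'' (R k) (idx s ''g'' (L k) 0)
         (val s' ''C'' (R k) (idx s ''g'' (L k) 0) + val s ''S'' (L k) 0 * v k)\<rparr>"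
      define s3 where "s3 = s2\<lparr>val := upd (val s2) ''D'' (idx s ''h'' (R k) 0) (L k)
         (val s' ''D'' (idx s ''h'' (R k) 0) (L k) + val s ''T'' (R k) 0 * v k)\<rparr>"
      have C3: "val s3 ''C'' = (\<lambda>i u. val s' ''C'' i u + of_bool (i = R k \<and> u = idx s ''g'' (L k) 0) * (val s ''S'' (L k) 0 * v k))"
        using s2 by (auto simp: s3_def upd_apply fun_eq_iff)
      have D3: "val s3 ''D'' = (\<lambda>u j. val s' ''D'' u j + of_bool (u = idx s ''h'' (R k) 0 \<and> j = L k) * (val s ''T'' (R k) 0 * v k))"
        using s2 by (auto simp: s3_def upd_apply fun_eq_iff)
      have "same {''e''} {''C'', ''D''} s (s3\<lparr>idx := upd (idx s3) ''e'' 0 0 (Suc k)\<rparr>)"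
        using k(2) s2 by (auto simp: I_def s3_def same_def upd_apply)
      moreover have "idx s3 ''e'' 0 0 = k" using s2 k(3) by (simp add: s3_def)
      ultimately have "idx s3 ''e'' 0 0 = k \<and> I (Suc k) (s3\<lparr>idx := upd (idx s3) ''e'' 0 0 (Suc k)\<rparr>) cs'"
        using k(2) by (simp add: I_def C3 D3 add.assoc del: sum_of_bool_mult_eq sum_mult_of_bool_eq)
      moreover have "s2\<lparr>val := upd (val s2) ''D'' (ieval s2 (ICell ''h'' row_of_entry (IConst 0)))
         (ieval s2 col_of_entry)
         (val s2 ''D'' (ieval s2 (ICell ''h'' row_of_entry (IConst 0))) (ieval s2 col_of_entry) +
          reval s2 (RMul (RCell ''T'' row_of_entry (IConst 0)) entry_expr))\<rparr> = s3"
        using s2 k(3) by (simp add: s3_def fr R_def L_def v_def entry_expr_def upd_apply)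
      ultimately show "run AddToD s2 cs2 1
        (\<lambda>s'' cs''. idx s'' ''e'' 0 0 = k \<and> I (Suc k) (s''\<lparr>idx := upd (idx s'') ''e'' 0 0 (Suc k)\<rparr>) cs'')"
        using s2 by (intro run_Accumulate) simp
    qed
  next
    fix k s' cs' assume "I k s' cs'"
    then show "ieval s' (scal ''nnz'') = N" using N by (auto simp: I_def same_def)
  qed
  then show ?thesis
  proof (rule run_mono)
    fix s' cs' assume "I N s' cs'"
    then show "cs' = cs \<and> same {''e''} {''C'', ''D''} s s' \<and>
     val s' ''C'' = (\<lambda>i u. val s ''C'' i u + (\<Sum>x<N. of_bool (i = R x \<and> u = idx s ''g'' (L x) 0) * (val s ''S'' (L x) 0 * v x))) \<and>
     val s' ''D'' = (\<lambda>u j. val s ''D'' u j + (\<Sum>x<N. of_bool (u = idx s ''h'' (R x) 0 \<and> j = L x) * (val s ''T'' (R x) 0 * v x)))"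
      by (simp only: I_def)
  qed simp
qed

section \<open>One round of the greedy algorithm\<close>

lemma runE:
  assumes "run c s cs T (\<lambda>s' cs'. cs' = cs \<and> P s')"
  obtains t s' where "exec c s cs t s' cs" "t \<le> T" "P s'"
  using assms by (auto simp: run_def)

lemma run_Tab0:
  fixes Na Nb Nc :: nat
  assumes b1: "\<And>s'. tab_same dst s s' \<Longrightarrow> ieval s' n1 = Na"
    and b2: "\<And>s'. tab_same dst s s' \<Longrightarrow> ieval s' n2 = Nb"
    and b3: "\<And>s'. tab_same dst s s' \<Longrightarrow> ieval s' n3 = Nc"
    and e: "\<And>s' x y z. tab_same dst s s' \<Longrightarrow> x < Na \<Longrightarrow> y < Nb \<Longrightarrow> z < Nc \<Longrightarrow>
      idx s' ''i'' 0 0 = x \<Longrightarrow> idx s' ''j'' 0 0 = y \<Longrightarrow> idx s' ''l'' 0 0 = z \<Longrightarrow>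
      val s' dst x y = val s dst x y \<Longrightarrow> reval s' e = F x y z"
    and dst: "dst \<noteq> ''a''"
  shows "run (Tab dst (IConst 0) n1 n2 n3 e) s cs (tab_time Na Nb Nc) (\<lambda>s' cs'. cs' = cs \<and>
    (tab_same dst s s' \<and> (\<forall>x y. x < Na \<longrightarrow> y < Nb \<longrightarrow> val s' dst x y = (\<Sum>z<Nc. F x y z))))"
proof -
  have "run (Tab dst (IConst 0) n1 n2 n3 e) s cs (tab_time Na Nb Nc) (\<lambda>s' cs'. cs' = cs \<and>
    tab_same dst s s' \<and>
    val s' dst = (\<lambda>x y. if x < Na \<and> 0 \<le> y \<and> y < 0 + Nb then \<Sum>z<Nc. F x (y - 0) z else val s dst x y))"
    by (rule run_Tab[where \<rho> = 0]) (simp_all add: b1 b2 b3 e dst)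
  then show ?thesis by (rule run_mono) simp_all
qed

text \<open>The result is an equation for the whole array, because the columns written in earlier
  rounds have to survive.\<close>

lemma run_Tabcol:
  fixes Na Nc :: nat
  assumes b1: "\<And>s'. tab_same dst s s' \<Longrightarrow> ieval s' n1 = Na"
    and b2: "\<And>s'. tab_same dst s s' \<Longrightarrow> ieval s' base = \<rho>"
    and b3: "\<And>s'. tab_same dst s s' \<Longrightarrow> ieval s' n3 = Nc"
    and e: "\<And>s' x z. tab_same dst s s' \<Longrightarrow> x < Na \<Longrightarrow> z < Nc \<Longrightarrow>
      idx s' ''i'' 0 0 = x \<Longrightarrow> idx s' ''l'' 0 0 = z \<Longrightarrow> reval s' e = F x z"
    and dst: "dst \<noteq> ''a''"
  shows "run (Tab dst base n1 (IConst 1) n3 e) s cs (tab_time Na 1 Nc) (\<lambda>s' cs'. cs' = cs \<and>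
    (tab_same dst s s' \<and>
    val s' dst = (\<lambda>x y. if x < Na \<and> y = \<rho> then \<Sum>z<Nc. F x z else val s dst x y)))"
proof -
  have "run (Tab dst base n1 (IConst 1) n3 e) s cs (tab_time Na 1 Nc) (\<lambda>s' cs'. cs' = cs \<and>
    tab_same dst s s' \<and>
    val s' dst = (\<lambda>x y. if x < Na \<and> \<rho> \<le> y \<and> y < \<rho> + 1 then \<Sum>z<Nc. (\<lambda>x y z. F x z) x (y - \<rho>) z else val s dst x y))"
    by (rule run_Tab[where \<rho> = \<rho>]) (simp_all add: b1 b2 b3 e dst)
  moreover have "(\<lambda>x y. if x < Na \<and> \<rho> \<le> y \<and> y < \<rho> + 1 then \<Sum>z<Nc. (\<lambda>x y z. F x z) x (y - \<rho>) z else val s dst x y) =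
     (\<lambda>x y. if x < Na \<and> y = \<rho> then \<Sum>z<Nc. F x z else val s dst x y)"
    by (intro ext) auto
  ultimately show ?thesis by (simp only:)
qed

section \<open>Choosing the longest column and powering the Gram matrix\<close>

primrec amax :: "(nat \<Rightarrow> real) \<Rightarrow> nat \<Rightarrow> nat" where
  "amax m 0 = 0"
| "amax m (Suc k) = (if m (amax m k) < m k then k else amax m k)"

lemma amax_max: "v < b \<Longrightarrow> m v \<le> m (amax m b)"
proof (induction b)
  case (Suc b)
  then show ?case by (cases "v = b") (auto simp: less_Suc_eq)
qed simp

lemma amax_less: "b > 0 \<Longrightarrow> amax m b < b"
proof (induction b)
  case (Suc b)
  then show ?case by (cases "b = 0") auto
qed simp

lemma amax_cong: "(\<And>v. v < b \<Longrightarrow> m v = m' v) \<Longrightarrow> b > 0 \<Longrightarrow> amax m b = amax m' b"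
proof (induction b)
  case (Suc b)
  then show ?case using amax_less[of b m'] by (cases "b = 0") auto
qed simp

abbreviation ArgmaxStep :: com where
  "ArgmaxStep \<equiv> Cond (RLess (RCell ''m'' (scal ''u'') (IConst 0)) (RCell ''m'' (scal ''i'') (IConst 0))) (seti ''u'' (scal ''i'')) Skip"

definition Argmax :: com where
  "Argmax = Seq (seti ''u'' (IConst 0)) (For ''i'' (scal ''b'')
     ArgmaxStep)"

lemma run_Argmax:
  assumes b: "idx s ''b'' 0 0 = b"
  shows "run Argmax s cs (1 + (2 + b * (2 + 2))) (\<lambda>s' cs'. cs' = cs \<and> (same {''i'', ''u''} {} s s' \<and>
     idx s' ''u'' 0 0 = amax (\<lambda>x. val s ''m'' x 0) b))"
proof -
  let ?I = "\<lambda>k s' cs'. cs' = cs \<and> same {''i'', ''u''} {} s s' \<and> idx s' ''u'' 0 0 = amax (\<lambda>x. val s ''m'' x 0) k"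
  show ?thesis
    unfolding Argmax_def
  proof (rule run_Seq[OF run_seti[where Q = "?I 0"]])
  show "?I 0 (s\<lparr>idx := upd (idx s) ''u'' 0 0 (ieval s (IConst 0))\<rparr>) cs"
    by (simp add: same_def upd_apply)
  fix s1 cs1 assume I0: "?I 0 s1 cs1"
  show "run (For ''i'' (scal ''b'')
     ArgmaxStep)
     s1 cs1 (2 + b * (2 + 2)) (\<lambda>s' cs'. cs' = cs \<and> (same {''i'', ''u''} {} s s' \<and>
     idx s' ''u'' 0 0 = amax (\<lambda>x. val s ''m'' x 0) b))"
  proof (rule run_For[where I = ?I])
    show "?I 0 (s1\<lparr>idx := upd (idx s1) ''i'' 0 0 0\<rparr>) cs1" using I0 by (simp add: same_def upd_apply)
  next
    fix k s' cs' assume k: "k < b" "?I k s' cs'" "idx s' ''i'' 0 0 = k"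
    have "run ArgmaxStep
       s' cs' (1 + 1) (\<lambda>s'' cs''. idx s'' ''i'' 0 0 = k \<and> ?I (Suc k) (s''\<lparr>idx := upd (idx s'') ''i'' 0 0 (Suc k)\<rparr>) cs'')"
      by (rule run_Cond; (rule run_seti | rule run_Skip)) (use k in \<open>simp_all add: same_def upd_apply\<close>)
    then show "run ArgmaxStep
       s' cs' 2 (\<lambda>s'' cs''. idx s'' ''i'' 0 0 = k \<and> ?I (Suc k) (s''\<lparr>idx := upd (idx s'') ''i'' 0 0 (Suc k)\<rparr>) cs'')"
      by (simp only: one_add_one)
  next
    fix k s' cs' assume "?I k s' cs'"
    then show "ieval s' (scal ''b'') = b" using b by (simp add: same_def)
  qed simp
qed
qed

text \<open>With truncated subtraction, \<open>1 - ((e - f) + (f - e))\<close> is 1 if \<open>e = f\<close> and 0 otherwise.\<close>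

definition EqExpr :: "iexp \<Rightarrow> iexp \<Rightarrow> rexp" where
  "EqExpr e f = RIndex (ISub (IConst 1) (IAdd (ISub e f) (ISub f e)))"

lemma reval_EqExpr [simp]: "reval s (EqExpr e f) = of_bool (ieval s e = ieval s f)"
  by (auto simp: EqExpr_def)

abbreviation IdentityC :: com where
  "IdentityC \<equiv> Tab ''N'' (IConst 0) (scal ''b'') (scal ''b'') (IConst 1) (EqExpr (scal ''i'') (scal ''j''))"

abbreviation MultiplyC :: com where
  "MultiplyC \<equiv> Tab ''O'' (IConst 0) (scal ''b'') (scal ''b'') (scal ''b'') (RMul (RCell ''G'' (scal ''i'') (scal ''l'')) (RCell ''N'' (scal ''l'') (scal ''j'')))"

abbreviation CopyC :: com where
  "CopyC \<equiv> Tab ''N'' (IConst 0) (scal ''b'') (scal ''b'') (IConst 1) (RCell ''O'' (scal ''i'') (scal ''j''))"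

text \<open>The exponent is \<open>b\<close>, a number at hand as an index and large enough for the
  convergence of power iteration. The product is built in \<open>O\<close>, since the old
  \<open>N\<close> is still being read.\<close>

definition Power :: com where
  "Power = Seq IdentityC
     (For ''q'' (scal ''b'')
       (Seq MultiplyC
            CopyC))"

lemma run_Power:
  assumes b: "idx s ''b'' 0 0 = b" and G: "\<And>u v. u < b \<Longrightarrow> v < b \<Longrightarrow> val s ''G'' u v = \<Gamma> u v"
  shows "run Power s cs (tab_time b b 1 + (2 + b * ((tab_time b b b + tab_time b b 1) + 2))) (\<lambda>s' cs'. cs' = cs \<and>
     (same {''i'', ''j'', ''l'', ''q''} {''a'', ''N'', ''O''} s s' \<and> (\<forall>u<b. \<forall>v<b. val s' ''N'' u v = mpow b \<Gamma> b u v)))"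
  unfolding Power_def
proof (rule run_Seq)
  let ?I = "\<lambda>k s' cs'. cs' = cs \<and> same {''i'', ''j'', ''l'', ''q''} {''a'', ''N'', ''O''} s s' \<and>
     (\<forall>u<b. \<forall>v<b. val s' ''N'' u v = mpow b \<Gamma> k u v)"
  have h1: "run IdentityC s cs (tab_time b b 1) (\<lambda>s' cs'. cs' = cs \<and> (tab_same ''N'' s s' \<and>
     (\<forall>x y. x < b \<longrightarrow> y < b \<longrightarrow> val s' ''N'' x y = (\<Sum>z<(1::nat). of_bool (x = y)))))"
      (is "run _ _ _ _ (\<lambda>s' cs'. ?E cs' \<and> ?P s')")
     by (rule run_Tab0[where F = "\<lambda>x y z. of_bool (x = y)" and Na = b and Nb = b and Nc = 1 and s = s and dst = "''N''" and cs = cs]) (simp_all add: same_def b)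
  obtain t1 s1 where s1': "exec IdentityC s cs t1 s1 cs" "t1 \<le> tab_time b b 1"
     "?P s1"
    by (rule runE[OF h1])
  note s1 = s1'(1,2) s1'(3)[THEN conjunct1] s1'(3)[THEN conjunct2, rule_format]
  have "same {''i'', ''j'', ''l'', ''q''} {''a'', ''N'', ''O''} s s1" by (rule same_trans[OF same_refl s1(3)]) auto
  then show "run IdentityC s cs (tab_time b b 1) (?I 0)"
    by (intro runI[OF s1(1,2)]) (simp add: s1(4))
  fix s2 cs2 assume I0: "?I 0 s2 cs2"
  show "run (For ''q'' (scal ''b'')
       (Seq MultiplyC
            CopyC))
      s2 cs2 (2 + b * ((tab_time b b b + tab_time b b 1) + 2)) (\<lambda>s' cs'. cs' = cs \<and>
     (same {''i'', ''j'', ''l'', ''q''} {''a'', ''N'', ''O''} s s' \<and> (\<forall>u<b. \<forall>v<b. val s' ''N'' u v = mpow b \<Gamma> b u v)))"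
  proof (rule run_For[where I = ?I])
    show "?I 0 (s2\<lparr>idx := upd (idx s2) ''q'' 0 0 0\<rparr>) cs2" using I0 by (simp add: same_def upd_apply)
  next
    fix k s3 cs3 assume k: "k < b" "?I k s3 cs3" "idx s3 ''q'' 0 0 = k"
    have s3: "same {''i'', ''j'', ''l'', ''q''} {''a'', ''N'', ''O''} s s3" and N3: "\<And>u v. u < b \<Longrightarrow> v < b \<Longrightarrow> val s3 ''N'' u v = mpow b \<Gamma> k u v"
      using k(2) by blast+
    have b3: "idx s3 ''b'' 0 0 = b" and G3: "\<And>u v. u < b \<Longrightarrow> v < b \<Longrightarrow> val s3 ''G'' u v = \<Gamma> u v"
      using s3 by (simp_all add: same_def b G)
    have h4: "run MultiplyC s3 cs (tab_time b b b) (\<lambda>s' cs'. cs' = cs \<and> (tab_same ''O'' s3 s' \<and>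
       (\<forall>x y. x < b \<longrightarrow> y < b \<longrightarrow> val s' ''O'' x y = (\<Sum>z<b. \<Gamma> x z * mpow b \<Gamma> k z y))))"
      (is "run _ _ _ _ (\<lambda>s' cs'. ?E cs' \<and> ?P s')")
       by (rule run_Tab0[where F = "\<lambda>x y z. \<Gamma> x z * mpow b \<Gamma> k z y" and Na = b and Nb = b and Nc = b and s = s3 and dst = "''O''" and cs = cs]) (simp_all add: same_def b3 G3 N3)
    obtain t4 s4 where s4': "exec MultiplyC s3 cs t4 s4 cs" "t4 \<le> tab_time b b b"
       "?P s4"
      by (rule runE[OF h4])
    note s4 = s4'(1,2) s4'(3)[THEN conjunct1] s4'(3)[THEN conjunct2, rule_format]
    have b4: "idx s4 ''b'' 0 0 = b" using s4(3) by (simp add: same_def b3)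
    have h5: "run CopyC s4 cs (tab_time b b 1) (\<lambda>s' cs'. cs' = cs \<and> (tab_same ''N'' s4 s' \<and>
       (\<forall>x y. x < b \<longrightarrow> y < b \<longrightarrow> val s' ''N'' x y = (\<Sum>z<(1::nat). mpow b \<Gamma> (Suc k) x y))))"
      (is "run _ _ _ _ (\<lambda>s' cs'. ?E cs' \<and> ?P s')")
       by (rule run_Tab0[where F = "\<lambda>x y z. mpow b \<Gamma> (Suc k) x y" and Na = b and Nb = b and Nc = 1 and s = s4 and dst = "''N''" and cs = cs]) (simp_all add: same_def b4 s4(4))
    obtain t5 s5 where s5': "exec CopyC s4 cs t5 s5 cs" "t5 \<le> tab_time b b 1"
       "?P s5"
      by (rule runE[OF h5])
    note s5 = s5'(1,2) s5'(3)[THEN conjunct1] s5'(3)[THEN conjunct2, rule_format]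
    have q: "same {''i'', ''j'', ''l''} {''a'', ''N'', ''O''} s3 s5" by (rule same_trans[OF s4(3) s5(3)]) auto
    have "same {''i'', ''j'', ''l'', ''q''} {''a'', ''N'', ''O''} s s5" by (rule same_trans[OF s3 q]) auto
    then have "same {''i'', ''j'', ''l'', ''q''} {''a'', ''N'', ''O''} s (s5\<lparr>idx := upd (idx s5) ''q'' 0 0 (Suc k)\<rparr>)"
      by (simp add: same_def upd_apply)
    moreover have "idx s5 ''q'' 0 0 = k" using q k(3) by (simp add: same_def)
    moreover have "cs3 = cs" using k(2) by blast
    ultimately show "run (Seq MultiplyC
            CopyC) s3 cs3
        (tab_time b b b + tab_time b b 1)
        (\<lambda>s'' cs''. idx s'' ''q'' 0 0 = k \<and> ?I (Suc k) (s''\<lparr>idx := upd (idx s'') ''q'' 0 0 (Suc k)\<rparr>) cs'')"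
      using exec.Seq[OF s4(1) s5(1)] s4(2) s5(2) by (intro runI[of _ s3 cs3 "t4 + t5" s5 cs]) (simp_all add: s5(4) del: mpow.simps)
  next
    fix k s' cs' assume "?I k s' cs'"
    then have "same {''i'', ''j'', ''l'', ''q''} {''a'', ''N'', ''O''} s s'" by blast
    then show "ieval s' (scal ''b'') = b" using b by (simp add: same_def)
  qed simp
qed

text \<open>The vector \<open>x\<close> of \<open>power_iteration\<close> for \<open>q = b\<close>,
  with the longest column of the power as starting choice.\<close>

definition direction :: "nat \<Rightarrow> nat \<Rightarrow> (nat \<Rightarrow> nat \<Rightarrow> real) \<Rightarrow> nat \<Rightarrow> real" where
  "direction n b E = mvec b E (\<lambda>u. mpow b (gram n E) b u (amax (\<lambda>v. \<Sum>u<b. (mpow b (gram n E) b u v)\<^sup>2) b))"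

definition deflate :: "nat \<Rightarrow> nat \<Rightarrow> (nat \<Rightarrow> nat \<Rightarrow> real) \<Rightarrow> nat \<Rightarrow> nat \<Rightarrow> real" where
  "deflate n b E i u = E i u - direction n b E i *
     (ip n (direction n b E) (\<lambda>i. E i u) / ip n (direction n b E) (direction n b E))"

text \<open>Cells of a round: \<open>C\<close> deflated sketch, \<open>G\<close> its Gram matrix, \<open>N\<close> the power of \<open>G\<close> (\<open>O\<close> scratch), \<open>m\<close> squared
  column norms of \<open>N\<close>, \<open>u\<close> the index of the largest, \<open>v\<close> squared norm of the new column \<open>x\<close> of \<open>X\<close>, \<open>c\<close> the row vector
  \<open>x\<^sup>T C / v\<close>, \<open>w\<close> the sketch \<open>T x\<close>. The hash values of \<open>S\<close> and \<open>T\<close> are in \<open>g\<close> and \<open>h\<close>.\<close>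

definition GramC :: com where
  "GramC = Tab ''G'' (IConst 0) (scal ''b'') (scal ''b'') (scal ''n'') (RMul (RCell ''C'' (scal ''l'') (scal ''i'')) (RCell ''C'' (scal ''l'') (scal ''j'')))"
definition NormC :: com where
  "NormC = Tab ''m'' (IConst 0) (scal ''b'') (IConst 1) (scal ''b'') (RMul (RCell ''N'' (scal ''l'') (scal ''i'')) (RCell ''N'' (scal ''l'') (scal ''i'')))"
definition XC :: com where
  "XC = Tab ''X'' (scal ''r'') (scal ''n'') (IConst 1) (scal ''b'') (RMul (RCell ''C'' (scal ''i'') (scal ''l'')) (RCell ''N'' (scal ''l'') (scal ''u'')))"
definition VC :: com where
  "VC = Tab ''v'' (IConst 0) (IConst 1) (IConst 1) (scal ''n'') (RMul (RCell ''X'' (scal ''l'') (scal ''r'')) (RCell ''X'' (scal ''l'') (scal ''r'')))"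
definition CoefC :: com where
  "CoefC = Tab ''c'' (IConst 0) (scal ''b'') (IConst 1) (scal ''n'')
     (RDiv (RMul (RCell ''X'' (scal ''l'') (scal ''r'')) (RCell ''C'' (scal ''l'') (scal ''i''))) (RCell ''v'' (IConst 0) (IConst 0)))"
definition DeflateC :: com where
  "DeflateC = Tab ''C'' (IConst 0) (scal ''n'') (scal ''b'') (IConst 1)
     (RSub (RCell ''C'' (scal ''i'') (scal ''j'')) (RMul (RCell ''X'' (scal ''i'') (scal ''r'')) (RCell ''c'' (scal ''j'') (IConst 0))))"
definition SketchC :: com where
  "SketchC = Tab ''w'' (IConst 0) (scal ''b'') (IConst 1) (scal ''n'')
     (RMul (EqExpr (ICell ''h'' (scal ''l'') (IConst 0)) (scal ''i'')) (RMul (RCell ''T'' (scal ''l'') (IConst 0)) (RCell ''X'' (scal ''l'') (scal ''r''))))"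
text \<open>One division by the squared norm \<open>v\<close> replaces normalizing the direction
  both in \<open>X\<close> and in its estimated products with the columns of
  \<open>M\<close>.\<close>

definition YC :: com where
  "YC = Tab ''Y'' (scal ''r'') (scal ''n'') (IConst 1) (scal ''b'')
     (RDiv (RMul (RCell ''w'' (scal ''l'') (IConst 0)) (RCell ''D'' (scal ''l'') (scal ''i''))) (RCell ''v'' (IConst 0) (IConst 0)))"

definition Round :: com where
  "Round = Seq GramC (Seq Power (Seq NormC (Seq Argmax (Seq XC (Seq VC (Seq CoefC (Seq DeflateC (Seq SketchC YC))))))))"

lemma run_Round:
  fixes s :: memory
  assumes n: "idx s ''n'' 0 0 = n" and b: "idx s ''b'' 0 0 = b" and r: "idx s ''r'' 0 0 = \<rho>"
    and n1: "n \<ge> 1" and b1: "b \<ge> 1" and C: "\<And>i u. i < n \<Longrightarrow> u < b \<Longrightarrow> val s ''C'' i u = E i u"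
  defines "x \<equiv> direction n b E"
  shows "run Round s cs (250 * (n * b ^ 4)) (\<lambda>s' cs'. cs' = cs \<and>
    same {''i'', ''j'', ''l'', ''q'', ''u''} {''a'', ''G'', ''N'', ''O'', ''m'', ''X'', ''v'', ''c'', ''C'', ''w'', ''Y''} s s' \<and>
    (\<forall>i<n. \<forall>u<b. val s' ''C'' i u = deflate n b E i u) \<and>
    val s' ''X'' = (\<lambda>i l. if i < n \<and> l = \<rho> then x i else val s ''X'' i l) \<and>
    val s' ''Y'' = (\<lambda>j l. if j < n \<and> l = \<rho> then
      (\<Sum>u<b. (\<Sum>i<n. of_bool (idx s ''h'' i 0 = u) * (val s ''T'' i 0 * x i)) * val s ''D'' u j / ip n x x) else val s ''Y'' j l))"
proof -
  have h1: "run GramC s cs (tab_time b b n) (\<lambda>s' cs'. cs' = cs \<and> (tab_same ''G'' s s' \<and>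
     (\<forall>x y. x < b \<longrightarrow> y < b \<longrightarrow> val s' ''G'' x y = (\<Sum>z<n. E z x * E z y))))"
      (is "run _ _ _ _ (\<lambda>s' cs'. ?E cs' \<and> ?P s')")
    unfolding GramC_def by (rule run_Tab0[where F = "\<lambda>x y z. E z x * E z y" and Na = b and Nb = b and Nc = n and s = s and dst = "''G''" and cs = cs]) (simp_all add: same_def n b C)
  obtain t1 s1 where s1': "exec GramC s cs t1 s1 cs" "t1 \<le> tab_time b b n"
     "?P s1"
    by (rule runE[OF h1])
  note s1 = s1'(1,2) s1'(3)[THEN conjunct1] s1'(3)[THEN conjunct2, rule_format]
  have b_1: "idx s1 ''b'' 0 0 = b" using s1(3) b by (simp add: same_def)
  have G1: "val s1 ''G'' u v = gram n E u v" if "u < b" "v < b" for u v using s1(4)[OF that] by (simp add: gram_def)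
  obtain t2 s2 where s2: "exec Power s1 cs t2 s2 cs" "t2 \<le> tab_time b b 1 + (2 + b * ((tab_time b b b + tab_time b b 1) + 2))"
     "same {''i'', ''j'', ''l'', ''q''} {''a'', ''N'', ''O''} s1 s2 \<and> (\<forall>u<b. \<forall>v<b. val s2 ''N'' u v = mpow b (gram n E) b u v)"
    by (rule runE[OF run_Power[OF b_1 G1, where cs = cs]])
  note N2 = s2(3)[THEN conjunct2, rule_format]
  have b_2: "idx s2 ''b'' 0 0 = b" using s2(3)[THEN conjunct1] b_1 by (simp add: same_def)
  have h3: "run NormC s2 cs (tab_time b 1 b) (\<lambda>s' cs'. cs' = cs \<and> (tab_same ''m'' s2 s' \<and>
     (\<forall>x y. x < b \<longrightarrow> y < (1::nat) \<longrightarrow> val s' ''m'' x y = (\<Sum>z<b. (mpow b (gram n E) b z x)\<^sup>2))))"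
      (is "run _ _ _ _ (\<lambda>s' cs'. ?E cs' \<and> ?P s')")
    unfolding NormC_def by (rule run_Tab0[where F = "\<lambda>x y z. (mpow b (gram n E) b z x)\<^sup>2" and Na = b and Nb = 1 and Nc = b and s = s2 and dst = "''m''" and cs = cs])
      (simp_all add: same_def b_2 N2 power2_eq_square)
  obtain t3 s3 where s3': "exec NormC s2 cs t3 s3 cs" "t3 \<le> tab_time b 1 b"
     "?P s3"
    by (rule runE[OF h3])
  note s3 = s3'(1,2) s3'(3)[THEN conjunct1] s3'(3)[THEN conjunct2, rule_format]
  have b_3: "idx s3 ''b'' 0 0 = b" using s3(3) b_2 by (simp add: same_def)
  obtain t4 s4 where s4: "exec Argmax s3 cs t4 s4 cs" "t4 \<le> 1 + (2 + b * (2 + 2))"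
     "same {''i'', ''u''} {} s3 s4 \<and> idx s4 ''u'' 0 0 = amax (\<lambda>x. val s3 ''m'' x 0) b"
    by (rule runE[OF run_Argmax[OF b_3, where cs = cs]])
  define u where "u = amax (\<lambda>v. \<Sum>u<b. (mpow b (gram n E) b u v)\<^sup>2) b"
  have u4: "idx s4 ''u'' 0 0 = u" unfolding u_def s4(3)[THEN conjunct2]
    by (rule amax_cong) (use s3(4) b1 in auto)
  have ub: "u < b" unfolding u_def by (rule amax_less) (use b1 in simp)
  let ?I = "{''i'', ''j'', ''l'', ''q'', ''u''}" and ?V = "{''a'', ''G'', ''N'', ''O'', ''m'', ''X'', ''v'', ''c'', ''C'', ''w'', ''Y''}"
  have f2: "same ?I {''a'', ''G'', ''N'', ''O'', ''m''} s s2" by (rule same_trans[OF s1(3) s2(3)[THEN conjunct1]]) auto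
  have f3: "same ?I {''a'', ''G'', ''N'', ''O'', ''m''} s s3" by (rule same_trans[OF f2 s3(3)]) auto
  have f4: "same ?I {''a'', ''G'', ''N'', ''O'', ''m''} s s4" by (rule same_trans[OF f3 s4(3)[THEN conjunct1]]) auto
  have e4: "idx s4 ''n'' 0 0 = n" "idx s4 ''b'' 0 0 = b" "idx s4 ''r'' 0 0 = \<rho>" using f4 n b r by (simp_all add: same_def)
  have v4: "val s4 ''X'' = val s ''X''" "val s4 ''Y'' = val s ''Y''" "val s4 ''D'' = val s ''D''" "val s4 ''T'' = val s ''T''"
     "idx s4 ''h'' = idx s ''h''" "val s4 ''C'' = val s ''C''"
    using f4 by (simp_all add: same_def)
  have N4: "val s4 ''N'' z u = mpow b (gram n E) b z u" if "z < b" for z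
    using s3(3) s4(3)[THEN conjunct1] N2[OF that ub] by (simp add: same_def)
  have h5: "run XC s4 cs (tab_time n 1 b) (\<lambda>s' cs'. cs' = cs \<and> (tab_same ''X'' s4 s' \<and>
     val s' ''X'' = (\<lambda>x y. if x < n \<and> y = \<rho> then \<Sum>z<b. E x z * mpow b (gram n E) b z u else val s4 ''X'' x y)))"
      (is "run _ _ _ _ (\<lambda>s' cs'. ?E cs' \<and> ?P s')")
    unfolding XC_def by (rule run_Tabcol[where F = "\<lambda>x z. E x z * mpow b (gram n E) b z u" and Na = n and Nc = b and \<rho> = \<rho> and s = s4 and dst = "''X''" and cs = cs])
      (simp_all add: same_def e4 u4 N4 v4 C)
  obtain t5 s5 where s5': "exec XC s4 cs t5 s5 cs" "t5 \<le> tab_time n 1 b"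
     "?P s5"
    by (rule runE[OF h5])
  note s5 = s5'(1,2) s5'(3)[THEN conjunct1] s5'(3)[THEN conjunct2]
  have xs: "(\<Sum>z<b. E i z * mpow b (gram n E) b z u) = x i" for i
    by (simp add: x_def direction_def mvec_def u_def)
  have X5: "val s5 ''X'' = (\<lambda>i l. if i < n \<and> l = \<rho> then x i else val s ''X'' i l)" unfolding s5(4) xs v4 ..
  have e5: "idx s5 ''n'' 0 0 = n" "idx s5 ''b'' 0 0 = b" "idx s5 ''r'' 0 0 = \<rho>"
     "val s5 ''Y'' = val s ''Y''" "val s5 ''D'' = val s ''D''" "val s5 ''T'' = val s ''T''"
     "idx s5 ''h'' = idx s ''h''" "val s5 ''C'' = val s ''C''"
    using s5(3) by (simp_all add: same_def e4 v4)
  have h6: "run VC s5 cs (tab_time 1 1 n) (\<lambda>s' cs'. cs' = cs \<and> (tab_same ''v'' s5 s' \<and>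
     (\<forall>i j. i < (1::nat) \<longrightarrow> j < (1::nat) \<longrightarrow> val s' ''v'' i j = (\<Sum>z<n. x z * x z))))"
      (is "run _ _ _ _ (\<lambda>s' cs'. ?E cs' \<and> ?P s')")
    unfolding VC_def by (rule run_Tab0[where F = "\<lambda>i j z. x z * x z" and Na = 1 and Nb = 1 and Nc = n and s = s5 and dst = "''v''" and cs = cs]) (simp_all add: same_def e5 X5)
  obtain t6 s6 where s6': "exec VC s5 cs t6 s6 cs" "t6 \<le> tab_time 1 1 n"
     "?P s6"
    by (rule runE[OF h6])
  note s6 = s6'(1,2) s6'(3)[THEN conjunct1] s6'(3)[THEN conjunct2, rule_format]
  have V6: "val s6 ''v'' 0 0 = ip n x x" using s6(4) by (simp add: ip_def)
  have e6: "idx s6 ''n'' 0 0 = n" "idx s6 ''b'' 0 0 = b" "idx s6 ''r'' 0 0 = \<rho>"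
     "val s6 ''Y'' = val s ''Y''" "val s6 ''D'' = val s ''D''" "val s6 ''T'' = val s ''T''"
     "idx s6 ''h'' = idx s ''h''" "val s6 ''C'' = val s ''C''" "val s6 ''X'' = val s5 ''X''"
    using s6(3) by (simp_all add: same_def e5)
  have h7: "run CoefC s6 cs (tab_time b 1 n) (\<lambda>s' cs'. cs' = cs \<and> (tab_same ''c'' s6 s' \<and>
     (\<forall>v j. v < b \<longrightarrow> j < (1::nat) \<longrightarrow> val s' ''c'' v j = (\<Sum>z<n. x z * E z v / ip n x x))))"
      (is "run _ _ _ _ (\<lambda>s' cs'. ?E cs' \<and> ?P s')")
    unfolding CoefC_def by (rule run_Tab0[where F = "\<lambda>v j z. x z * E z v / ip n x x" and Na = b and Nb = 1 and Nc = n and s = s6 and dst = "''c''" and cs = cs]) (simp_all add: same_def e6 X5 V6 C)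
  obtain t7 s7 where s7': "exec CoefC s6 cs t7 s7 cs" "t7 \<le> tab_time b 1 n"
     "?P s7"
    by (rule runE[OF h7])
  note s7 = s7'(1,2) s7'(3)[THEN conjunct1] s7'(3)[THEN conjunct2, rule_format]
  have c7: "val s7 ''c'' v 0 = ip n x (\<lambda>i. E i v) / ip n x x" if "v < b" for v
    using s7(4)[OF that, of 0] by (simp add: ip_def[of n x "\<lambda>i. E i v"] sum_divide_distrib)
  have e7: "idx s7 ''n'' 0 0 = n" "idx s7 ''b'' 0 0 = b" "idx s7 ''r'' 0 0 = \<rho>"
     "val s7 ''Y'' = val s ''Y''" "val s7 ''D'' = val s ''D''" "val s7 ''T'' = val s ''T''"
     "idx s7 ''h'' = idx s ''h''" "val s7 ''C'' = val s ''C''" "val s7 ''X'' = val s5 ''X''" "val s7 ''v'' = val s6 ''v''"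
    using s7(3) by (simp_all add: same_def e6)
  have h8: "run DeflateC s7 cs (tab_time n b 1) (\<lambda>s' cs'. cs' = cs \<and> (tab_same ''C'' s7 s' \<and>
     (\<forall>i v. i < n \<longrightarrow> v < b \<longrightarrow> val s' ''C'' i v = (\<Sum>z<(1::nat). deflate n b E i v))))"
      (is "run _ _ _ _ (\<lambda>s' cs'. ?E cs' \<and> ?P s')")
    unfolding DeflateC_def by (rule run_Tab0[where F = "\<lambda>i v z. deflate n b E i v" and Na = n and Nb = b and Nc = 1 and s = s7 and dst = "''C''" and cs = cs]) (simp_all add: same_def e7 X5 c7 C deflate_def x_def)
  obtain t8 s8 where s8': "exec DeflateC s7 cs t8 s8 cs" "t8 \<le> tab_time n b 1"
     "?P s8"
    by (rule runE[OF h8])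
  note s8 = s8'(1,2) s8'(3)[THEN conjunct1] s8'(3)[THEN conjunct2, rule_format]
  have e8: "idx s8 ''n'' 0 0 = n" "idx s8 ''b'' 0 0 = b" "idx s8 ''r'' 0 0 = \<rho>"
     "val s8 ''Y'' = val s ''Y''" "val s8 ''D'' = val s ''D''" "val s8 ''T'' = val s ''T''"
     "idx s8 ''h'' = idx s ''h''" "val s8 ''X'' = val s5 ''X''" "val s8 ''v'' = val s6 ''v''"
    using s8(3) by (simp_all add: same_def e7)
  have h9: "run SketchC s8 cs (tab_time b 1 n) (\<lambda>s' cs'. cs' = cs \<and> (tab_same ''w'' s8 s' \<and>
     (\<forall>v j. v < b \<longrightarrow> j < (1::nat) \<longrightarrow> val s' ''w'' v j = (\<Sum>z<n. of_bool (idx s ''h'' z 0 = v) * (val s ''T'' z 0 * x z)))))"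
      (is "run _ _ _ _ (\<lambda>s' cs'. ?E cs' \<and> ?P s')")
    unfolding SketchC_def by (rule run_Tab0[where F = "\<lambda>v j z. of_bool (idx s ''h'' z 0 = v) * (val s ''T'' z 0 * x z)" and Na = b and Nb = 1 and Nc = n and s = s8 and dst = "''w''" and cs = cs]) (simp_all add: same_def e8 X5)
  obtain t9 s9 where s9': "exec SketchC s8 cs t9 s9 cs" "t9 \<le> tab_time b 1 n"
     "?P s9"
    by (rule runE[OF h9])
  note s9 = s9'(1,2) s9'(3)[THEN conjunct1] s9'(3)[THEN conjunct2, rule_format]
  have e9: "idx s9 ''n'' 0 0 = n" "idx s9 ''b'' 0 0 = b" "idx s9 ''r'' 0 0 = \<rho>"
     "val s9 ''Y'' = val s ''Y''" "val s9 ''D'' = val s ''D''" "val s9 ''X'' = val s5 ''X''" "val s9 ''v'' = val s6 ''v''"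
     "val s9 ''C'' = val s8 ''C''"
    using s9(3) by (simp_all add: same_def e8)
  have h10: "run YC s9 cs (tab_time n 1 b) (\<lambda>s' cs'. cs' = cs \<and> (tab_same ''Y'' s9 s' \<and>
     (val s' ''Y'' = (\<lambda>j l. if j < n \<and> l = \<rho> then
        \<Sum>u<b. (\<Sum>i<n. of_bool (idx s ''h'' i 0 = u) * (val s ''T'' i 0 * x i)) * val s ''D'' u j / ip n x x else val s9 ''Y'' j l))))"
      (is "run _ _ _ _ (\<lambda>s' cs'. ?E cs' \<and> ?P s')")
    unfolding YC_def by (rule run_Tabcol[where F = "\<lambda>j u. (\<Sum>i<n. of_bool (idx s ''h'' i 0 = u) * (val s ''T'' i 0 * x i)) * val s ''D'' u j / ip n x x"
          and Na = n and Nc = b and \<rho> = \<rho> and s = s9 and dst = "''Y''" and cs = cs]) (simp_all add: same_def e9 V6 s9(4) del: sum_of_bool_mult_eq sum_mult_of_bool_eq)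
  obtain t10 s10 where s10': "exec YC s9 cs t10 s10 cs" "t10 \<le> tab_time n 1 b"
     "?P s10"
    by (rule runE[OF h10])
  note s10 = s10'(1,2) s10'(3)[THEN conjunct1] s10'(3)[THEN conjunct2, rule_format]
  have ex: "exec Round s cs (t1 + (t2 + (t3 + (t4 + (t5 + (t6 + (t7 + (t8 + (t9 + t10))))))))) s10 cs"
    unfolding Round_def by (intro exec.Seq; fact)
  have f5: "same ?I ?V s s5" by (rule same_trans[OF f4 s5(3)]) auto
  have f6: "same ?I ?V s s6" by (rule same_trans[OF f5 s6(3)]) auto
  have f7: "same ?I ?V s s7" by (rule same_trans[OF f6 s7(3)]) auto
  have f8: "same ?I ?V s s8" by (rule same_trans[OF f7 s8(3)]) auto
  have f9: "same ?I ?V s s9" by (rule same_trans[OF f8 s9(3)]) auto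
  have f10: "same ?I ?V s s10" by (rule same_trans[OF f9 s10(3)]) auto
  have e10: "val s10 ''X'' = val s5 ''X''" "val s10 ''C'' = val s8 ''C''" using s10(3) by (simp_all add: same_def e9)
  \<comment> \<open>The \<open>b\<close> products of \<open>b\<close> by \<open>b\<close> matrices
    give the power \<open>b ^ 4\<close>; each table outside the power loop takes at most
    \<open>15 * (n * b ^ 4)\<close> steps.\<close>
  have time: "t1 + (t2 + (t3 + (t4 + (t5 + (t6 + (t7 + (t8 + (t9 + t10)))))))) \<le> 250 * (n * b ^ 4)"
  proof -
    define B where "B = n * b ^ 4"
    have pw: "b \<le> b ^ 4" "b * b \<le> b ^ 4" "b * b * b \<le> b ^ 4" "1 \<le> b ^ 4"
      using power_increasing[of 1 4 b] power_increasing[of 2 4 b] power_increasing[of 3 4 b] b1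
      by (simp_all add: power2_eq_square power3_eq_cube)
    have nB: "c \<le> B" if "c \<le> b ^ 4" for c
      unfolding B_def using mult_le_mono[OF n1 that] by simp
    have nB': "n * c \<le> B" if "c \<le> b ^ 4" for c
      unfolding B_def using that by simp
    have loop: "b * ((tab_time b b b + tab_time b b 1) + 2) \<le> 32 * B"
    proof -
      have "tab_time b b b \<le> 15 * (b * b * b)" "tab_time b b 1 \<le> 15 * (b * b)"
        using tab_time_le[OF b1 b1 b1] tab_time_le[OF b1 b1, of 1] by simp_all
      moreover have "b * b \<le> b * b * b" "1 \<le> b * b * b" using b1 by simp_all
      ultimately have "(tab_time b b b + tab_time b b 1) + 2 \<le> 32 * (b * b * b)" by linarith
      then have "b * ((tab_time b b b + tab_time b b 1) + 2) \<le> b * (32 * (b * b * b))" by (rule mult_le_mono2)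
      also have "\<dots> = 32 * b ^ 4" by (simp add: power4_eq_xxxx)
      also have "\<dots> \<le> 32 * B" using nB[of "b ^ 4"] by simp
      finally show ?thesis .
    qed
    have "tab_time b b n \<le> 15 * B" using tab_time_le[OF b1 b1 n1] nB'[OF pw(2)] by (simp add: mult_ac)
    moreover have "tab_time b b 1 \<le> 15 * B" using tab_time_le[OF b1 b1, of 1] nB[OF pw(2)] by simp
    moreover have "tab_time b 1 b \<le> 15 * B" using tab_time_le[OF b1 _ b1, of 1] nB[OF pw(2)] by simp
    moreover have "tab_time n 1 b \<le> 15 * B" using tab_time_le[OF n1 _ b1, of 1] nB'[OF pw(1)] by simp
    moreover have "tab_time 1 1 n \<le> 15 * B" using tab_time_le[OF _ _ n1, of 1 1] nB'[OF pw(4)] by simp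
    moreover have "tab_time b 1 n \<le> 15 * B" using tab_time_le[OF b1 _ n1, of 1] nB'[OF pw(1)] by (simp add: mult_ac)
    moreover have "tab_time n b 1 \<le> 15 * B" using tab_time_le[OF n1 b1, of 1] nB'[OF pw(1)] by simp
    moreover have "b \<le> B" "1 \<le> B" using nB pw by auto
    moreover have "t2 \<le> tab_time b b 1 + (2 + 32 * B)"
      by (rule order_trans[OF s2(2)]) (intro add_mono order_refl loop)
    moreover have "t4 \<le> 3 + 4 * b" using s4(2) by simp
    ultimately show ?thesis
      using s1(2) s3(2) s5(2) s6(2) s7(2) s8(2) s9(2) s10(2) unfolding B_def[symmetric] by linarith
  qed
  show ?thesis
    by (rule runI[OF ex time]) (intro conjI refl f10, simp add: e10 s8(4), simp only: e10 X5, simp only: s10(4) e9(4))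
qed

section \<open>The whole algorithm\<close>

primrec deflations :: "nat \<Rightarrow> nat \<Rightarrow> (nat \<Rightarrow> nat \<Rightarrow> real) \<Rightarrow> nat \<Rightarrow> nat \<Rightarrow> nat \<Rightarrow> real" where
  "deflations n b C 0 = C"
| "deflations n b C (Suc l) = deflate n b (deflations n b C l)"

abbreviation directions :: "nat \<Rightarrow> nat \<Rightarrow> (nat \<Rightarrow> nat \<Rightarrow> real) \<Rightarrow> nat \<Rightarrow> nat \<Rightarrow> real" where
  "directions n b C l \<equiv> direction n b (deflations n b C l)"

definition Greedy :: com where
  "Greedy = For ''r'' (scal ''rank'') Round"

text \<open>The invariant records the columns of \<open>X\<close> and \<open>Y\<close> found so far
  and the current residual in \<open>C\<close>. A round leaves the hash tables and \<open>D\<close>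
  alone, so all coefficients refer to the same second sketch.\<close>

lemma run_Greedy:
  fixes s :: memory
  assumes n: "idx s ''n'' 0 0 = n" and b: "idx s ''b'' 0 0 = b" and R: "idx s ''rank'' 0 0 = R"
    and n1: "n \<ge> 1" and b1: "b \<ge> 1" and C: "\<And>i u. i < n \<Longrightarrow> u < b \<Longrightarrow> val s ''C'' i u = C i u"
  defines "x \<equiv> \<lambda>l. directions n b C l"
  shows "run Greedy s cs (2 + R * (250 * (n * b ^ 4) + 2)) (\<lambda>s' cs'. cs' = cs \<and> idx s' ''r'' 0 0 = R \<and>
    (\<forall>i<n. \<forall>l<R. val s' ''X'' i l = x l i) \<and>
    (\<forall>j<n. \<forall>l<R. val s' ''Y'' j l =
      (\<Sum>u<b. (\<Sum>i<n. of_bool (idx s ''h'' i 0 = u) * (val s ''T'' i 0 * x l i)) * val s ''D'' u j / ip n (x l) (x l))))"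
proof -
  let ?I = "{''i'', ''j'', ''l'', ''q'', ''u'', ''r''}" and ?V = "{''a'', ''G'', ''N'', ''O'', ''m'', ''X'', ''v'', ''c'', ''C'', ''w'', ''Y''}"
  define Yv where "Yv = (\<lambda>l j. \<Sum>u<b. (\<Sum>i<n. of_bool (idx s ''h'' i 0 = u) * (val s ''T'' i 0 * x l i)) * val s ''D'' u j / ip n (x l) (x l))"
  define J where "J = (\<lambda>k s' cs'. cs' = cs \<and> same ?I ?V s s' \<and>
     (\<forall>i<n. \<forall>u<b. val s' ''C'' i u = deflations n b C k i u) \<and>
     (\<forall>i<n. \<forall>l<k. val s' ''X'' i l = x l i) \<and> (\<forall>j<n. \<forall>l<k. val s' ''Y'' j l = Yv l j))"
  have "run Greedy s cs (2 + R * (250 * (n * b ^ 4) + 2)) (\<lambda>s' cs'. cs' = cs \<and> idx s' ''r'' 0 0 = R \<and>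
    (\<forall>i<n. \<forall>l<R. val s' ''X'' i l = x l i) \<and> (\<forall>j<n. \<forall>l<R. val s' ''Y'' j l = Yv l j))"
    unfolding Greedy_def
  proof (rule run_For[where I = J])
    show "J 0 (s\<lparr>idx := upd (idx s) ''r'' 0 0 0\<rparr>) cs" by (simp add: J_def same_def upd_apply C)
  next
    fix k s1 cs1 assume k: "k < R" "J k s1 cs1" "idx s1 ''r'' 0 0 = k"
    have cs1: "cs1 = cs" and f1: "same ?I ?V s s1" and C1: "\<And>i u. i < n \<Longrightarrow> u < b \<Longrightarrow> val s1 ''C'' i u = deflations n b C k i u"
      and X1: "\<And>i l. i < n \<Longrightarrow> l < k \<Longrightarrow> val s1 ''X'' i l = x l i" and Y1: "\<And>j l. j < n \<Longrightarrow> l < k \<Longrightarrow> val s1 ''Y'' j l = Yv l j"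
      using k(2) unfolding J_def by simp_all
    have e1: "idx s1 ''n'' 0 0 = n" "idx s1 ''b'' 0 0 = b" "idx s1 ''h'' = idx s ''h''" "val s1 ''T'' = val s ''T''" "val s1 ''D'' = val s ''D''"
      using f1 by (simp_all add: same_def n b)
    note R = run_Round[OF e1(1,2) k(3) n1 b1 C1, where cs = cs1]
    show "run Round s1 cs1 (250 * (n * b ^ 4)) (\<lambda>s'' cs''. idx s'' ''r'' 0 0 = k \<and> J (Suc k) (s''\<lparr>idx := upd (idx s'') ''r'' 0 0 (Suc k)\<rparr>) cs'')"
    proof (rule run_mono[OF R order_refl])
      fix s2 cs2
      assume a: "cs2 = cs1 \<and>
        same {''i'', ''j'', ''l'', ''q'', ''u''} {''a'', ''G'', ''N'', ''O'', ''m'', ''X'', ''v'', ''c'', ''C'', ''w'', ''Y''} s1 s2 \<and>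
        (\<forall>i<n. \<forall>u<b. val s2 ''C'' i u = deflate n b (deflations n b C k) i u) \<and>
        val s2 ''X'' = (\<lambda>i l. if i < n \<and> l = k then directions n b C k i else val s1 ''X'' i l) \<and>
        val s2 ''Y'' = (\<lambda>j l. if j < n \<and> l = k then
          (\<Sum>u<b. (\<Sum>i<n. of_bool (idx s1 ''h'' i 0 = u) * (val s1 ''T'' i 0 * directions n b C k i)) * val s1 ''D'' u j /
             ip n (directions n b C k) (directions n b C k)) else val s1 ''Y'' j l)"
      note a1 = a[THEN conjunct1] and a2 = a[THEN conjunct2, THEN conjunct1] and a3 = a[THEN conjunct2, THEN conjunct2, THEN conjunct1]
        and a4 = a[THEN conjunct2, THEN conjunct2, THEN conjunct2, THEN conjunct1]
        and a5 = a[THEN conjunct2, THEN conjunct2, THEN conjunct2, THEN conjunct2, folded x_def, unfolded e1, folded Yv_def]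
      have "same ?I ?V s s2" by (rule same_trans[OF f1 a2]) auto
      then have g: "same ?I ?V s (s2\<lparr>idx := upd (idx s2) ''r'' 0 0 (Suc k)\<rparr>)" by (simp add: same_def upd_apply)
      have r: "idx s2 ''r'' 0 0 = k" using a2 k(3) by (simp add: same_def)
      have X2: "val s2 ''X'' i l = x l i" if "i < n" "l < Suc k" for i l
        using X1[of i l] that by (cases "l = k") (simp_all add: a4 x_def)
      have Y2: "val s2 ''Y'' j l = Yv l j" if "j < n" "l < Suc k" for j l
        using Y1[of j l] that by (cases "l = k") (simp_all add: a5 Yv_def x_def)
      show "idx s2 ''r'' 0 0 = k \<and> J (Suc k) (s2\<lparr>idx := upd (idx s2) ''r'' 0 0 (Suc k)\<rparr>) cs2"
        unfolding J_def using g r X2 Y2 a3 a1 cs1 by simp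
    qed
  next
    fix k s' cs' assume "J k s' cs'"
    then have "same ?I ?V s s'" unfolding J_def by blast
    then show "ieval s' (scal ''rank'') = R" by (simp add: same_def R)
  next
    fix s' cs' assume "J R s' cs'" "idx s' ''r'' 0 0 = R"
    then show "cs' = cs \<and> idx s' ''r'' 0 0 = R \<and> (\<forall>i<n. \<forall>l<R. val s' ''X'' i l = x l i) \<and> (\<forall>j<n. \<forall>l<R. val s' ''Y'' j l = Yv l j)"
      unfolding J_def by (intro conjI) simp_all
  qed
  then show ?thesis unfolding Yv_def .
qed

text \<open>The interface between program and analysis: the output described as a function of the
  two coin strings alone.\<close>

definition sketched_output ::
  "nat \<Rightarrow> nat \<Rightarrow> nat \<Rightarrow> (nat \<Rightarrow> nat \<Rightarrow> real) \<Rightarrow> bool list \<Rightarrow> bool list \<Rightarrow> memory \<Rightarrow> bool" where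
  "sketched_output n k' lb M w1 w2 s \<longleftrightarrow> idx s ''r'' 0 0 = k' \<and>
     (\<forall>i<n. \<forall>l<k'. val s ''X'' i l = directions n (2 ^ lb) (\<lambda>i. sketch lb n w1 (M i)) l i) \<and>
     (\<forall>j<n. \<forall>l<k'. val s ''Y'' j l =
       ip (2 ^ lb) (sketch lb n w2 (directions n (2 ^ lb) (\<lambda>i. sketch lb n w1 (M i)) l)) (sketch lb n w2 (\<lambda>i. M i j)) /
       ip n (directions n (2 ^ lb) (\<lambda>i. sketch lb n w1 (M i)) l) (directions n (2 ^ lb) (\<lambda>i. sketch lb n w1 (M i)) l))"

text \<open>The summands are, in order, the test on \<epsilon>, the choice of \<open>b\<close>, two
  hash tables, the pass over the entries, and \<open>k'\<close> rounds.\<close>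

definition lowrank_steps :: "nat \<Rightarrow> nat \<Rightarrow> nat \<Rightarrow> nat \<Rightarrow> nat" where
  "lowrank_steps n lb N k' = 1 + ((2 + 2 * lb) + ((2 + n * (7 + 4 * lb)) + ((2 + n * (7 + 4 * lb)) +
     ((2 + N * 4) + (2 + k' * (250 * (n * (2 ^ lb) ^ 4) + 2))))))"

text \<open>Skipping leaves \<open>r\<close> at its initial value 0, which encodes the zero matrix;
  this is the answer for \<epsilon> \<ge> 1/2.\<close>

definition LowRank :: "nat \<Rightarrow> com" where
  "LowRank K = Cond (RLess (RCell ''eps'' (IConst 0) (IConst 0)) (RDiv (RIndex (IConst 1)) (RIndex (IConst 2))))
     (Seq (Buckets K) (Seq (HashGen ''g'' ''S'') (Seq (HashGen ''h'' ''T'') (Seq Entries Greedy)))) Skip"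

text \<open>The list enumerates the support in arbitrary order, and positions outside the support
  contribute 0, so a pass over the input computes a sum over all positions.\<close>

lemma sum_entries:
  fixes f :: "nat \<Rightarrow> nat \<Rightarrow> real"
  assumes A: "A \<in> carrier_mat n n" and es: "distinct es" "set es = support A"
    and f: "\<And>i j. A $$ (i,j) = 0 \<Longrightarrow> f i j = 0"
  shows "(\<Sum>x<length es. f (fst (es ! x)) (snd (es ! x))) = (\<Sum>i<n. \<Sum>j<n. f i j)"
proof -
  have "(\<Sum>x<length es. f (fst (es ! x)) (snd (es ! x))) = (\<Sum>p\<in>set es. f (fst p) (snd p))"
    by (rule sum.reindex_bij_betw[OF bij_betw_nth]) (use es in auto)
  also have "\<dots> = (\<Sum>p\<in>{..<n} \<times> {..<n}. f (fst p) (snd p))"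
    unfolding es(2) by (rule sum.mono_neutral_left) (use A f in \<open>auto simp: support_def\<close>)
  finally show ?thesis by (simp add: sum.cartesian_product split_def)
qed

lemma sketch_entries:
  fixes A W :: "real mat"
  assumes A: "A \<in> carrier_mat n n" and es: "distinct es" "set es = support A" and i: "i < n"
  shows "(\<Sum>x<length es. of_bool (i = fst (es ! x) \<and> u = hash lb w (snd (es ! x))) *
      (sign lb w (snd (es ! x)) * (A $$ (es ! x) * W $$ (es ! x)))) = sketch lb n w (\<lambda>j. A $$ (i,j) * W $$ (i,j)) u" (is "?L1 = _")
    and "(\<Sum>x<length es. of_bool (u = hash lb w (fst (es ! x)) \<and> i = snd (es ! x)) *
      (sign lb w (fst (es ! x)) * (A $$ (es ! x) * W $$ (es ! x)))) = sketch lb n w (\<lambda>j. A $$ (j,i) * W $$ (j,i)) u" (is "?L2 = _")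
proof -
  have "?L1 = (\<Sum>i'<n. \<Sum>j<n. of_bool (i = i' \<and> u = hash lb w j) * (sign lb w j * (A $$ (i',j) * W $$ (i',j))))"
    using sum_entries[OF A es, of "\<lambda>i' j. of_bool (i = i' \<and> u = hash lb w j) * (sign lb w j * (A $$ (i',j) * W $$ (i',j)))"]
    by (simp del: sum_of_bool_mult_eq sum_mult_of_bool_eq)
  also have "\<dots> = (\<Sum>i'<n. if i' = i then (\<Sum>j<n. of_bool (u = hash lb w j) * (sign lb w j * (A $$ (i',j) * W $$ (i',j)))) else 0)"
    by (intro sum.cong refl) (auto simp del: sum_of_bool_mult_eq sum_mult_of_bool_eq)
  also have "\<dots> = sketch lb n w (\<lambda>j. A $$ (i,j) * W $$ (i,j)) u"
    unfolding sketch_def using i by (simp add: mult.assoc eq_commute[of u] del: sum_of_bool_mult_eq sum_mult_of_bool_eq)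
  finally show "?L1 = sketch lb n w (\<lambda>j. A $$ (i,j) * W $$ (i,j)) u" .
  have "?L2 = (\<Sum>i'<n. \<Sum>j<n. of_bool (u = hash lb w i' \<and> i = j) * (sign lb w i' * (A $$ (i',j) * W $$ (i',j))))"
    using sum_entries[OF A es, of "\<lambda>i' j. of_bool (u = hash lb w i' \<and> i = j) * (sign lb w i' * (A $$ (i',j) * W $$ (i',j)))"]
    by (simp del: sum_of_bool_mult_eq sum_mult_of_bool_eq)
  also have "\<dots> = (\<Sum>i'<n. \<Sum>j<n. if j = i then of_bool (u = hash lb w i') * (sign lb w i' * (A $$ (i',j) * W $$ (i',j))) else 0)"
    by (intro sum.cong refl) auto
  also have "\<dots> = sketch lb n w (\<lambda>j. A $$ (j,i) * W $$ (j,i)) u"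
    unfolding sketch_def using i by (simp add: mult.assoc eq_commute[of u] del: sum_of_bool_mult_eq sum_mult_of_bool_eq)
  finally show "?L2 = sketch lb n w (\<lambda>j. A $$ (j,i) * W $$ (j,i)) u" .
qed

text \<open>After the pass over the entries, \<open>C\<close> holds the sketches of the rows of
  \<open>M\<close> and \<open>D\<close> those of the columns, each made with its own half of the
  coins. Both arrays start at 0 because all cells outside the input do.\<close>

lemma run_LowRank:
  fixes A W :: "real mat" and k' n :: nat
  assumes n1: "n \<ge> 1" and A: "A \<in> carrier_mat n n" and es: "distinct es" "set es = support A" and \<epsilon>: "\<epsilon> < 1 / 2"
  defines "M \<equiv> \<lambda>i j. A $$ (i,j) * W $$ (i,j)"
  shows "\<exists>lb. real K * (real k' / \<epsilon>)\<^sup>2 \<le> 2 ^ lb \<and> 2 ^ lb \<le> 1 + 2 * (real K * (real k' / \<epsilon>)\<^sup>2) \<and>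
    (\<forall>w1 w2. length w1 = n * Suc lb \<longrightarrow> length w2 = n * Suc lb \<longrightarrow>
      run (LowRank K) (input_memory n k' \<epsilon> A es W) (w1 @ w2)
        (lowrank_steps n lb (length es) k')
        (\<lambda>s' cs'. sketched_output n k' lb M w1 w2 s'))"
proof -
  define Q where "Q = (\<lambda>lb w1 w2 s' (cs'::bool list). sketched_output n k' lb M w1 w2 s')"
  define x where "x = (\<lambda>b C l. directions n b C l)"
  define s where "s = input_memory n k' \<epsilon> A es W"
  have s: "idx s ''rank'' 0 0 = k'" "val s ''eps'' 0 0 = \<epsilon>" "idx s ''n'' 0 0 = n" "idx s ''nnz'' 0 0 = length es"
    by (simp_all add: s_def input_memory_def)
  have sC: "val s ''C'' = (\<lambda>_ _. 0)" "val s ''D'' = (\<lambda>_ _. 0)" by (simp_all add: s_def input_memory_def fun_eq_iff)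
  have se: "idx s ''row'' z 0 = fst (es ! z)" "idx s ''col'' z 0 = snd (es ! z)" "val s ''entry'' z 0 = A $$ (es ! z)"
    if "z < length es" for z using that by (simp_all add: s_def input_memory_def)
  have esn: "fst (es ! z) < n" "snd (es ! z) < n" if "z < length es" for z
    using nth_mem[OF that] A unfolding es(2) by (auto simp: support_def)
  have sW: "val s ''W'' i j = W $$ (i,j)" if "i < n" "j < n" for i j using that by (simp add: s_def input_memory_def)
  obtain lb where lb: "real K * (real k' / \<epsilon>)\<^sup>2 \<le> 2 ^ lb" "2 ^ lb \<le> 1 + 2 * (real K * (real k' / \<epsilon>)\<^sup>2)"
     and runB: "\<And>cs. run (Buckets K) s cs (2 + 2 * lb) (\<lambda>s' cs'. cs' = cs \<and> same {''b''} {} s s' \<and> idx s' ''b'' 0 0 = 2 ^ lb)"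
  proof -
    show thesis using run_Buckets[of "real K * (real k' / \<epsilon>)\<^sup>2" K s] that by (auto simp: s)
  qed
  have main: "run (Seq (Buckets K) (Seq (HashGen ''g'' ''S'') (Seq (HashGen ''h'' ''T'') (Seq Entries Greedy)))) s (w1 @ w2)
        ((2 + 2 * lb) + ((2 + n * (7 + 4 * lb)) + ((2 + n * (7 + 4 * lb)) + ((2 + length es * 4) + (2 + k' * (250 * (n * (2 ^ lb) ^ 4) + 2))))))
        (Q lb w1 w2)"
    if w: "length w1 = n * Suc lb" "length w2 = n * Suc lb" for w1 w2
  proof (rule run_Seq[OF runB])
    fix s1 cs1 assume 1: "cs1 = w1 @ w2 \<and> same {''b''} {} s s1 \<and> idx s1 ''b'' 0 0 = 2 ^ lb"
    have f1: "same {''b''} {} s s1" and b1: "idx s1 ''b'' 0 0 = 2 ^ lb" using 1 by blast+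
    have n_1: "idx s1 ''n'' 0 0 = n" using f1 s by (simp add: same_def)
    show "run (Seq (HashGen ''g'' ''S'') (Seq (HashGen ''h'' ''T'') (Seq Entries Greedy))) s1 cs1
      ((2 + n * (7 + 4 * lb)) + ((2 + n * (7 + 4 * lb)) + ((2 + length es * 4) + (2 + k' * (250 * (n * (2 ^ lb) ^ 4) + 2)))))
      (Q lb w1 w2)"
      unfolding 1[THEN conjunct1]
    proof (rule run_Seq[OF run_HashGen[OF _ b1 n_1 w(1)]])
      show "''g'' \<notin> {''f'', ''w'', ''b'', ''i'', ''n''}" by simp
    next
      fix s2 cs2 assume 2: "cs2 = w2 \<and> same {''f'', ''w'', ''i'', ''g''} {''S''} s1 s2 \<and> (\<forall>j<n. idx s2 ''g'' j 0 = hash lb w1 j \<and> val s2 ''S'' j 0 = sign lb w1 j)"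
      have f2: "same {''b'', ''f'', ''w'', ''i'', ''g''} {''S''} s s2" by (rule same_trans[OF f1 2[THEN conjunct2, THEN conjunct1]]) auto
      have b2: "idx s2 ''b'' 0 0 = 2 ^ lb" using 2[THEN conjunct2, THEN conjunct1] b1 by (simp add: same_def)
      have n2: "idx s2 ''n'' 0 0 = n" using f2 s by (simp add: same_def)
      show "run (Seq (HashGen ''h'' ''T'') (Seq Entries Greedy)) s2 cs2
        ((2 + n * (7 + 4 * lb)) + ((2 + length es * 4) + (2 + k' * (250 * (n * (2 ^ lb) ^ 4) + 2))))
      (Q lb w1 w2)"
      proof (rule run_Seq)
        have "cs2 = w2 @ []" using 2 by simp
        then show "run (HashGen ''h'' ''T'') s2 cs2 (2 + n * (7 + 4 * lb)) (\<lambda>s' cs'. cs' = [] \<and>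
           same {''f'', ''w'', ''i'', ''h''} {''T''} s2 s' \<and> (\<forall>j<n. idx s' ''h'' j 0 = hash lb w2 j \<and> val s' ''T'' j 0 = sign lb w2 j))"
          by (simp only:) (rule run_HashGen[OF _ b2 n2 w(2)], simp)
      next
        fix s3 and cs3 :: "bool list" assume 3: "cs3 = [] \<and> same {''f'', ''w'', ''i'', ''h''} {''T''} s2 s3 \<and>
           (\<forall>j<n. idx s3 ''h'' j 0 = hash lb w2 j \<and> val s3 ''T'' j 0 = sign lb w2 j)"
        note 3 = 3[THEN conjunct2, THEN conjunct1] 3[THEN conjunct2, THEN conjunct2, rule_format]
        have f3: "same {''b'', ''f'', ''w'', ''i'', ''g'', ''h''} {''S'', ''T''} s s3" by (rule same_trans[OF f2 3(1)]) auto
        have b3: "idx s3 ''b'' 0 0 = 2 ^ lb" using 3(1) b2 by (simp add: same_def)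
        have g3: "idx s3 ''g'' j 0 = hash lb w1 j" "val s3 ''S'' j 0 = sign lb w1 j" if "j < n" for j
          using 3(1) 2[THEN conjunct2, THEN conjunct2] that by (simp_all add: same_def)
        have s3: "idx s3 ''n'' 0 0 = n" "idx s3 ''rank'' 0 0 = k'" "idx s3 ''nnz'' 0 0 = length es" "idx s3 ''row'' = idx s ''row''" "idx s3 ''col'' = idx s ''col''"
          "val s3 ''entry'' = val s ''entry''" "val s3 ''W'' = val s ''W''" "val s3 ''C'' = (\<lambda>_ _. 0)" "val s3 ''D'' = (\<lambda>_ _. 0)"
          using f3 by (simp_all add: same_def s sC)
        show "run (Seq Entries Greedy) s3 cs3 ((2 + length es * 4) + (2 + k' * (250 * (n * (2 ^ lb) ^ 4) + 2)))
          (Q lb w1 w2)"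
        proof (rule run_Seq[OF run_Entries[OF s3(3)]], elim conjE)
          fix s4 cs4
          assume f4: "same {''e''} {''C'', ''D''} s3 s4"
            and C4: "val s4 ''C'' = (\<lambda>i u. val s3 ''C'' i u + (\<Sum>x<length es. of_bool (i = idx s3 ''row'' x 0 \<and> u = idx s3 ''g'' (idx s3 ''col'' x 0) 0) *
               (val s3 ''S'' (idx s3 ''col'' x 0) 0 * (val s3 ''entry'' x 0 * val s3 ''W'' (idx s3 ''row'' x 0) (idx s3 ''col'' x 0)))))"
            and D4: "val s4 ''D'' = (\<lambda>u j. val s3 ''D'' u j + (\<Sum>x<length es. of_bool (u = idx s3 ''h'' (idx s3 ''row'' x 0) 0 \<and> j = idx s3 ''col'' x 0) *
               (val s3 ''T'' (idx s3 ''row'' x 0) 0 * (val s3 ''entry'' x 0 * val s3 ''W'' (idx s3 ''row'' x 0) (idx s3 ''col'' x 0)))))"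
          have C: "val s4 ''C'' i u = sketch lb n w1 (M i) u" if "i < n" for i u
          proof -
            have "val s4 ''C'' i u = (\<Sum>x<length es. of_bool (i = fst (es ! x) \<and> u = hash lb w1 (snd (es ! x))) *
              (sign lb w1 (snd (es ! x)) * (A $$ (es ! x) * W $$ (es ! x))))"
              unfolding C4 s3 add_0 by (rule sum.cong[OF refl]) (simp add: se esn g3 sW)
            then show ?thesis unfolding M_def sketch_entries(1)[OF A es that] .
          qed
          have D: "val s4 ''D'' u j = sketch lb n w2 (\<lambda>i. M i j) u" if "j < n" for j u
          proof -
            have "val s4 ''D'' u j = (\<Sum>x<length es. of_bool (u = hash lb w2 (fst (es ! x)) \<and> j = snd (es ! x)) *
              (sign lb w2 (fst (es ! x)) * (A $$ (es ! x) * W $$ (es ! x))))"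
              unfolding D4 s3 add_0 by (rule sum.cong[OF refl]) (simp add: se esn 3(2) sW)
            then show ?thesis unfolding M_def sketch_entries(2)[OF A es that] .
          qed
          have e4: "idx s4 ''n'' 0 0 = n" "idx s4 ''b'' 0 0 = 2 ^ lb" "idx s4 ''rank'' 0 0 = k'" "idx s4 ''h'' = idx s3 ''h''" "val s4 ''T'' = val s3 ''T''"
            using f4 by (simp_all add: same_def s3 b3)
          have sk: "(\<Sum>i<n. of_bool (idx s4 ''h'' i 0 = u) * (val s4 ''T'' i 0 * y i)) = sketch lb n w2 y u" for u y
            unfolding sketch_def by (rule sum.cong[OF refl]) (simp add: e4 3(2))
          have "run Greedy s4 cs4 (2 + k' * (250 * (n * (2 ^ lb) ^ 4) + 2)) (\<lambda>s' cs'. cs' = cs4 \<and> idx s' ''r'' 0 0 = k' \<and>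
            (\<forall>i<n. \<forall>l<k'. val s' ''X'' i l = x (2 ^ lb) (\<lambda>i. sketch lb n w1 (M i)) l i) \<and>
            (\<forall>j<n. \<forall>l<k'. val s' ''Y'' j l =
              (\<Sum>u<2 ^ lb. sketch lb n w2 (x (2 ^ lb) (\<lambda>i. sketch lb n w1 (M i)) l) u * val s4 ''D'' u j /
                ip n (x (2 ^ lb) (\<lambda>i. sketch lb n w1 (M i)) l) (x (2 ^ lb) (\<lambda>i. sketch lb n w1 (M i)) l))))"
            using run_Greedy[OF e4(1-3) n1 _ C, where cs = cs4] unfolding sk x_def by simp
          then show "run Greedy s4 cs4 (2 + k' * (250 * (n * (2 ^ lb) ^ 4) + 2))
            (Q lb w1 w2)"
            unfolding Q_def sketched_output_def x_def
              by (rule run_mono) (simp_all add: D ip_def[of "2 ^ lb"] sum_divide_distrib)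
        qed
      qed
    qed
  qed
  have "run (LowRank K) s (w1 @ w2)
        (lowrank_steps n lb (length es) k')
        (Q lb w1 w2)"
    if w: "length w1 = n * Suc lb" "length w2 = n * Suc lb" for w1 w2
    unfolding LowRank_def lowrank_steps_def by (rule run_Cond[OF main[OF w]]) (use \<epsilon> s in simp)
  then show ?thesis using lb unfolding s_def Q_def by blast
qed

section \<open>Accuracy and running time\<close>

text \<open>With \<open>\<eta> = \<epsilon> / 4\<close>, the product of \<open>1 - \<eta>\<close>
  and \<open>1 + \<eta>\<close> is at most 1, so Bernoulli bounds \<open>(1 - \<eta>) ^ b\<close> by
  the inverse of \<open>1 + b * \<eta>\<close>. The square of the latter exceeds \<open>b\<close>,
  because \<open>b * \<eta>^2\<close> is at least 256 / 16 = 16.\<close>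

lemma power_iteration_count:
  fixes \<epsilon> :: real
  assumes \<epsilon>: "0 < \<epsilon>" "\<epsilon> \<le> 1" and b: "real b * \<epsilon>\<^sup>2 \<ge> 256"
  shows "(1 - \<epsilon> / 4) ^ (2 * b) * real b < 1"
proof -
  define \<eta> where "\<eta> = \<epsilon> / 4"
  have \<eta>: "0 < \<eta>" "\<eta> \<le> 1" using \<epsilon> by (auto simp: \<eta>_def)
  have b\<eta>: "real b * \<eta>\<^sup>2 \<ge> 16" using b by (simp add: \<eta>_def power_divide)
  then have bpos: "real b > 0" by (cases "b = 0") auto
  have "(1 - \<eta>) ^ b * (1 + \<eta>) ^ b \<le> 1"
    unfolding power_mult_distrib[symmetric] using \<eta> by (intro power_le_one) (auto simp: algebra_simps intro: mult_le_one)
  moreover have "1 + real b * \<eta> \<le> (1 + \<eta>) ^ b" using Bernoulli_inequality[of \<eta> b] \<eta> by simp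
  ultimately have "(1 - \<eta>) ^ b * (1 + real b * \<eta>) \<le> 1"
    using mult_left_mono[of "1 + real b * \<eta>" "(1 + \<eta>) ^ b" "(1 - \<eta>) ^ b"] \<eta> by simp
  then have "((1 - \<eta>) ^ b * (1 + real b * \<eta>))\<^sup>2 \<le> 1"
    using \<eta> bpos by (intro power_le_one) auto
  then have sq: "(1 - \<eta>) ^ (2 * b) * (1 + real b * \<eta>)\<^sup>2 \<le> 1"
    by (simp add: power_mult_distrib power_mult[symmetric] mult.commute)
  have "real b * 1 < real b * (real b * \<eta>\<^sup>2)" using bpos b\<eta> by (intro mult_strict_left_mono) auto
  also have "\<dots> \<le> (1 + real b * \<eta>)\<^sup>2" using \<eta> bpos by (simp add: power2_eq_square algebra_simps)
  finally have lt: "real b < (1 + real b * \<eta>)\<^sup>2" by simp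
  show ?thesis
  proof (cases "1 - \<eta> = 0")
    case True
    then show ?thesis using bpos by (simp add: \<eta>_def[symmetric] power_0_left)
  next
    case False
    then have "(1 - \<eta>) ^ (2 * b) > 0" using \<eta> by simp
    then have "(1 - \<eta>) ^ (2 * b) * real b < (1 - \<eta>) ^ (2 * b) * (1 + real b * \<eta>)\<^sup>2"
      using lt by (rule mult_strict_left_mono[rotated])
    then show ?thesis using sq by (simp add: \<eta>_def[symmetric])
  qed
qed

lemma sketch_normalized: "sketch lb n w (normalized n x) u = sketch lb n w x u / sqrt (ip n x x)"
  by (simp add: sketch_def normalized_def sum_divide_distrib)

text \<open>\<open>good1\<close> and \<open>good2\<close> exclude the two bad events. The residuals
  and directions of the run form a \<open>deflation\<close>, power iteration supplies its greedy
  inequality, and \<zeta> is the sketched product of a normalized direction with a column of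
  \<open>M\<close>.\<close>

lemma LowRank_output:
  fixes A W :: "real mat" and s :: memory and n m k k' lb :: nat and \<epsilon> :: real
  defines "M \<equiv> \<lambda>i j. A $$ (i,j) * W $$ (i,j)"
  defines "F \<equiv> \<Sum>i<n. \<Sum>j<n. (M i j)\<^sup>2"
  assumes n: "n = 2 ^ m" and A: "A \<in> carrier_mat n n" and Wc: "W \<in> carrier_mat n n"
    and W: "\<forall>i<n. \<forall>j<n. W $$ (i,j) \<in> {0, 1}" and \<epsilon>: "0 < \<epsilon>" "\<epsilon> \<le> 1"
    and k': "k' = k * 2 ^ one_sided_cc m \<epsilon> (\<lambda>x y. \<not> computed_by W x y)"
    and b: "2 ^ lb * \<epsilon>\<^sup>2 \<ge> 256"
  defines "x \<equiv> \<lambda>w. \<lambda>l. directions n (2 ^ lb) (\<lambda>i. sketch lb n w (M i)) l"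
  assumes good1: "real k' * (\<Sum>i<n. \<Sum>j<n. (ip (2 ^ lb) (sketch lb n w1 (M i)) (sketch lb n w1 (M j)) - ip n (M i) (M j))\<^sup>2) \<le> (\<epsilon> / 8 * F)\<^sup>2"
    and good2: "(\<Sum>l<k'. \<Sum>j<n. (ip (2 ^ lb) (sketch lb n w2 (normalized n (x w1 l))) (sketch lb n w2 (\<lambda>i. M i j)) -
       ip n (normalized n (x w1 l)) (\<lambda>i. M i j))\<^sup>2) \<le> \<epsilon> / 2 * F"
    and out: "sketched_output n k' lb M w1 w2 s"
  shows "bicriteria_solution n A W k k' \<epsilon> (output_matrix n s)"
proof -
  have r: "idx s ''r'' 0 0 = k'" and X: "\<forall>i<n. \<forall>l<k'. val s ''X'' i l = x w1 l i"
    and Y: "\<forall>j<n. \<forall>l<k'. val s ''Y'' j l = ip (2 ^ lb) (sketch lb n w2 (x w1 l)) (sketch lb n w2 (\<lambda>i. M i j)) / ip n (x w1 l) (x w1 l)"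
    using out by (simp_all add: sketched_output_def x_def)
  define B where "B = (2::nat) ^ lb"
  define E where "E = deflations n B (\<lambda>i. sketch lb n w1 (M i))"
  define y where "y = (\<lambda>a u. mpow B (gram n (E a)) B u (amax (\<lambda>v. \<Sum>u<B. (mpow B (gram n (E a)) B u v)\<^sup>2) B))"
  have xE: "x w1 a = mvec B (E a) (y a)" for a
    by (simp add: x_def E_def y_def B_def direction_def)
  have Bpos: "B > 0" by (simp add: B_def)
  interpret deflation n B E "x w1" y
  proof
    show "x w1 a i = mvec B (E a) (y a) i" for a i by (simp add: xE)
    show "E (Suc a) i u = E a i u - x w1 a i * (ip n (x w1 a) (\<lambda>i. E a i u) / ip n (x w1 a) (x w1 a))" for a i u
      by (simp add: x_def E_def B_def deflate_def)
  qed
  define \<zeta> where "\<zeta> = (\<lambda>l j. ip B (sketch lb n w2 (normalized n (x w1 l))) (sketch lb n w2 (\<lambda>i. M i j)))"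
  have E0: "E 0 = (\<lambda>i. sketch lb n w1 (M i))" by (simp add: E_def)
  have \<zeta>_eq: "\<zeta> l j = ip B (sketch lb n w2 (x w1 l)) (sketch lb n w2 (\<lambda>i. M i j)) / sqrt (ip n (x w1 l) (x w1 l))" for l j
    by (simp add: \<zeta>_def sketch_normalized[abs_def] ip_scale)
  have err: "(\<Sum>i<n. \<Sum>j<n. (M i j - (\<Sum>l<k'. hat l i * \<zeta> l j))\<^sup>2) \<le>
    (\<Sum>i<n. \<Sum>j<n. (M i j - (\<Sum>l<k'. X l i * Y l j))\<^sup>2) + \<epsilon> * F" for X Y
    unfolding F_def
  proof (rule low_rank_error)
    show "(1 - \<epsilon> / 4) * (\<Sum>u<B. (ip n z (\<lambda>i. E a i u))\<^sup>2) \<le> ip n z z * (\<Sum>u<B. (ip n (hat a) (\<lambda>i. E a i u))\<^sup>2)" for a z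
      by (rule power_iteration[where q = B and ?i0.0 = "amax (\<lambda>v. \<Sum>u<B. (mpow B (gram n (E a)) B u v)\<^sup>2) B"])
        (use \<epsilon> Bpos amax_less[of B] amax_max[of _ B] power_iteration_count[OF \<epsilon>, of B] b xE
          in \<open>simp_all add: y_def B_def\<close>)
    show "0 < \<epsilon>" "\<epsilon> \<le> 1" by fact+
    show "real k' * (\<Sum>i<n. \<Sum>j<n. (ip B (E 0 i) (E 0 j) - ip n (M i) (M j))\<^sup>2) \<le> (\<epsilon> / 8 * (\<Sum>i<n. \<Sum>j<n. (M i j)\<^sup>2))\<^sup>2"
      using good1 by (simp add: E0 B_def F_def)
    show "\<zeta> l j = 0" if "ip n (x w1 l) (x w1 l) = 0" for l j using that by (simp add: \<zeta>_eq)
    show "(\<Sum>l<k'. \<Sum>j<n. (ip n (hat l) (\<lambda>i. M i j) - \<zeta> l j)\<^sup>2) \<le> \<epsilon> / 2 * (\<Sum>i<n. \<Sum>j<n. (M i j)\<^sup>2)"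
      using good2 by (simp add: \<zeta>_def B_def F_def power2_commute)
  qed
  have entries: "output_matrix n s $$ (i,j) = (\<Sum>l<k'. hat l i * \<zeta> l j)" if "i < n" "j < n" for i j
  proof -
    have "output_matrix n s $$ (i,j) = (\<Sum>l<k'. val s ''X'' i l * val s ''Y'' j l)"
      using that by (simp add: output_matrix_def r)
    also have "\<dots> = (\<Sum>l<k'. hat l i * \<zeta> l j)"
    proof (rule sum.cong[OF refl])
      fix l assume "l \<in> {..<k'}"
      then have "val s ''X'' i l * val s ''Y'' j l =
          x w1 l i * (ip B (sketch lb n w2 (x w1 l)) (sketch lb n w2 (\<lambda>i. M i j)) / ip n (x w1 l) (x w1 l))"
        using X Y that by (simp add: B_def)
      \<comment> \<open>The squared norm is split into two square roots, one normalizing the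
        direction and one the coefficient. For a zero direction division by 0 makes both sides
        0.\<close>
      also have "\<dots> = x w1 l i * ip B (sketch lb n w2 (x w1 l)) (sketch lb n w2 (\<lambda>i. M i j)) /
          (sqrt (ip n (x w1 l) (x w1 l)) * sqrt (ip n (x w1 l) (x w1 l)))" by simp
      also have "\<dots> = hat l i * \<zeta> l j" unfolding \<zeta>_eq normalized_def by simp
      finally show "val s ''X'' i l * val s ''Y'' j l = hat l i * \<zeta> l j" .
    qed
    finally show ?thesis .
  qed
  show ?thesis
  proof (rule bicriteria_solutionI[OF n A Wc W \<epsilon>(1) k'])
    show oc: "output_matrix n s \<in> carrier_mat n n" by (simp add: output_matrix_def)
    show "mat_rank (output_matrix n s) \<le> k'"
      using rank_of_factorization[of n "val s ''X''" "val s ''Y''" k'] by (simp add: output_matrix_def r)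
    show "(\<Sum>i<n. \<Sum>j<n. (A $$ (i,j) * W $$ (i,j) - output_matrix n s $$ (i,j))\<^sup>2) \<le>
      (\<Sum>i<n. \<Sum>j<n. (A $$ (i,j) * W $$ (i,j) - (\<Sum>l<k'. X l i * Y l j))\<^sup>2) + \<epsilon> * (\<Sum>i<n. \<Sum>j<n. (A $$ (i,j) * W $$ (i,j))\<^sup>2)" for X Y
      using err[of X Y] by (simp add: entries M_def F_def)
  qed
qed

text \<open>Apart from the pass over the entries, the rounds contribute 250 and the remaining terms,
  each at most \<open>n * k' * b ^ 4\<close>, have coefficients adding up to 37.\<close>

lemma LowRank_time:
  fixes n b lb N k' :: nat
  assumes "n \<ge> 1" "k' \<ge> 1" "b = 2 ^ lb"
  shows "lowrank_steps n lb N k' \<le> 4 * N + 300 * (n * k' * b ^ 4)"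
proof -
  define B where "B = n * k' * b ^ 4"
  have b1: "b \<ge> 1" and lbb: "lb \<le> b" using assms(3) less_exp[of lb] by auto
  have bb: "b \<le> b ^ 4" "1 \<le> b ^ 4" using power_increasing[of 1 4 b] b1 by simp_all
  have le: "p * q * c \<le> B" if "p \<le> n" "q \<le> k'" "c \<le> b ^ 4" for p q c
    unfolding B_def using that by (intro mult_le_mono) auto
  have "lb \<le> b ^ 4" using lbb bb(1) by (rule order_trans)
  then have "lb \<le> B" "n \<le> B" "n * lb \<le> B" "1 \<le> B" "k' \<le> B"
    using le[of 1 1 lb] le[of n 1 1] le[of n 1 lb] le[of 1 1 1] le[of 1 k' 1] assms(1,2) bb(2) by simp_all
  moreover have "k' * (250 * (n * b ^ 4) + 2) = 250 * B + 2 * k'" by (simp add: B_def algebra_simps)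
  moreover have "n * (7 + 4 * lb) = 7 * n + 4 * (n * lb)" by (simp add: algebra_simps)
  ultimately show ?thesis unfolding lowrank_steps_def assms(3)[symmetric] B_def[symmetric] by linarith
qed

text \<open>With \<open>z = k' / \<epsilon>\<close>, there are at most \<open>3 * K * z^2\<close>
  buckets. Their fourth power times \<open>k' \<le> z\<close> is at most
  \<open>81 * K^4 * z^9\<close>, and 300 * 81 = 24300. The constant term 2 pays for the test and the
  skip when \<epsilon> is large, where \<open>z\<close> may be tiny.\<close>

lemma runs_within_LowRank:
  fixes \<delta> \<epsilon> :: real and A W :: "real mat"
  assumes \<delta>: "0 < \<delta>" and K: "\<delta> * real K \<ge> 256" "K \<ge> 256"
    and n: "n = 2 ^ m" and A: "A \<in> carrier_mat n n" and Wc: "W \<in> carrier_mat n n"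
    and W: "\<forall>i<n. \<forall>j<n. W $$ (i,j) \<in> {0, 1}" and k: "k \<ge> 1" and \<epsilon>: "\<epsilon> > 0"
    and k': "k' = k * 2 ^ one_sided_cc m \<epsilon> (\<lambda>x y. \<not> computed_by W x y)"
    and es: "distinct es" "set es = support A"
  shows "runs_within (LowRank K) (input_memory n k' \<epsilon> A es W)
     (4 * real (nnz A) + real n * poly ([:2:] + monom (24300 * real K ^ 4) 9) (real k' / \<epsilon>)) \<delta>
     (\<lambda>s. bicriteria_solution n A W k k' \<epsilon> (output_matrix n s))"
proof (cases "\<epsilon> < 1 / 2")
  case False
  let ?s = "input_memory n k' \<epsilon> A es W"
  have n1: "real n \<ge> 1" using n by simp
  have ex: "exec (LowRank K) ?s cs (1 + 1) ?s cs" for cs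
    unfolding LowRank_def by (rule exec.CondFalse[OF _ exec.Skip]) (use False in \<open>simp add: input_memory_def\<close>)
  have "output_matrix n ?s = 0\<^sub>m n n"
    by (auto simp: output_matrix_def input_memory_def)
  then have good: "bicriteria_solution n A W k k' \<epsilon> (output_matrix n ?s)"
    using bicriteria_solution_zero[OF A Wc] False by simp
  have "poly ([:2:] + monom (24300 * real K ^ 4) 9) (real k' / \<epsilon>) \<ge> 2"
    using \<epsilon> by (simp add: poly_monom)
  then have "real n * poly ([:2:] + monom (24300 * real K ^ 4) 9) (real k' / \<epsilon>) \<ge> 1 * 2"
    using n1 by (intro mult_mono) auto
  then have time: "real (1 + 1) \<le> 4 * real (nnz A) + real n * poly ([:2:] + monom (24300 * real K ^ 4) 9) (real k' / \<epsilon>)"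
    by simp
  show ?thesis unfolding runs_within_def
  proof (intro exI[of _ 0] conjI)
    show "\<forall>cs. length cs = 0 \<longrightarrow> (\<exists>t s' cs'. exec (LowRank K) ?s cs t s' cs' \<and>
      real t \<le> 4 * real (nnz A) + real n * poly ([:2:] + monom (24300 * real K ^ 4) 9) (real k' / \<epsilon>))"
      using ex time by blast
    have "(\<lambda>cs. of_bool (cs \<in> {cs. \<exists>t s' cs'. exec (LowRank K) ?s cs t s' cs' \<and> bicriteria_solution n A W k k' \<epsilon> (output_matrix n s')})) = (\<lambda>cs. 1::real)"
      using ex good by (intro ext) auto
    then show "1 - \<delta> \<le> measure_pmf.prob (pmf_of_set {cs. length cs = 0})
      {cs. \<exists>t s' cs'. exec (LowRank K) ?s cs t s' cs' \<and> bicriteria_solution n A W k k' \<epsilon> (output_matrix n s')}"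
      unfolding prob_coins using \<delta> by simp
  qed
next
  case True
  let ?s = "input_memory n k' \<epsilon> A es W"
  define M where "M = (\<lambda>i j. A $$ (i,j) * W $$ (i,j))"
  have n1: "n \<ge> 1" using n by simp
  have k'1: "k' \<ge> 1" using k k' by simp
  define z where "z = real k' / \<epsilon>"
  have z: "z \<ge> 1" "real k' \<le> z" "1 / \<epsilon> \<le> z" using k'1 \<epsilon> True by (auto simp: z_def field_simps)
  obtain lb where lb: "real K * z\<^sup>2 \<le> 2 ^ lb" "2 ^ lb \<le> 1 + 2 * (real K * z\<^sup>2)"
    and run: "\<And>w1 w2. length w1 = n * Suc lb \<Longrightarrow> length w2 = n * Suc lb \<Longrightarrow>
      run (LowRank K) ?s (w1 @ w2)
        (lowrank_steps n lb (length es) k')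
        (\<lambda>s' cs'. sketched_output n k' lb M w1 w2 s')"
    using run_LowRank[OF n1 A es True, of K k' W] unfolding z_def M_def by blast
  define T where "T = lowrank_steps n lb (length es) k'"
  have time: "real T \<le> 4 * real (nnz A) + real n * poly ([:2:] + monom (24300 * real K ^ 4) 9) z"
  proof -
    have len: "length es = nnz A" using distinct_card[OF es(1)] es(2) by (simp add: nnz_def)
    have "T \<le> 4 * length es + 300 * (n * k' * (2 ^ lb) ^ 4)"
      unfolding T_def by (rule LowRank_time[OF n1 k'1 refl])
    then have "real T \<le> real (4 * length es + 300 * (n * k' * (2 ^ lb) ^ 4))" by (simp only: of_nat_le_iff)
    then have T: "real T \<le> 4 * real (nnz A) + real n * (300 * (real k' * (2 ^ lb) ^ 4))" by (simp add: len)
    have "1 \<le> real K * z\<^sup>2" using K(2) z(1) by (simp add: mult_ge1_I)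
    then have "(2::real) ^ lb \<le> 3 * (real K * z\<^sup>2)" using lb(2) by simp
    then have "((2::real) ^ lb) ^ 4 \<le> (3 * (real K * z\<^sup>2)) ^ 4" by (intro power_mono) auto
    then have "real k' * (2 ^ lb) ^ 4 \<le> z * (3 * (real K * z\<^sup>2)) ^ 4" using z by (intro mult_mono) auto
    also have "\<dots> = 81 * real K ^ 4 * z ^ 9"
      by (simp add: power_mult_distrib power_mult[symmetric]) (simp add: power_Suc[symmetric] del: power_Suc)
    finally have "300 * (real k' * (2 ^ lb) ^ 4) \<le> poly ([:2:] + monom (24300 * real K ^ 4) 9) z"
      by (simp add: poly_monom)
    then have "real n * (300 * (real k' * (2 ^ lb) ^ 4)) \<le> real n * poly ([:2:] + monom (24300 * real K ^ 4) 9) z"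
      by (intro mult_left_mono) auto
    then show ?thesis using T by linarith
  qed
  define N where "N = n * Suc lb"
  define H where "H = (\<lambda>w l. normalized n (directions n (2 ^ lb) (\<lambda>i. sketch lb n w (M i)) l))"
  define F where "F = (\<Sum>i<n. \<Sum>j<n. (M i j)\<^sup>2)"
  define bad1 where "bad1 = (\<lambda>w. (\<epsilon> / 8 * F)\<^sup>2 < real k' * (\<Sum>i<n. \<Sum>j<n.
      (ip (2 ^ lb) (sketch lb n w (M i)) (sketch lb n w (M j)) - ip n (M i) (M j))\<^sup>2))"
  define bad2 where "bad2 = (\<lambda>w w'. \<epsilon> / 2 * F < (\<Sum>l<k'. \<Sum>j<n.
      (ip (2 ^ lb) (sketch lb n w' (H w l)) (sketch lb n w' (\<lambda>i. M i j)) - ip n (H w l) (\<lambda>i. M i j))\<^sup>2))"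
  have bad: "cavg (N + N) (\<lambda>cs. of_bool (bad1 (take N cs) \<or> bad2 (take N cs) (drop N cs))) \<le> \<delta>"
    unfolding N_def bad1_def bad2_def F_def
  proof (rule cavg_sketch_good[where K = "real K"])
    show "2 ^ lb \<ge> real K * (real k' / \<epsilon>)\<^sup>2" using lb(1) by (simp add: z_def)
    show "ip n (H w l) (H w l) \<le> 1" for w l by (simp add: H_def ip_normalized_self)
  qed (use \<epsilon> True k'1 \<delta> K in auto)
  \<comment> \<open>Needed for the \<open>b\<close> power steps to converge; it rests on
    \<open>K \<ge> 256\<close> and not on \<delta>.\<close>
  have big: "2 ^ lb * \<epsilon>\<^sup>2 \<ge> (256::real)"
  proof -
    have "256 * (1 / \<epsilon>)\<^sup>2 \<le> real K * z\<^sup>2" using K(2) z(3) \<epsilon> by (intro mult_mono power_mono) auto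
    then have "256 * (1 / \<epsilon>)\<^sup>2 \<le> 2 ^ lb" using lb(1) by simp
    then show ?thesis using \<epsilon> by (simp add: power_divide field_simps)
  qed
  have success: "\<exists>t s' cs'. exec (LowRank K) ?s cs t s' cs' \<and> t \<le> T \<and>
      (\<not> (bad1 (take N cs) \<or> bad2 (take N cs) (drop N cs)) \<longrightarrow> bicriteria_solution n A W k k' \<epsilon> (output_matrix n s'))"
    if "length cs = N + N" for cs
  proof -
    define w1 w2 where "w1 = take N cs" and "w2 = drop N cs"
    have w: "length w1 = n * Suc lb" "length w2 = n * Suc lb" "cs = w1 @ w2"
      using that by (simp_all add: w1_def w2_def N_def)
    obtain t s' cs' where e: "exec (LowRank K) ?s cs t s' cs'" "t \<le> T"
      and out: "sketched_output n k' lb M w1 w2 s'"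
      using run[OF w(1,2)] unfolding run_def w(3) T_def by blast
    have "bicriteria_solution n A W k k' \<epsilon> (output_matrix n s')" if g: "\<not> bad1 w1" "\<not> bad2 w1 w2"
      by (rule LowRank_output[OF n A Wc W \<epsilon> _ k' big, of w1 w2 s'])
        (use g out True in \<open>simp_all add: bad1_def bad2_def F_def H_def not_less M_def\<close>)
    then show ?thesis using e unfolding w1_def w2_def by blast
  qed
  show ?thesis unfolding runs_within_def
  proof (rule exI[of _ "N + N"], intro conjI allI impI)
    fix cs :: "bool list" assume "length cs = N + N"
    then show "\<exists>t s' cs'. exec (LowRank K) ?s cs t s' cs' \<and>
      real t \<le> 4 * real (nnz A) + real n * poly ([:2:] + monom (24300 * real K ^ 4) 9) (real k' / \<epsilon>)"
      using success[of cs] time unfolding z_def by (meson of_nat_mono order_trans)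
  next
    let ?S = "{cs. \<exists>t s' cs'. exec (LowRank K) ?s cs t s' cs' \<and> bicriteria_solution n A W k k' \<epsilon> (output_matrix n s')}"
    have "1 = cavg (N + N) (\<lambda>cs. 1)" by simp
    \<comment> \<open>Every coin string is bad or successful, so the two frequencies add up to at
      least 1.\<close>
    also have "\<dots> \<le> cavg (N + N) (\<lambda>cs. of_bool (bad1 (take N cs) \<or> bad2 (take N cs) (drop N cs)) + of_bool (cs \<in> ?S))"
    proof (rule cavg_mono)
      fix cs :: "bool list" assume "length cs = N + N"
      then show "1 \<le> of_bool (bad1 (take N cs) \<or> bad2 (take N cs) (drop N cs)) + (of_bool (cs \<in> ?S) :: real)"
        using success[of cs] by (cases "bad1 (take N cs) \<or> bad2 (take N cs) (drop N cs)") auto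
    qed
    also have "\<dots> \<le> \<delta> + cavg (N + N) (\<lambda>cs. of_bool (cs \<in> ?S))" unfolding cavg_add using bad by simp
    finally show "1 - \<delta> \<le> measure_pmf.prob (pmf_of_set {cs. length cs = N + N}) ?S"
      unfolding prob_coins by simp
  qed
qed

text \<open>Positive success probability leaves at least one successful coin string, which turns the
  algorithm into a proof of existence.\<close>

lemma runs_within_imp_output:
  assumes "runs_within c s T \<delta> Q" "\<delta> < 1"
  shows "\<exists>s'. Q s'"
proof (rule ccontr)
  assume "\<nexists>s'. Q s'"
  then have "{cs. \<exists>t s' cs'. exec c s cs t s' cs' \<and> Q s'} = {}" by blast
  then show False using assms unfolding runs_within_def by (simp del: Collect_empty_eq)
qed

theorem theorem1:
  shows "(\<forall>m n A W k \<epsilon> k'.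
            n = 2 ^ m \<and> A \<in> carrier_mat n n \<and> W \<in> carrier_mat n n \<and>
            (\<forall>i<n. \<forall>j<n. W $$ (i,j) \<in> {0, 1}) \<and> k \<ge> 1 \<and> \<epsilon> > 0 \<and>
            k' = k * 2 ^ one_sided_cc m \<epsilon> (\<lambda>x y. \<not> computed_by W x y) \<longrightarrow>
            (\<exists>L. bicriteria_solution n A W k k' \<epsilon> L))
       \<and> (\<forall>\<delta>::real. 0 < \<delta> \<and> \<delta> < 1 \<longrightarrow>
            (\<exists>(P::com) (C::real) (p::real poly). \<forall>m n A W k \<epsilon> k' es.
              n = 2 ^ m \<and> A \<in> carrier_mat n n \<and> W \<in> carrier_mat n n \<and>
              (\<forall>i<n. \<forall>j<n. W $$ (i,j) \<in> {0, 1}) \<and> k \<ge> 1 \<and> \<epsilon> > 0 \<and>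
              k' = k * 2 ^ one_sided_cc m \<epsilon> (\<lambda>x y. \<not> computed_by W x y) \<and>
              distinct es \<and> set es = support A \<longrightarrow>
              runs_within P (input_memory n k' \<epsilon> A es W)
                (C * real (nnz A) + real n * poly p (real k' / \<epsilon>)) \<delta>
                (\<lambda>s. bicriteria_solution n A W k k' \<epsilon> (output_matrix n s))))"
proof (intro conjI allI impI)
  fix m n k k' :: nat and A W :: "real mat" and \<epsilon> :: real
  assume a: "n = 2 ^ m \<and> A \<in> carrier_mat n n \<and> W \<in> carrier_mat n n \<and>
            (\<forall>i<n. \<forall>j<n. W $$ (i,j) \<in> {0, 1}) \<and> k \<ge> 1 \<and> \<epsilon> > 0 \<and>
            k' = k * 2 ^ one_sided_cc m \<epsilon> (\<lambda>x y. \<not> computed_by W x y)"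
  have "finite (support A)"
    by (rule finite_subset[of _ "{..<dim_row A} \<times> {..<dim_col A}"]) (auto simp: support_def)
  then obtain es where es: "distinct es" "set es = support A" using finite_distinct_list by metis
  \<comment> \<open>512 is 256 / \<delta> for \<delta> = 1/2.\<close>
  have "runs_within (LowRank 512) (input_memory n k' \<epsilon> A es W)
     (4 * real (nnz A) + real n * poly ([:2:] + monom (24300 * real 512 ^ 4) 9) (real k' / \<epsilon>)) (1 / 2)
     (\<lambda>s. bicriteria_solution n A W k k' \<epsilon> (output_matrix n s))"
    by (rule runs_within_LowRank[where m = m]) (use a es in auto)
  then show "\<exists>L. bicriteria_solution n A W k k' \<epsilon> L"
    using runs_within_imp_output[of "LowRank 512"] by fastforce
next
  fix \<delta> :: real assume \<delta>: "0 < \<delta> \<and> \<delta> < 1"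
  \<comment> \<open>For \<delta> < 1 this choice also gives \<open>K \<ge> 256\<close>, so both
    requirements on \<open>K\<close> are met.\<close>
  define K where "K = nat \<lceil>256 / \<delta>\<rceil>"
  have "256 / \<delta> \<le> real K" unfolding K_def by linarith
  then have K: "\<delta> * real K \<ge> 256" using \<delta> by (simp add: field_simps)
  have "\<delta> * real K \<le> 1 * real K" using \<delta> by (intro mult_right_mono) auto
  then have K2: "K \<ge> 256" using K by simp
  show "\<exists>(P::com) (C::real) (p::real poly). \<forall>m n A W k \<epsilon> k' es.
              n = 2 ^ m \<and> A \<in> carrier_mat n n \<and> W \<in> carrier_mat n n \<and>
              (\<forall>i<n. \<forall>j<n. W $$ (i,j) \<in> {0, 1}) \<and> k \<ge> 1 \<and> \<epsilon> > 0 \<and>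
              k' = k * 2 ^ one_sided_cc m \<epsilon> (\<lambda>x y. \<not> computed_by W x y) \<and>
              distinct es \<and> set es = support A \<longrightarrow>
              runs_within P (input_memory n k' \<epsilon> A es W)
                (C * real (nnz A) + real n * poly p (real k' / \<epsilon>)) \<delta>
                (\<lambda>s. bicriteria_solution n A W k k' \<epsilon> (output_matrix n s))"
  proof (intro exI allI impI)
    fix m n k k' :: nat and A W :: "real mat" and \<epsilon> :: real and es :: "(nat \<times> nat) list"
    assume "n = 2 ^ m \<and> A \<in> carrier_mat n n \<and> W \<in> carrier_mat n n \<and>
              (\<forall>i<n. \<forall>j<n. W $$ (i,j) \<in> {0, 1}) \<and> k \<ge> 1 \<and> \<epsilon> > 0 \<and>
              k' = k * 2 ^ one_sided_cc m \<epsilon> (\<lambda>x y. \<not> computed_by W x y) \<and>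
              distinct es \<and> set es = support A"
    then show "runs_within (LowRank K) (input_memory n k' \<epsilon> A es W)
       (4 * real (nnz A) + real n * poly ([:2:] + monom (24300 * real K ^ 4) 9) (real k' / \<epsilon>)) \<delta>
       (\<lambda>s. bicriteria_solution n A W k k' \<epsilon> (output_matrix n s))"
      using runs_within_LowRank[OF _ K K2, where m = m] \<delta> by auto
  qed
qed

end
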